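(* Let $n$ be a positive integer, let $K_{\triangle^{n}}$ be a finite simplicial $n$-complex containing a subcomplex $\triangle^n$ isomorphic to the boundary of an $(n+1)$-simplex, and let $K_{Y^{n}}$ be the simplicial $n$-complex obtained from $K_{\triangle^n}$ by the $\triangle Y(n)$-exchange at $\triangle^n$. If for any embedding $f'$ of $K_{\triangle^{n}}$ into $\mathbb{R}^{2n+1}$ there exists a pair $\lambda'$ in $\Lambda^{n}(K_{\triangle^{n}})$ such that $\mathrm{lk}_{2}(f'(\lambda'))=1$, then for any embedding $f$ of $K_{Y^{n}}$ into $\mathbb{R}^{2n+1}$ there exists a pair $\lambda$ in $\Lambda^{n}(K_{Y^{n}})$ such that $\mathrm{lk}_{2}(f(\lambda))=1$.
   Context: Everything (embeddings, spheres, homeomorphisms) is in the piecewise linear category; a finite simplicial complex is identified with its polyhedron. For a finite simplicial $n$-complex $K$, $\Lambda^{n}(K)$ denotes the set of all unordered pairs $(\gamma_1,\gamma_2)$ of mutually disjoint subcomplexes of $K$, each homeomorphic to an $n$-sphere; such a pair is identified with the disjoint union $\lambda=\gamma_1\sqcup\gamma_2$. For an embedding $f$ of $K$ into $\mathbb{R}^{2n+1}$, $f(\lambda)=f(\gamma_1)\sqcup f(\gamma_2)$ is a two-component link of $n$-spheres, and $\mathrm{lk}_2(f(\lambda))=\mathrm{lk}_2(f(\gamma_1),f(\gamma_2))\in\mathbb{Z}_2$ is its mod 2 linking number. $\triangle Y(n)$-exchange: let $K_{\triangle^{n}}$ be a simplicial $n$-complex containing an $n$-subcomplex $\triangle^{n}$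 isomorphic to, and identified with, the boundary $\partial\sigma_{n+1}$ of an $(n+1)$-simplex $\sigma_{n+1}=|a_0a_1\cdots a_{n+1}|$. Let $\sigma_{n+1}^{n-1}$ be the $(n-1)$-skeleton of $\sigma_{n+1}$, let $x$ be a new $0$-simplex, and let $Y^n=\sigma_{n+1}^{n-1}*x$ (the join). Then $K_{Y^{n}}$ is the simplicial $n$-complex obtained from $K_{\triangle^n}$ by replacing $\triangle^{n}$ with $Y^{n}$; i.e. the $n+2$ $n$-simplices of $\triangle^n$ are removed (all their proper faces are kept), and the cone $\sigma_{n+1}^{n-1}*x$ is added. *)

theory Defs
  imports "HOL-Analysis.Analysis" "HOL-Library.Z2"
begin

section \<open>Finite simplicial complexes\<close>

text \<open>
  Complexes are given by their nonempty simplices, each as its vertex set. The vertices come from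
  a finite type that may have elements which are not vertices, and the polyhedron of a complex is
  its standard geometric realization in the Euclidean space with one coordinate per element.
\<close>

definition is_complex :: "'v set set \<Rightarrow> bool" where
  "is_complex K \<longleftrightarrow> finite K \<and> (\<forall>s\<in>K. finite s \<and> s \<noteq> {}) \<and>
     (\<forall>s\<in>K. \<forall>t. t \<subseteq> s \<and> t \<noteq> {} \<longrightarrow> t \<in> K)"

definition is_n_complex :: "nat \<Rightarrow> 'v set set \<Rightarrow> bool" where
  "is_n_complex n K \<longleftrightarrow> is_complex K \<and> (\<forall>s\<in>K. card s \<le> n + 1) \<and> (\<exists>s\<in>K. card s = n + 1)"

definition subcomplex :: "'v set set \<Rightarrow> 'v set set \<Rightarrow> bool" where
  "subcomplex L K \<longleftrightarrow> is_complex L \<and> L \<subseteq> K"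

definition vertex_point :: "'v::finite \<Rightarrow> real ^ 'v" where
  "vertex_point v = axis v 1"

definition realization :: "'v::finite set set \<Rightarrow> (real ^ 'v) set" where
  "realization K = (\<Union>s\<in>K. convex hull (vertex_point ` s))"

definition full_simplex :: "'v set \<Rightarrow> 'v set set" where
  "full_simplex A = {s. s \<subseteq> A \<and> s \<noteq> {}}"

definition simplex_boundary :: "'v set \<Rightarrow> 'v set set" where
  "simplex_boundary A = {s. s \<subset> A \<and> s \<noteq> {}}"

definition skeleton :: "nat \<Rightarrow> 'v set set \<Rightarrow> 'v set set" where
  "skeleton k K = {s\<in>K. card s \<le> k + 1}"

text \<open>The two factors of a join are meant to have no vertex in common.\<close>

definition join_complex :: "'v set set \<Rightarrow> 'v set set \<Rightarrow> 'v set set" where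
  "join_complex K L = K \<union> L \<union> {s \<union> t |s t. s \<in> K \<and> t \<in> L}"

section \<open>The exchange\<close>

text \<open>
  Here \<open>A = {a\<^sub>0, \<dots>, a\<^bsub>n+1\<^esub>}\<close> is the vertex set of \<open>\<sigma>\<^bsub>n+1\<^esub>\<close> and \<open>x\<close> is the new vertex.
\<close>

definition Y_complex :: "nat \<Rightarrow> 'v set \<Rightarrow> 'v \<Rightarrow> 'v set set" where
  "Y_complex n A x = join_complex (skeleton (n - 1) (full_simplex A)) {{x}}"

definition Delta_Y_exchange :: "nat \<Rightarrow> 'v set \<Rightarrow> 'v \<Rightarrow> 'v set set \<Rightarrow> 'v set set" where
  "Delta_Y_exchange n A x K =
     (K - {s \<in> simplex_boundary A. card s = n + 1}) \<union> Y_complex n A x"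

lemma is_n_complex_Delta_Y_exchange:
  assumes "n \<ge> 1" "is_n_complex n K" "card A = n + 2" "x \<notin> \<Union>K" "simplex_boundary A \<subseteq> K"
  shows "is_n_complex n (Delta_Y_exchange n A x K)"
proof -
  have cK: "is_complex K" and dim: "\<And>s. s \<in> K \<Longrightarrow> card s \<le> n + 1"
    using assms(2) by (auto simp: is_n_complex_def)
  have finA: "finite A" by (rule card_ge_0_finite) (simp add: assms(3))
  have AK: "s \<in> K" if "s \<subseteq> A" "s \<noteq> {}" "card s \<le> n + 1" for s
  proof -
    have "s \<noteq> A" using that(3) assms(3) by auto
    then show ?thesis using that assms(5) by (auto simp: simplex_boundary_def)
  qed
  have xA: "x \<notin> A"
  proof
    assume "x \<in> A"
    then have "{x} \<in> K" using AK by simp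
    then show False using assms(4) by blast
  qed
  define S where "S = skeleton (n - 1) (full_simplex A)"
  have S: "s \<in> S \<longleftrightarrow> s \<subseteq> A \<and> s \<noteq> {} \<and> card s \<le> n" for s
    using assms(1) by (auto simp: S_def skeleton_def full_simplex_def)
  define E where "E = Delta_Y_exchange n A x K"
  have E: "s \<in> E \<longleftrightarrow> (s \<in> K \<and> \<not> (s \<subset> A \<and> card s = n + 1)) \<or> s \<in> S \<or> s = {x} \<or>
      (\<exists>t\<in>S. s = insert x t)" for s
  proof -
    have Y: "Y_complex n A x = S \<union> {{x}} \<union> insert x ` S"
      unfolding Y_complex_def S_def join_complex_def by auto
    have "s \<in> K \<Longrightarrow> s \<noteq> {}" using cK by (simp add: is_complex_def)
    then show ?thesis unfolding E_def Delta_Y_exchange_def Y simplex_boundary_def by blast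
  qed
  have finS: "finite S" by (rule finite_subset[of _ "Pow A"]) (use S finA in auto)
  have Ecases: "(s \<in> K \<and> \<not> (s \<subset> A \<and> card s = n + 1)) \<or> s \<in> S \<or> s = {x} \<or> (\<exists>r\<in>S. s = insert x r)"
    if "s \<in> E" for s using that E by blast
  have EI: "s \<in> K \<Longrightarrow> \<not> (s \<subset> A \<and> card s = n + 1) \<Longrightarrow> s \<in> E" "s \<in> S \<Longrightarrow> s \<in> E" "{x} \<in> E"
    "s \<in> S \<Longrightarrow> insert x s \<in> E" for s unfolding E by blast+
  have finK: "finite K" "\<And>s. s \<in> K \<Longrightarrow> finite s \<and> s \<noteq> {}"
    using cK by (auto simp: is_complex_def)
  have Sfin: "finite s \<and> s \<noteq> {} \<and> card s \<le> n" if "s \<in> S" for s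
    using that S finA finite_subset by blast
  have "E \<subseteq> K \<union> S \<union> {{x}} \<union> insert x ` S" using Ecases by blast
  moreover have "finite (K \<union> S \<union> {{x}} \<union> insert x ` S)" using finK finS by simp
  ultimately have "finite E" by (rule finite_subset)
  moreover have "finite s \<and> s \<noteq> {}" if "s \<in> E" for s
    using Ecases[OF that] finK(2) Sfin by (metis finite.emptyI finite_insert insert_not_empty)
  moreover have "t \<in> E" if "s \<in> E" "t \<subseteq> s" "t \<noteq> {}" for s t
  proof -
    have Sd: "u \<in> S" if "r \<in> S" "u \<subseteq> r" "u \<noteq> {}" for r u
    proof -
      have "finite r" "card r \<le> n" "r \<subseteq> A" using Sfin[OF that(1)] S that(1) by blast+
      moreover have "card u \<le> card r" using card_mono that(2) \<open>finite r\<close> by blast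
      ultimately show ?thesis unfolding S using that by auto
    qed
    consider "s \<in> K" "\<not> (s \<subset> A \<and> card s = n + 1)" | "s \<in> S" | "s = {x}"
      | r where "r \<in> S" "s = insert x r" using Ecases[OF \<open>s \<in> E\<close>] by metis
    then show ?thesis
    proof cases
      case 1
      have "t \<in> K" using cK 1(1) that(2,3) unfolding is_complex_def by blast
      moreover have "\<not> (t \<subset> A \<and> card t = n + 1)"
      proof
        assume t: "t \<subset> A \<and> card t = n + 1"
        have "finite s" using finK(2) 1(1) by blast
        then have "t = s" using dim[OF 1(1)] t that by (metis card_seteq)
        then show False using t 1 by blast
      qed
      ultimately show ?thesis by (rule EI(1))
    next
      case 2 then show ?thesis using Sd that EI(2) by blast
    next
      case 3
      then have "t = {x}" using that by blast
      then show ?thesis using EI(3) by simp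
    next
      case 4
      show ?thesis
      proof (cases "x \<in> t")
        case True
        then have "t = insert x (t - {x})" "t - {x} \<subseteq> r" using that 4 by auto
        then show ?thesis using Sd[OF 4(1), of "t - {x}"] EI(3) EI(4)[of "t - {x}"]
          by (cases "t - {x} = {}") auto
      next
        case False
        then show ?thesis using Sd[OF 4(1), of t] that 4 EI(2)[of t] by blast
      qed
    qed
  qed
  moreover have "card s \<le> n + 1" if "s \<in> E" for s
  proof -
    consider "s \<in> K" | "s \<in> S" | "s = {x}" | r where "r \<in> S" "s = insert x r"
      using Ecases[OF \<open>s \<in> E\<close>] by metis
    then show ?thesis
    proof cases
      case 1 then show ?thesis using dim by blast
    next
      case 2 then show ?thesis using Sfin[of s] by simp
    next
      case 3 then show ?thesis by simp
    next
      case 4 then show ?thesis using Sfin[of r] by (simp add: card_insert_if)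
    qed
  qed
  moreover have "\<exists>s\<in>E. card s = n + 1"
  proof -
    obtain t where t: "t \<subseteq> A" "card t = n"
      using obtain_subset_with_card_n[of n A] assms(3) by auto
    then have "t \<in> S" using S assms(1) by auto
    moreover have "card (insert x t) = n + 1"
      using t xA finA finite_subset by (subst card_insert_disjoint) auto
    ultimately show ?thesis using EI(4)[of t] by blast
  qed
  ultimately show ?thesis unfolding E_def[symmetric] is_n_complex_def is_complex_def by blast
qed

section \<open>Piecewise linear maps\<close>

definition affine_map_on ::
    "'a::euclidean_space set \<Rightarrow> ('a \<Rightarrow> 'b::euclidean_space) \<Rightarrow> bool" where
  "affine_map_on T f \<longleftrightarrow> (\<exists>h c. linear h \<and> (\<forall>y\<in>T. f y = h y + c))"

definition pl_map_on ::
    "'a::euclidean_space set \<Rightarrow> ('a \<Rightarrow> 'b::euclidean_space) \<Rightarrow> bool" where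
  "pl_map_on X f \<longleftrightarrow>
     (\<exists>\<T>. simplicial_complex \<T> \<and> \<Union>\<T> = X \<and> (\<forall>T\<in>\<T>. affine_map_on T f))"

text \<open>
  By the definition above, the domain of a PL map is a compact polyhedron and the map is
  continuous on it, so an injective PL map is a homeomorphism onto its image.
\<close>

definition pl_embedding ::
    "'a::euclidean_space set \<Rightarrow> ('a \<Rightarrow> 'b::euclidean_space) \<Rightarrow> bool" where
  "pl_embedding X f \<longleftrightarrow> pl_map_on X f \<and> inj_on f X"

definition pl_homeomorphic ::
    "'a::euclidean_space set \<Rightarrow> 'b::euclidean_space set \<Rightarrow> bool" where
  "pl_homeomorphic X Y \<longleftrightarrow> (\<exists>f g. homeomorphism X Y f g \<and> pl_map_on X f \<and> pl_map_on Y g)"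

text \<open>
  The model of the PL \<open>n\<close>-sphere is the boundary of an \<open>(n+1)\<close>-simplex. That this simplex lies in
  the ambient space of \<open>X\<close> is no restriction, because a space containing a topological
  \<open>n\<close>-sphere has dimension at least \<open>n + 1\<close>.
\<close>

definition pl_sphere :: "nat \<Rightarrow> 'a::euclidean_space set \<Rightarrow> bool" where
  "pl_sphere n X \<longleftrightarrow> (\<exists>T :: 'a set. (int n + 1) simplex T \<and> pl_homeomorphic X (rel_frontier T))"

definition sphere_pairs :: "nat \<Rightarrow> 'v::finite set set \<Rightarrow> 'v set set set set" where
  "sphere_pairs n K = {{\<gamma>\<^sub>1, \<gamma>\<^sub>2} |\<gamma>\<^sub>1 \<gamma>\<^sub>2.
     subcomplex \<gamma>\<^sub>1 K \<and> subcomplex \<gamma>\<^sub>2 K \<and> realization \<gamma>\<^sub>1 \<inter> realization \<gamma>\<^sub>2 = {} \<and>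
     pl_sphere n (realization \<gamma>\<^sub>1) \<and> pl_sphere n (realization \<gamma>\<^sub>2)}"

section \<open>The mod 2 linking number\<close>

text \<open>
  For disjoint PL \<open>n\<close>-spheres \<open>X\<close>, \<open>Y\<close> in a space of dimension \<open>2n + 1\<close>, the mod 2 linking number
  is the mod 2 degree of the Gauss map \<open>X \<times> Y \<rightarrow> S\<^bsup>2n\<^esup>\<close>, \<open>(p, q) \<mapsto> (p - q) / \<bar>p - q\<bar>\<close>, that is, the
  parity of the number of preimages of a regular value. As \<open>X\<close> and \<open>Y\<close> are PL, the directions of
  almost all vectors \<open>v\<close> are regular values (finitely many preimages, each in the interior of a
  product of two \<open>n\<close>-simplices that is mapped injectively near it), and the parity is the same
  for all of these.
\<close>

definition gauss_preimage ::
    "'b::euclidean_space set \<Rightarrow> 'b set \<Rightarrow> 'b \<Rightarrow> ('b \<times> 'b) set" where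
  "gauss_preimage X Y v = {(p, q). p \<in> X \<and> q \<in> Y \<and> sgn (p - q) = sgn v}"

definition lk2 :: "'b::euclidean_space set \<Rightarrow> 'b set \<Rightarrow> bit" where
  "lk2 X Y = (if AE v in lborel. odd (card (gauss_preimage X Y v)) then 1 else 0)"

text \<open>The linking number is symmetric, hence a function of the unordered pair.\<close>

lemma lk2_commute: "lk2 X Y = lk2 Y (X :: 'b::euclidean_space set)"
proof -
  have *: "AE v in lborel. odd (card (gauss_preimage Y X v))"
    if "AE v in lborel. odd (card (gauss_preimage X Y v))" for X Y :: "'b set"
  proof -
    have sw: "gauss_preimage Y X v = prod.swap ` gauss_preimage X Y (- v)" for v
    proof -
      have "sgn (q - p) = sgn v \<longleftrightarrow> sgn (p - q) = sgn (- v)" for p q :: 'b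
        by (metis minus_diff_eq sgn_minus neg_equal_iff_equal)
      then show ?thesis by (force simp: gauss_preimage_def)
    qed
    have c: "card (gauss_preimage Y X v) = card (gauss_preimage X Y (- v))" for v
      unfolding sw by (simp add: card_image)
    have m: "distr lborel borel uminus = (lborel :: 'b measure)"
      using lborel_affine[of "-1" "0 :: 'b"] by (simp add: density_1)
    have "AE v in lborel. odd (card (gauss_preimage X Y (- v)))"
    proof (rule AE_distrD[of uminus lborel borel])
      show "AE v in distr lborel borel uminus. odd (card (gauss_preimage X Y v))"
        unfolding m by (rule that)
    qed simp
    then show ?thesis by (simp add: c)
  qed
  show ?thesis unfolding lk2_def using *[of X Y] *[of Y X] by auto
qed

end

theory Submission
  imports Defs
begin

text \<open>
  Let \<open>f\<close> embed the complex \<open>K\<^sub>Y\<close>. Each facet \<open>A - {a}\<close> of the removed simplex boundary is a PL disc with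
  the same boundary as the cone from \<open>x\<close> over the boundary of this facet, and the homeomorphism
  between them that takes \<open>x\<close> to the barycentre of the facet is linear on the simplices of the
  cone. Following its inverse by \<open>f\<close> gives a PL map of \<open>K\<close> that agrees with \<open>f\<close> outside the facets
  but overlaps itself, as two of the cones have simplices in common. The images of the facets have
  dimension \<open>n\<close> in a space of dimension \<open>2n + 1\<close>, so a generic displacement of the vertices inside
  the facets, by less than any given \<open>\<delta>\<close>, turns it into an embedding \<open>f'\<close>
  (\<open>exists_general_position\<close>, \<open>general_position_embeds\<close>).

  The hypothesis gives disjoint spheres \<open>\<gamma>\<close>, \<open>\<gamma>'\<close> in \<open>K\<close> whose images under \<open>f'\<close> are linked. Any two
  facets share a vertex, so at most one of the spheres contains facets. If none does, then \<open>f'\<close> and \<open>f\<close>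
  agree on both spheres. Otherwise let \<open>\<gamma>\<close> be the one that contains facets, and let \<open>I\<close> be the set of those \<open>a\<close> for which
  \<open>A - {a}\<close> belongs to \<open>\<gamma>\<close>. The facets in \<open>\<gamma>\<close> form the star of the face \<open>B = A - I\<close> in \<open>\<gamma>\<close>
  (\<open>sphere_star_of_facets\<close>, from invariance of domain), so replacing them by the cone from \<open>x\<close> over
  the boundary of their union is the stellar subdivision of \<open>\<gamma>\<close> at \<open>B\<close>. This is a sphere in
  \<open>K\<^sub>Y\<close>, unless \<open>B\<close> is empty, and still disjoint from \<open>\<gamma>'\<close> (\<open>pl_sphere_stellar\<close>, \<open>exchanged_subset_KY\<close>).

  Its image under \<open>f\<close> has the same linking number with \<open>f \<gamma>'\<close> as \<open>f' \<gamma>\<close>, for two reasons. First,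
  moving the perturbed vertices back sweeps \<open>(n+1)\<close>-simplices that stay within \<open>\<delta>\<close> of cones
  disjoint from \<open>f \<gamma>'\<close>, and the boundary of such a simplex meets a cycle along a generic direction
  in an even number of pairs (\<open>even_chain_count_boundary\<close>, \<open>chain_count_move_vertices\<close>). Secondly,
  after the vertices are back, an \<open>n\<close>-simplex of \<open>K\<^sub>Y\<close> through \<open>x\<close> is covered once for each of the two
  facets whose cones contain it, if this facet is in \<open>\<gamma>\<close>; modulo 2 this leaves the simplices of the new
  sphere (\<open>even_unfolded_exchanged\<close>). If \<open>\<gamma>\<close> contained all facets, everything would cancel, so
  this case contradicts the linking of \<open>f' \<gamma>\<close> and \<open>f \<gamma>'\<close>.

  Linking numbers are counted by linear algebra. For simplices with vertex sets \<open>S\<close> and \<open>T\<close>, the pairs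
  of points \<open>(p, q)\<close> for which \<open>p - q\<close> is a positive multiple of \<open>v\<close> are the nonnegative solutions of
  a linear system, and for almost all \<open>v\<close> no solution has more vanishing coordinates than the
  dimensions force.
\<close>

section \<open>Geometric complexes and piecewise linear maps\<close>

text \<open>
  Barycentric coordinates are functions on all possible vertices, zero outside the simplex, so that
  coordinates with respect to different simplices can be compared.
\<close>

definition weights :: "'p set \<Rightarrow> ('p \<Rightarrow> real) \<Rightarrow> bool" where
  "weights s u \<longleftrightarrow> (\<forall>v. 0 \<le> u v) \<and> (\<forall>v. v \<notin> s \<longrightarrow> u v = 0) \<and> sum u s = 1"

definition wsum :: "'p set \<Rightarrow> ('p \<Rightarrow> real) \<Rightarrow> ('p \<Rightarrow> 'e::real_vector) \<Rightarrow> 'e" where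
  "wsum s u a = (\<Sum>v\<in>s. u v *\<^sub>R a v)"

abbreviation point_at :: "'e set \<Rightarrow> ('e \<Rightarrow> real) \<Rightarrow> 'e::real_vector" where
  "point_at s u \<equiv> wsum s u (\<lambda>v. v)"

text \<open>
  The empty simplex is a member because a simplicial complex is closed under all faces of its
  simplices, including the empty one.
\<close>

definition scheme :: "'p set set \<Rightarrow> bool" where
  "scheme V \<longleftrightarrow> finite V \<and> (\<forall>s\<in>V. finite s \<and> Pow s \<subseteq> V)"

text \<open>
  This expresses at once that every simplex is mapped to an affinely independent set and that the
  images of two simplices meet in the image of their common face. It is a condition on the
  positions of the vertices alone, which is the form in which general position yields it.
\<close>

definition embeds :: "'p set set \<Rightarrow> ('p \<Rightarrow> 'e::real_vector) \<Rightarrow> bool" where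
  "embeds V a \<longleftrightarrow> (\<forall>s\<in>V. \<forall>t\<in>V. \<forall>u w. weights s u \<and> weights t w \<and> wsum s u a = wsum t w a
      \<longrightarrow> u = w)"

definition geometric :: "'e::real_vector set set \<Rightarrow> bool" where
  "geometric V \<longleftrightarrow> scheme V \<and> embeds V (\<lambda>v. v)"

definition body :: "'e::real_vector set set \<Rightarrow> 'e set" where
  "body V = (\<Union>s\<in>V. convex hull s)"

text \<open>
  Affine maps of a simplex in terms of coordinates, without reference to an extension to the
  ambient space.
\<close>

definition affine_on_simplex :: "'e::real_vector set \<Rightarrow> ('e \<Rightarrow> 'f::real_vector) \<Rightarrow> bool" where
  "affine_on_simplex s f \<longleftrightarrow> (\<forall>u. weights s u \<longrightarrow> f (point_at s u) = wsum s u f)"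

lemma weights_mono:
  assumes "weights s u" "s \<subseteq> t" "finite t" shows "weights t u"
proof -
  have "sum u s = sum u t"
    by (rule sum.mono_neutral_left) (use assms in \<open>auto simp: weights_def\<close>)
  then show ?thesis using assms unfolding weights_def by auto
qed

lemma weights_restrict:
  assumes "weights s u" "finite s" "finite t" "\<And>v. u v \<noteq> 0 \<Longrightarrow> v \<in> t" shows "weights t u"
proof -
  have "sum u s = sum u (s \<union> t)" 
    by (rule sum.mono_neutral_left) (use assms in \<open>auto simp: weights_def\<close>)
  moreover have "sum u t = sum u (s \<union> t)"
    by (rule sum.mono_neutral_left) (use assms in \<open>auto simp: weights_def\<close>)
  ultimately show ?thesis using assms unfolding weights_def by auto
qed

lemma wsum_cong_support:
  assumes "finite s" "finite t" "\<And>v. v \<notin> s \<Longrightarrow> u v = 0" "\<And>v. v \<notin> t \<Longrightarrow> u v = 0"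
  shows "wsum s u a = wsum t u a"
proof -
  have "wsum s u a = wsum (s \<union> t) u a" unfolding wsum_def
    by (rule sum.mono_neutral_left) (use assms in auto)
  moreover have "wsum t u a = wsum (s \<union> t) u a" unfolding wsum_def
    by (rule sum.mono_neutral_left) (use assms in auto)
  ultimately show ?thesis by simp
qed

lemma wsum_weights_cong:
  "\<lbrakk>weights s u; weights t u; finite s; finite t\<rbrakk> \<Longrightarrow> wsum s u a = wsum t u a"
  by (rule wsum_cong_support) (auto simp: weights_def)

lemma wsum_extend:
  "\<lbrakk>weights s u; s \<subseteq> t; finite t\<rbrakk> \<Longrightarrow> wsum s u a = wsum t u a"
  by (rule wsum_weights_cong) (auto intro: weights_mono finite_subset)

lemma mem_hull_iff:
  assumes "finite s"
  shows "p \<in> convex hull s \<longleftrightarrow> (\<exists>u. weights s u \<and> p = point_at s u)"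
proof
  assume "p \<in> convex hull s"
  then obtain u where u: "\<forall>x\<in>s. 0 \<le> u x" "sum u s = 1" "(\<Sum>x\<in>s. u x *\<^sub>R x) = p"
    unfolding convex_hull_finite[OF assms] by blast
  let ?w = "\<lambda>v. if v \<in> s then u v else 0"
  have "weights s ?w" using u by (auto simp: weights_def)
  moreover have "point_at s ?w = p" using u(3) by (simp add: wsum_def)
  ultimately show "\<exists>u. weights s u \<and> p = point_at s u" by blast
next
  assume "\<exists>u. weights s u \<and> p = point_at s u"
  then show "p \<in> convex hull s"
    unfolding convex_hull_finite[OF assms] weights_def wsum_def by blast
qed

text \<open>
  The coordinates of an image point when the vertices are mapped by \<open>a\<close>, possibly with repetition.
\<close>

definition push_weights :: "('p \<Rightarrow> 'q) \<Rightarrow> 'p set \<Rightarrow> ('p \<Rightarrow> real) \<Rightarrow> 'q \<Rightarrow> real" where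
  "push_weights a s u y = (\<Sum>v\<in>{v\<in>s. a v = y}. u v)"

lemma weights_push:
  assumes "weights s u" "finite s" shows "weights (a ` s) (push_weights a s u)"
proof -
  have "sum (push_weights a s u) (a ` s) = sum u s" unfolding push_weights_def
    by (rule sum.image_gen[symmetric]) (rule assms)
  then show ?thesis
    using assms unfolding weights_def push_weights_def
    by (auto intro!: sum_nonneg sum.neutral)
qed

lemma wsum_push:
  assumes "finite s" shows "wsum (a ` s) (push_weights a s u) b = wsum s u (\<lambda>v. b (a v))"
proof -
  have "wsum s u (\<lambda>v. b (a v)) = (\<Sum>y\<in>a ` s. \<Sum>v\<in>{v\<in>s. a v = y}. u v *\<^sub>R b (a v))"
    unfolding wsum_def by (rule sum.image_gen) (rule assms)
  also have "\<dots> = (\<Sum>y\<in>a ` s. push_weights a s u y *\<^sub>R b y)"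
    unfolding push_weights_def by (intro sum.cong refl) (simp add: scaleR_left.sum)
  finally show ?thesis by (simp add: wsum_def)
qed

lemma wsum_in_hull: "\<lbrakk>weights s u; finite s\<rbrakk> \<Longrightarrow> wsum s u a \<in> convex hull (a ` s)"
  unfolding wsum_def by (rule convex_sum) (auto simp: weights_def intro: hull_inc)

lemma hull_image_iff:
  assumes "finite s"
  shows "p \<in> convex hull (a ` s) \<longleftrightarrow> (\<exists>u. weights s u \<and> p = wsum s u a)"
proof
  assume "p \<in> convex hull (a ` s)"
  then obtain w where w: "weights (a ` s) w" "p = point_at (a ` s) w"
    using mem_hull_iff assms by blast
  define r where "r = inv_into s a"
  have r: "r y \<in> s" "a (r y) = y" if "y \<in> a ` s" for y
    using that by (auto simp: r_def inv_into_into f_inv_into_f)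
  define u where "u = push_weights r (a ` s) w"
  have u: "weights (r ` a ` s) u" "wsum (r ` a ` s) u a = wsum (a ` s) w (\<lambda>v. a (r v))"
    unfolding u_def using weights_push[OF w(1)] wsum_push[of "a ` s" r w] assms by auto
  have sub: "r ` a ` s \<subseteq> s" using r by blast
  have "wsum s u a = wsum (r ` a ` s) u a"
    by (rule wsum_extend[symmetric]) (use u sub assms in auto)
  also have "\<dots> = p" using u(2) w(2) r by (simp add: wsum_def)
  finally show "\<exists>u. weights s u \<and> p = wsum s u a" using weights_mono[OF u(1) sub assms] by blast
qed (use wsum_in_hull assms in blast)

lemma schemeD:
  "scheme V \<Longrightarrow> finite V" "scheme V \<Longrightarrow> s \<in> V \<Longrightarrow> finite s"
  "scheme V \<Longrightarrow> s \<in> V \<Longrightarrow> t \<subseteq> s \<Longrightarrow> t \<in> V"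
  unfolding scheme_def by auto

lemma embedsD:
  "\<lbrakk>embeds V a; s \<in> V; t \<in> V; weights s u; weights t w; wsum s u a = wsum t w a\<rbrakk> \<Longrightarrow> u = w"
  unfolding embeds_def by blast

lemma weights_single: "weights {v} (\<lambda>x. if x = v then 1 else 0)"
  by (simp add: weights_def)

lemma wsum_single: "wsum {v} (\<lambda>x. if x = v then 1 else 0) a = a v"
  by (simp add: wsum_def)

lemma embeds_inj_vertices:
  assumes "scheme V" "embeds V a" shows "inj_on a (\<Union>V)"
proof (rule inj_onI)
  fix v w assume "v \<in> \<Union>V" "w \<in> \<Union>V" and eq: "a v = a w"
  then have "{v} \<in> V" "{w} \<in> V" using assms(1) unfolding scheme_def by auto
  then have "(\<lambda>x. if x = v then 1 else 0) = (\<lambda>x. if x = w then 1 else (0::real))"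
    using embedsD[OF assms(2) _ _ weights_single weights_single] eq wsum_single by metis
  then show "v = w" by (metis zero_neq_one)
qed

lemma geometric_weights_eq:
  "\<lbrakk>geometric V; s \<in> V; t \<in> V; weights s u; weights t w; point_at s u = point_at t w\<rbrakk>
    \<Longrightarrow> u = w"
  unfolding geometric_def using embedsD by blast

lemma independent_weights_eq:
  assumes "\<not> affine_dependent s" "finite s" "weights s u" "weights s w"
    "point_at s u = point_at s w"
  shows "u = w"
proof (rule ccontr)
  assume "u \<noteq> w"
  then obtain v where v: "u v \<noteq> w v" by blast
  have "v \<in> s"
  proof (rule ccontr)
    assume "v \<notin> s"
    then have "u v = 0" "w v = 0" using assms(3,4) unfolding weights_def by blast+
    then show False using v by simp
  qed
  moreover have "sum (\<lambda>x. u x - w x) s = 0" using assms by (simp add: weights_def sum_subtractf)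
  moreover have "sum (\<lambda>x. (u x - w x) *\<^sub>R x) s = 0"
    using assms(5) by (simp add: wsum_def sum_subtractf scaleR_diff_left)
  ultimately have "affine_dependent s"
    unfolding affine_dependent_explicit_finite[OF assms(2)] using v
    by (intro exI[of _ "\<lambda>x. u x - w x"]) auto
  then show False using assms by blast
qed

text \<open>
  A small multiple of an affine dependence, added to the uniform coordinates of the barycentre, would
  give the barycentre a second set of coordinates.
\<close>

lemma embeds_single_independent:
  assumes "embeds V (\<lambda>v::'e::real_vector. v)" "s \<in> V" "finite s"
  shows "\<not> affine_dependent s"
proof
  assume "affine_dependent s"
  then obtain U v where U: "sum U s = 0" "v \<in> s" "U v \<noteq> 0" "(\<Sum>v\<in>s. U v *\<^sub>R v) = 0"
    unfolding affine_dependent_explicit_finite[OF assms(3)] by blast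
  define N where "N = real (card s)"
  have N: "N > 0" using U(2) assms(3) by (auto simp: N_def card_gt_0_iff)
  \<comment> \<open>The dependence is divided by a bound for its coefficients, so that the perturbed coordinates stay nonnegative.\<close>
  define M where "M = 1 + (\<Sum>v\<in>s. \<bar>U v\<bar>)"
  have M: "M > 0" unfolding M_def by (smt (verit) sum_nonneg abs_ge_zero)
  have UM: "\<bar>U x\<bar> \<le> M" if "x \<in> s" for x
    using member_le_sum[of x s "\<lambda>v. \<bar>U v\<bar>"] that assms(3) by (auto simp: M_def)
  define u where "u x = (if x \<in> s then 1 / N else 0)" for x
  define w where "w x = (if x \<in> s then 1 / N + U x / (N * M) else 0)" for x
  have u: "weights s u" unfolding weights_def u_def using N by (auto simp: N_def)
  have "sum w s = sum u s + sum U s / (N * M)"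
    by (simp add: w_def u_def sum.distrib sum_divide_distrib)
  moreover have "0 \<le> w x" for x
  proof (cases "x \<in> s")
    case True
    have "- (U x) / M \<le> 1" using UM[OF True] M abs_ge_minus_self[of "U x"]
      by (subst pos_divide_le_eq) linarith+
    then have "0 \<le> (1 + U x / M) / N" using N by simp
    also have "\<dots> = w x" using True N M by (simp add: w_def field_simps)
    finally show ?thesis .
  qed (simp add: w_def)
  ultimately have w: "weights s w" using u U by (auto simp: weights_def w_def)
  have "point_at s w = point_at s u + (1 / (N * M)) *\<^sub>R (\<Sum>v\<in>s. U v *\<^sub>R v)"
    unfolding wsum_def w_def u_def scaleR_sum_right sum.distrib[symmetric]
    by (intro sum.cong) (auto simp: scaleR_add_left)
  then have "u = w" using embedsD[OF assms(1,2,2) u w] U by simp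
  then have "u v = w v" by simp
  then show False using U N M by (simp add: u_def w_def)
qed

lemma geometricD:
  assumes "geometric V"
  shows "scheme V" "finite V" "\<And>s. s \<in> V \<Longrightarrow> finite s"
    "\<And>s t. s \<in> V \<Longrightarrow> t \<subseteq> s \<Longrightarrow> t \<in> V" "\<And>s. s \<in> V \<Longrightarrow> \<not> affine_dependent s"
proof -
  show sch: "scheme V" using assms by (simp add: geometric_def)
  show "finite V" using schemeD(1)[OF sch] .
  show fin: "finite s" if "s \<in> V" for s using schemeD(2)[OF sch that] .
  show "t \<in> V" if "s \<in> V" "t \<subseteq> s" for s t using schemeD(3)[OF sch that] .
  show "\<not> affine_dependent s" if "s \<in> V" for s
    using embeds_single_independent[OF _ that fin[OF that]] assms by (simp add: geometric_def)
qed

lemma geometric_Int: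
  assumes "geometric V" "s \<in> V" "t \<in> V"
  shows "convex hull s \<inter> convex hull t = convex hull (s \<inter> t)"
proof
  show "convex hull s \<inter> convex hull t \<subseteq> convex hull (s \<inter> t)"
  proof
    fix p assume "p \<in> convex hull s \<inter> convex hull t"
    moreover have fin: "finite s" "finite t" using geometricD assms by auto
    ultimately obtain u w where uw: "weights s u" "p = point_at s u"
        "weights t w" "p = point_at t w"
      by (auto simp: mem_hull_iff)
    then have "u = w" using geometric_weights_eq[OF assms] by simp
    have "weights (s \<inter> t) u"
      by (rule weights_restrict[OF uw(1)]) (use uw \<open>u = w\<close> fin in \<open>auto simp: weights_def\<close>)
    moreover have "p = point_at (s \<inter> t) u"
      unfolding uw(2) by (rule wsum_weights_cong) (use uw calculation fin in auto)
    ultimately show "p \<in> convex hull (s \<inter> t)" using fin by (auto simp: mem_hull_iff)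
  qed
qed (auto simp: hull_mono subsetD[OF hull_mono])

lemma geometricI:
  assumes "scheme V" "\<And>s. s \<in> V \<Longrightarrow> \<not> affine_dependent s"
    "\<And>s t. s \<in> V \<Longrightarrow> t \<in> V \<Longrightarrow> convex hull s \<inter> convex hull t \<subseteq> convex hull (s \<inter> t)"
  shows "geometric V"
  unfolding geometric_def embeds_def
proof (intro conjI ballI allI impI assms(1))
  fix s t u w assume st: "s \<in> V" "t \<in> V"
    and uw: "weights s u \<and> weights t w \<and> point_at s u = point_at t w"
  have fin: "finite s" "finite t" using assms(1) st schemeD by auto
  have "point_at s u \<in> convex hull s" "point_at t w \<in> convex hull t"
    using uw mem_hull_iff fin by blast+
  then have "point_at s u \<in> convex hull (s \<inter> t)"
    using uw assms(3)[OF st] by auto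
  then obtain z where z: "weights (s \<inter> t) z" "point_at s u = point_at (s \<inter> t) z"
    using mem_hull_iff[of "s \<inter> t"] fin by blast
  have zw: "weights s z" "weights t z" using weights_mono[OF z(1)] fin by auto
  have ze: "point_at s z = point_at (s \<inter> t) z" "point_at t z = point_at (s \<inter> t) z"
    using wsum_extend[OF z(1), of s "\<lambda>v. v"] wsum_extend[OF z(1), of t "\<lambda>v. v"] fin by auto
  have "u = z"
    using independent_weights_eq[OF assms(2)[OF st(1)] fin(1) _ zw(1)] uw z ze by simp
  moreover have "w = z"
    using independent_weights_eq[OF assms(2)[OF st(2)] fin(2) _ zw(2)] uw z ze by simp
  ultimately show "u = w" by simp
qed

lemma geometric_subset:
  assumes "geometric V" "W \<subseteq> V" "\<And>s t. s \<in> W \<Longrightarrow> t \<subseteq> s \<Longrightarrow> t \<in> W"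
  shows "geometric W"
proof -
  note V = geometricD[OF assms(1)]
  have "finite W" using finite_subset[OF assms(2) V(2)] .
  then have "scheme W" using assms(2,3) V(3) unfolding scheme_def by blast
  moreover have "embeds W (\<lambda>v. v)"
    unfolding embeds_def using geometric_weights_eq[OF assms(1)] assms(2) by (meson subsetD)
  ultimately show ?thesis by (simp add: geometric_def)
qed

lemma compact_body: "scheme V \<Longrightarrow> compact (body (V::'e::euclidean_space set set))"
  unfolding body_def
  by (intro compact_UN) (auto simp: scheme_def compact_convex_hull finite_imp_compact)

lemma affine_on_simplexD:
  "\<lbrakk>affine_on_simplex s f; weights s u\<rbrakk> \<Longrightarrow> f (point_at s u) = wsum s u f"
  unfolding affine_on_simplex_def by blast

lemma affine_map_on_imp_affine_on_simplex:
  assumes "finite s" "affine_map_on (convex hull s) f"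
  shows "affine_on_simplex s f"
  unfolding affine_on_simplex_def
proof (intro allI impI)
  fix u assume u: "weights s u"
  obtain h c where h: "linear h" "\<And>y. y \<in> convex hull s \<Longrightarrow> f y = h y + c"
    using assms(2) unfolding affine_map_on_def by blast
  have "point_at s u \<in> convex hull s" using mem_hull_iff assms(1) u by blast
  then have "f (point_at s u) = h (point_at s u) + c" by (rule h(2))
  also have "\<dots> = (\<Sum>v\<in>s. u v *\<^sub>R h v) + (\<Sum>v\<in>s. u v) *\<^sub>R c"
    using u h(1) by (simp add: wsum_def linear_sum linear_cmul weights_def)
  also have "\<dots> = (\<Sum>v\<in>s. u v *\<^sub>R (h v + c))"
    by (simp add: scaleR_add_right sum.distrib scaleR_sum_left)
  also have "\<dots> = wsum s u f"
    unfolding wsum_def by (rule sum.cong) (auto simp: h(2) hull_inc)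
  finally show "f (point_at s u) = wsum s u f" .
qed

lemma exists_affine_through:
  fixes s :: "'e::euclidean_space set" and b :: "'e \<Rightarrow> 'f::euclidean_space"
  assumes "\<not> affine_dependent s"
  shows "\<exists>h c. linear h \<and> (\<forall>v\<in>s. h v + c = b v)"
proof (cases "s = {}")
  case True then show ?thesis using linear_zero by auto
next
  case False
  then obtain v0 where v0: "v0 \<in> s" by blast
  have eq: "(\<lambda>x. - v0 + x) ` (s - {v0}) = (\<lambda>x. x - v0) ` (s - {v0})"
    by (rule image_cong) auto
  have "\<not> dependent ((\<lambda>x. x - v0) ` (s - {v0}))"
    using affine_dependent_iff_dependent2[OF v0] assms unfolding eq by blast
  from linear_independent_extend[OF this, of "\<lambda>x. b (x + v0) - b v0"]
  obtain h where h: "linear h" "\<forall>x\<in>(\<lambda>x. x - v0) ` (s - {v0}). h x = b (x + v0) - b v0"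
    by blast
  have "h v + (b v0 - h v0) = b v" if "v \<in> s" for v
  proof (cases "v = v0")
    case False
    then have "h (v - v0) = b (v - v0 + v0) - b v0" using h(2) that by blast
    then show ?thesis using linear_diff[OF h(1), of v v0] by (simp add: algebra_simps)
  qed simp
  then show ?thesis using h(1) by blast
qed

lemma affine_on_simplex_imp_affine_map_on:
  fixes s :: "'e::euclidean_space set" and f :: "'e \<Rightarrow> 'f::euclidean_space"
  assumes "\<not> affine_dependent s" "affine_on_simplex s f"
  shows "affine_map_on (convex hull s) f"
proof -
  have fin: "finite s" using aff_independent_finite assms(1) by blast
  obtain h c where h: "linear h" "\<And>v. v \<in> s \<Longrightarrow> h v + c = f v"
    using exists_affine_through[OF assms(1)] by metis
  have "f y = h y + c" if y: "y \<in> convex hull s" for y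
  proof -
    obtain u where u: "weights s u" "y = point_at s u" using y mem_hull_iff fin by blast
    have "f y = (\<Sum>v\<in>s. u v *\<^sub>R (h v + c))"
      using affine_on_simplexD[OF assms(2) u(1)] u(2) h(2) by (simp add: wsum_def)
    also have "\<dots> = h y + (\<Sum>v\<in>s. u v) *\<^sub>R c"
      unfolding u(2) using h(1)
      by (simp add: wsum_def scaleR_add_right sum.distrib scaleR_sum_left linear_sum linear_cmul)
    finally show ?thesis using u(1) by (simp add: weights_def)
  qed
  then show ?thesis using h(1) unfolding affine_map_on_def by blast
qed

lemma affine_on_simplex_mono:
  fixes s :: "'e::euclidean_space set" and f :: "'e \<Rightarrow> 'f::euclidean_space"
  assumes "\<not> affine_dependent s" "affine_on_simplex s f" "finite q"
    "convex hull q \<subseteq> convex hull s"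
  shows "affine_on_simplex q f"
proof (rule affine_map_on_imp_affine_on_simplex[OF assms(3)])
  show "affine_map_on (convex hull q) f"
    using affine_on_simplex_imp_affine_map_on[OF assms(1,2)] assms(4)
    unfolding affine_map_on_def by blast
qed

lemma affine_on_simplex_image:
  assumes "affine_on_simplex s f" "finite s"
  shows "f ` (convex hull s) = convex hull (f ` s)"
proof -
  have "convex hull s = {point_at s u |u. weights s u}" using mem_hull_iff[OF assms(2)] by blast
  then have "f ` (convex hull s) = {f (point_at s u) |u. weights s u}" by auto
  also have "\<dots> = {wsum s u f |u. weights s u}" using affine_on_simplexD[OF assms(1)] by metis
  also have "\<dots> = convex hull (f ` s)" using hull_image_iff[OF assms(2), of _ f] by blast
  finally show ?thesis .
qed

lemma affine_on_simplex_continuous: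
  fixes s :: "'e::euclidean_space set" and f :: "'e \<Rightarrow> 'f::euclidean_space"
  assumes "\<not> affine_dependent s" "affine_on_simplex s f"
  shows "continuous_on (convex hull s) f"
proof -
  obtain h c where h: "linear h" "\<And>y. y \<in> convex hull s \<Longrightarrow> f y = h y + c"
    using affine_on_simplex_imp_affine_map_on[OF assms] unfolding affine_map_on_def by blast
  have "continuous_on (convex hull s) (\<lambda>y. h y + c)"
    by (intro continuous_intros linear_continuous_on) (simp add: h(1) linear_conv_bounded_linear[symmetric])
  then show ?thesis by (rule continuous_on_eq) (simp add: h(2))
qed

lemma linear_affine_on_simplex: "linear f \<Longrightarrow> affine_on_simplex s f"
  unfolding affine_on_simplex_def wsum_def by (simp add: linear_sum linear_cmul)

lemma affine_on_simplex_comp: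
  fixes g :: "'f::real_vector \<Rightarrow> 'g::real_vector"
  assumes "affine_on_simplex s f" "affine_on_simplex (f ` s) g" "finite s"
  shows "affine_on_simplex s (g \<circ> f)"
  unfolding affine_on_simplex_def
proof (intro allI impI)
  fix u assume u: "weights s u"
  let ?w = "push_weights f s u"
  note w = weights_push[OF u assms(3), of f] wsum_push[OF assms(3), of f u "\<lambda>v. v"]
    wsum_push[OF assms(3), of f u g]
  have "(g \<circ> f) (point_at s u) = g (point_at (f ` s) ?w)"
    using affine_on_simplexD[OF assms(1) u] w(2) by simp
  also have "\<dots> = wsum s u (g \<circ> f)" using affine_on_simplexD[OF assms(2) w(1)] w(3) by (simp add: o_def)
  finally show "(g \<circ> f) (point_at s u) = wsum s u (g \<circ> f)" .
qed


lemma independent_hull_inj: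
  fixes s :: "'e::euclidean_space set"
  assumes "\<not> affine_dependent s" "\<not> affine_dependent t" "convex hull s = convex hull t"
  shows "s = t"
proof -
  have "x \<in> s \<longleftrightarrow> x \<in> t" for x
    unfolding extreme_point_of_convex_hull_affine_independent[OF assms(1), symmetric]
      extreme_point_of_convex_hull_affine_independent[OF assms(2), symmetric] assms(3) ..
  then show ?thesis by blast
qed

text \<open>
  A simplex is determined by its vertices, its extreme points, so the vertex sets carry the whole
  complex.
\<close>

lemma simplicial_complex_imp_geometric:
  fixes T :: "'e::euclidean_space set set"
  assumes T: "simplicial_complex T"
  obtains V where "geometric V" "body V = \<Union>T" "\<And>s. s \<in> V \<Longrightarrow> convex hull s \<in> T"
proof -
  define V where "V = {s. \<not> affine_dependent s \<and> convex hull s \<in> T}"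
  have ind: "\<not> affine_dependent s" if "s \<in> V" for s using that by (simp add: V_def)
  have fin: "finite s" if "s \<in> V" for s using aff_independent_finite ind[OF that] by blast
  have face: "F \<in> T" if "S \<in> T" "F face_of S" for S F
    using T that unfolding simplicial_complex_def by blast
  have int: "S \<inter> S' face_of S" if "S \<in> T" "S' \<in> T" for S S'
    using T that unfolding simplicial_complex_def by blast
  have "inj_on (\<lambda>s. convex hull s) V"
    using independent_hull_inj ind by (intro inj_onI) blast
  moreover have "(\<lambda>s. convex hull s) ` V \<subseteq> T" by (auto simp: V_def)
  ultimately have finV: "finite V"
    using T finite_imageD finite_subset unfolding simplicial_complex_def by blast
  have down: "t \<in> V" if "s \<in> V" "t \<subseteq> s" for s t
  proof -
    have "convex hull t face_of convex hull s"
      using face_of_convex_hull_affine_independent[OF ind[OF that(1)]] that(2) by blast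
    then have "convex hull t \<in> T" using face that(1) by (auto simp: V_def)
    then show ?thesis using affine_independent_subset[OF ind[OF that(1)] that(2)] by (simp add: V_def)
  qed
  have sch: "scheme V" using finV fin down by (auto simp: scheme_def)
  have "geometric V"
  proof (rule geometricI[OF sch ind])
    fix s t assume st: "s \<in> V" "t \<in> V"
    then have "convex hull s \<inter> convex hull t face_of convex hull s"
      "convex hull t \<inter> convex hull s face_of convex hull t" using int by (auto simp: V_def)
    then obtain c d where cd: "c \<subseteq> s" "convex hull s \<inter> convex hull t = convex hull c"
        "d \<subseteq> t" "convex hull t \<inter> convex hull s = convex hull d"
      using face_of_convex_hull_affine_independent ind st by metis
    have "c = d"
      by (rule independent_hull_inj) (use cd ind st down in \<open>auto simp: Int_commute\<close>)
    then show "convex hull s \<inter> convex hull t \<subseteq> convex hull (s \<inter> t)"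
      using cd hull_mono[of c "s \<inter> t" convex] by blast
  qed
  moreover have "body V = \<Union>T"
  proof -
    have "\<exists>s\<in>V. S = convex hull s" if S: "S \<in> T" for S
    proof -
      obtain n where "n simplex S" using T S unfolding simplicial_complex_def by blast
      then obtain C where "\<not> affine_dependent C" "S = convex hull C" unfolding simplex_def by blast
      then show ?thesis using S by (auto simp: V_def)
    qed
    then show ?thesis unfolding body_def V_def by blast
  qed
  ultimately show ?thesis using that by (auto simp: V_def)
qed

lemma geometric_imp_simplicial_complex:
  fixes V :: "'e::euclidean_space set set"
  assumes V: "geometric V"
  shows "simplicial_complex ((\<lambda>s. convex hull s) ` V)" "\<Union>((\<lambda>s. convex hull s) ` V) = body V"
proof -
  have face: "convex hull c face_of convex hull s" if "s \<in> V" "c \<subseteq> s" for s c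
    using face_of_convex_hull_affine_independent[OF geometricD(5)[OF V that(1)]] that(2) by blast
  show "simplicial_complex ((\<lambda>s. convex hull s) ` V)"
    unfolding simplicial_complex_def
  proof (intro conjI allI impI ballI)
    show "finite ((\<lambda>s. convex hull s) ` V)" using geometricD(2)[OF V] by simp
    fix S assume "S \<in> (\<lambda>s. convex hull s) ` V"
    then obtain s where "s \<in> V" "S = convex hull s" by blast
    then have "int (card s) - 1 simplex S"
      unfolding simplex_def using geometricD(5)[OF V] by (intro exI[of _ s]) auto
    then show "\<exists>n. n simplex S" by blast
  next
    fix F S assume a: "S \<in> (\<lambda>s. convex hull s) ` V \<and> F face_of S"
    then obtain s where s: "s \<in> V" "S = convex hull s" by blast
    then obtain c where "c \<subseteq> s" "F = convex hull c"
      using face_of_convex_hull_affine_independent[OF geometricD(5)[OF V s(1)]] a by blast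
    then show "F \<in> (\<lambda>s. convex hull s) ` V" using geometricD(4)[OF V s(1)] by blast
  next
    fix S S' assume "S \<in> (\<lambda>s. convex hull s) ` V \<and> S' \<in> (\<lambda>s. convex hull s) ` V"
    then obtain s t where st: "s \<in> V" "S = convex hull s" "t \<in> V" "S' = convex hull t" by blast
    show "S \<inter> S' face_of S" using face[OF st(1), of "s \<inter> t"] geometric_Int[OF V st(1,3)] st by simp
  qed
qed (auto simp: body_def)

text \<open>
  Piecewise linear maps are handled below through vertex sets and coordinates only.
\<close>

lemma pl_map_on_iff_geometric:
  fixes f :: "'a::euclidean_space \<Rightarrow> 'b::euclidean_space"
  shows "pl_map_on X f \<longleftrightarrow> (\<exists>V. geometric V \<and> body V = X \<and> (\<forall>s\<in>V. affine_on_simplex s f))"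
proof
  assume "pl_map_on X f"
  then obtain T where T: "simplicial_complex T" "\<Union>T = X" "\<And>S. S \<in> T \<Longrightarrow> affine_map_on S f"
    unfolding pl_map_on_def by blast
  obtain V where V: "geometric V" "body V = \<Union>T" "\<And>s. s \<in> V \<Longrightarrow> convex hull s \<in> T"
    using simplicial_complex_imp_geometric[OF T(1)] by blast
  have "affine_on_simplex s f" if "s \<in> V" for s
    by (rule affine_map_on_imp_affine_on_simplex)
      (use V(3)[OF that] T(3) geometricD(3)[OF V(1) that] in auto)
  then show "\<exists>V. geometric V \<and> body V = X \<and> (\<forall>s\<in>V. affine_on_simplex s f)" using V T by blast
next
  assume "\<exists>V. geometric V \<and> body V = X \<and> (\<forall>s\<in>V. affine_on_simplex s f)"
  then obtain V where V: "geometric V" "body V = X" "\<And>s. s \<in> V \<Longrightarrow> affine_on_simplex s f" by blast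
  have "affine_map_on (convex hull s) f" if "s \<in> V" for s
    using affine_on_simplex_imp_affine_map_on[OF geometricD(5)[OF V(1) that] V(3)[OF that]] .
  then show "pl_map_on X f"
    unfolding pl_map_on_def using geometric_imp_simplicial_complex[OF V(1)] V(2) by blast
qed

text \<open>
  The intersections of the simplices of one complex with those of the other form a cell complex, which
  has a simplicial subdivision.
\<close>

lemma common_refinement:
  fixes V W :: "'e::euclidean_space set set"
  assumes V: "geometric V" and W: "geometric W"
  obtains Q where "geometric Q" "body Q = body V \<inter> body W"
    "\<And>q. q \<in> Q \<Longrightarrow> \<exists>s\<in>V. \<exists>t\<in>W. convex hull q \<subseteq> convex hull s \<and> convex hull q \<subseteq> convex hull t"
proof -
  define M where "M = {convex hull s \<inter> convex hull t |s t. s \<in> V \<and> t \<in> W}"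
  have face: "convex hull s \<inter> convex hull s' face_of convex hull s" if "geometric U" "s \<in> U" "s' \<in> U"
    for s s' and U :: "'e set set"
    using face_of_convex_hull_affine_independent[OF geometricD(5)[OF that(1,2)]]
      geometric_Int[OF that] by blast
  have "finite M" using geometricD(2)[OF V] geometricD(2)[OF W] unfolding M_def
    using finite_image_set2[of "\<lambda>s. s \<in> V" "\<lambda>t. t \<in> W" "\<lambda>s t. convex hull s \<inter> convex hull t"]
    by simp
  moreover have "polytope C" if CM: "C \<in> M" for C
  proof -
    obtain s t where st: "s \<in> V" "t \<in> W" "C = convex hull s \<inter> convex hull t"
      using CM unfolding M_def by blast
    then show ?thesis using geometricD(3)[OF V st(1)] geometricD(3)[OF W st(2)]
      by (simp add: polytope_Int polytope_convex_hull)
  qed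
  moreover have "C1 \<inter> C2 face_of C1" if "C1 \<in> M" "C2 \<in> M" for C1 C2
  proof -
    obtain s t s' t' where st: "s \<in> V" "t \<in> W" "C1 = convex hull s \<inter> convex hull t"
      "s' \<in> V" "t' \<in> W" "C2 = convex hull s' \<inter> convex hull t'"
      using \<open>C1 \<in> M\<close> \<open>C2 \<in> M\<close> unfolding M_def by blast
    have "(convex hull s \<inter> convex hull s') \<inter> (convex hull t \<inter> convex hull t') face_of C1"
      unfolding st(3) using face_of_Int_Int face V W st by blast
    moreover have "(convex hull s \<inter> convex hull s') \<inter> (convex hull t \<inter> convex hull t') = C1 \<inter> C2"
      using st by blast
    ultimately show ?thesis by simp
  qed
  ultimately obtain T where T: "simplicial_complex T" "\<Union>T = \<Union>M"
      "\<And>K. K \<in> T \<Longrightarrow> \<exists>C. C \<in> M \<and> K \<subseteq> C"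
    using simplicial_subdivision_of_cell_complex[of M] by metis
  obtain Q where Q: "geometric Q" "body Q = \<Union>T" "\<And>s. s \<in> Q \<Longrightarrow> convex hull s \<in> T"
    using simplicial_complex_imp_geometric[OF T(1)] by blast
  show ?thesis
  proof (rule that[OF Q(1)])
    show "body Q = body V \<inter> body W" unfolding Q(2) T(2) unfolding M_def body_def by blast
    show "\<exists>s\<in>V. \<exists>t\<in>W. convex hull q \<subseteq> convex hull s \<and> convex hull q \<subseteq> convex hull t" if "q \<in> Q" for q
      using T(3)[OF Q(3)[OF that]] unfolding M_def by blast
  qed
qed

text \<open>
  The value at a point does not depend on the simplex chosen for it, because the point has the same
  coordinates in every simplex that contains it.
\<close>

lemma piecewise_affine_extension:
  fixes b :: "'e::real_vector \<Rightarrow> 'f::real_vector"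
  assumes V: "geometric V"
  obtains f where "\<And>s. s \<in> V \<Longrightarrow> affine_on_simplex s f" "\<And>v. {v} \<in> V \<Longrightarrow> f v = b v"
    "\<And>s u. s \<in> V \<Longrightarrow> weights s u \<Longrightarrow> f (point_at s u) = wsum s u b"
proof -
  define f where "f p = (SOME y. \<exists>s u. s \<in> V \<and> weights s u \<and> p = point_at s u \<and> y = wsum s u b)" for p
  have f: "f (point_at s u) = wsum s u b" if su: "s \<in> V" "weights s u" for s u
  proof -
    have "\<exists>t w. t \<in> V \<and> weights t w \<and> point_at s u = point_at t w
        \<and> f (point_at s u) = wsum t w b"
      unfolding f_def by (rule someI) (use su in blast)
    then obtain t w where tw: "t \<in> V" "weights t w" "point_at s u = point_at t w"
      "f (point_at s u) = wsum t w b" by blast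
    have "u = w" using geometric_weights_eq[OF V su(1) tw(1) su(2) tw(2,3)] .
    then show ?thesis
      using wsum_weights_cong[of s u t b] su tw geometricD(3)[OF V] by simp
  qed
  have vert: "f v = b v" if "{v} \<in> V" for v
    using f[OF that weights_single] by (simp add: wsum_single)
  have "affine_on_simplex s f" if "s \<in> V" for s
    unfolding affine_on_simplex_def
  proof (intro allI impI)
    fix u assume u: "weights s u"
    have "f (point_at s u) = wsum s u b" by (rule f[OF that u])
    also have "\<dots> = wsum s u f"
      unfolding wsum_def by (rule sum.cong) (use vert that geometricD(4)[OF V that] in auto)
    finally show "f (point_at s u) = wsum s u f" .
  qed
  then show ?thesis using vert f that by blast
qed

lemma simplex_subset_body: "s \<in> V \<Longrightarrow> s \<subseteq> body V"
  unfolding body_def using hull_subset[of s convex] by blast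

lemma body_iff:
  "geometric V \<Longrightarrow> p \<in> body V \<longleftrightarrow> (\<exists>s u. s \<in> V \<and> weights s u \<and> p = point_at s u)"
  unfolding body_def using geometricD(3) mem_hull_iff by blast

lemma embeds_imp_inj_on_body:
  fixes f :: "'e::real_vector \<Rightarrow> 'f::real_vector"
  assumes V: "geometric V" and aff: "\<And>s. s \<in> V \<Longrightarrow> affine_on_simplex s f" and emb: "embeds V f"
  shows "inj_on f (body V)"
proof (rule inj_onI)
  fix p q assume "p \<in> body V" "q \<in> body V" and eq: "f p = f q"
  then obtain s u t w where st: "s \<in> V" "weights s u" "p = point_at s u"
    "t \<in> V" "weights t w" "q = point_at t w" unfolding body_iff[OF V] by blast
  then have "wsum s u f = wsum t w f"
    using eq affine_on_simplexD[OF aff] by metis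
  then have "u = w" using embedsD[OF emb] st by blast
  then show "p = q"
    using wsum_weights_cong[of s u t "\<lambda>v. v"] st geometricD(3)[OF V] by simp
qed

lemma inj_on_body_imp_embeds:
  fixes f :: "'e::real_vector \<Rightarrow> 'f::real_vector"
  assumes V: "geometric V" and aff: "\<And>s. s \<in> V \<Longrightarrow> affine_on_simplex s f"
    and inj: "inj_on f (body V)"
  shows "embeds V f"
  unfolding embeds_def
proof (intro ballI allI impI)
  fix s t u w assume st: "s \<in> V" "t \<in> V"
    and uw: "weights s u \<and> weights t w \<and> wsum s u f = wsum t w f"
  then have "f (point_at s u) = f (point_at t w)"
    using affine_on_simplexD[OF aff] by metis
  moreover have "point_at s u \<in> body V" "point_at t w \<in> body V"
    unfolding body_iff[OF V] using st uw by blast+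
  ultimately have "point_at s u = point_at t w" using inj_onD[OF inj] by blast
  then show "u = w" using geometric_weights_eq[OF V] st uw by blast
qed

lemma embeds_image_geometric:
  fixes a :: "'p \<Rightarrow> 'f::real_vector"
  assumes V: "scheme V" and emb: "embeds V a"
  shows "geometric ((`) a ` V)"
  unfolding geometric_def
proof
  have inj: "inj_on a (\<Union>V)" by (rule embeds_inj_vertices[OF V emb])
  show "scheme ((`) a ` V)"
    unfolding scheme_def
  proof (intro conjI ballI subsetI)
    fix S assume "S \<in> (`) a ` V"
    then obtain s where s: "s \<in> V" "S = a ` s" by blast
    then show "finite S" using schemeD(2)[OF V] by simp
    fix T assume "T \<in> Pow S"
    then obtain t where "t \<subseteq> s" "T = a ` t" using s by (meson PowD subset_imageE)
    then show "T \<in> (`) a ` V" using schemeD(3)[OF V s(1)] by blast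
  qed (use schemeD(1)[OF V] in simp)
  show "embeds ((`) a ` V) (\<lambda>v. v)"
    unfolding embeds_def
  proof (intro ballI allI impI)
    fix S T u w assume ST: "S \<in> (`) a ` V" "T \<in> (`) a ` V"
      and uw: "weights S u \<and> weights T w \<and> point_at S u = point_at T w"
    obtain s t where st: "s \<in> V" "S = a ` s" "t \<in> V" "T = a ` t" using ST by blast
    have pull: "weights s (\<lambda>v. if v \<in> s then z (a v) else 0)
        \<and> wsum s (\<lambda>v. if v \<in> s then z (a v) else 0) a = point_at (a ` s) z"
      if "s \<in> V" "weights (a ` s) z" for s and z :: "'f \<Rightarrow> real"
    proof -
      have "inj_on a s" using inj that(1) by (meson Union_upper inj_on_subset)
      then show ?thesis using that(2) unfolding weights_def wsum_def by (auto simp: sum.reindex)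
    qed
    let ?u = "\<lambda>v. if v \<in> s then u (a v) else 0" and ?w = "\<lambda>v. if v \<in> t then w (a v) else 0"
    have uw': "weights (a ` s) u" "weights (a ` t) w"
      "point_at (a ` s) u = point_at (a ` t) w" using uw st by auto
    have "?u = ?w"
      by (rule embedsD[OF emb st(1,3)]) (use pull[OF st(1) uw'(1)] pull[OF st(3) uw'(2)] uw'(3) in auto)
    then have eq: "?u v = ?w v" for v by (rule fun_cong)
    have "u y = w y" for y
    proof (cases "y \<in> a ` s \<union> a ` t")
      case True
      then obtain v where v: "v \<in> s \<union> t" "y = a v" by blast
      have mem: "a v \<in> a ` r \<longleftrightarrow> v \<in> r" if "r \<in> V" for r
        by (rule inj_on_image_mem_iff[OF inj]) (use v(1) st that in auto)
      have "u y = ?u v"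
        using uw st mem[OF st(1)] v(2) unfolding weights_def by auto
      moreover have "w y = ?w v"
        using uw st mem[OF st(3)] v(2) unfolding weights_def by auto
      ultimately show ?thesis using eq by simp
    next
      case False
      then show ?thesis using uw st unfolding weights_def by auto
    qed
    then show "u = w" by blast
  qed
qed

lemma body_image:
  assumes "geometric V" "\<And>s. s \<in> V \<Longrightarrow> affine_on_simplex s f"
  shows "body ((`) f ` V) = f ` body V"
  unfolding body_def using affine_on_simplex_image[OF assms(2) geometricD(3)[OF assms(1)]]
  by (auto simp: image_UN)

lemma affine_inverse_on_image:
  assumes V: "geometric V" and aff: "\<And>s. s \<in> V \<Longrightarrow> affine_on_simplex s f"
    and inj: "inj_on f (body V)" and g: "\<And>p. p \<in> body V \<Longrightarrow> g (f p) = p" and s: "s \<in> V"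
  shows "affine_on_simplex (f ` s) g"
  unfolding affine_on_simplex_def
proof (intro allI impI)
  fix u assume u: "weights (f ` s) u"
  have fin: "finite s" using geometricD(3)[OF V s] .
  have sb: "s \<subseteq> body V" using s by (auto simp: body_def hull_inc)
  have gs: "g ` f ` s = s" using g sb by force
  let ?w = "push_weights g (f ` s) u"
  have w: "weights s ?w" using weights_push[OF u, of g] fin gs by simp
  have "wsum s ?w f = wsum (f ` s) u (\<lambda>v. f (g v))"
    using wsum_push[of "f ` s" g u f] fin gs by simp
  also have "\<dots> = point_at (f ` s) u"
    unfolding wsum_def by (rule sum.cong) (use g sb in auto)
  finally have "f (point_at s ?w) = point_at (f ` s) u"
    using affine_on_simplexD[OF aff[OF s] w] by simp
  moreover have "point_at s ?w \<in> body V" using body_iff[OF V] s w by blast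
  ultimately have "g (point_at (f ` s) u) = point_at s ?w" using g by metis
  then show "g (point_at (f ` s) u) = wsum (f ` s) u g"
    using wsum_push[of "f ` s" g u "\<lambda>v. v"] fin gs by simp
qed

lemma piecewise_affine_continuous:
  fixes f :: "'e::euclidean_space \<Rightarrow> 'f::euclidean_space"
  assumes V: "geometric V" and aff: "\<And>s. s \<in> V \<Longrightarrow> affine_on_simplex s f"
  shows "continuous_on (body V) f"
  unfolding body_def
proof (rule continuous_on_closed_Union)
  show "finite V" using geometricD(2)[OF V] .
  show "closed (convex hull s)" if "s \<in> V" for s
    using geometricD(3)[OF V that] by (simp add: compact_imp_closed compact_convex_hull finite_imp_compact)
  show "continuous_on (convex hull s) f" if "s \<in> V" for s
    using affine_on_simplex_continuous[OF geometricD(5)[OF V that] aff[OF that]] .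
qed

lemma piecewise_affine_pl_homeomorphic:
  fixes f :: "'e::euclidean_space \<Rightarrow> 'f::euclidean_space"
  assumes V: "geometric V" and aff: "\<And>s. s \<in> V \<Longrightarrow> affine_on_simplex s f"
    and inj: "inj_on f (body V)"
  shows "pl_homeomorphic (body V) (f ` body V)"
proof -
  obtain g where g: "homeomorphism (body V) (f ` body V) f g"
    using homeomorphism_compact[OF compact_body[OF geometricD(1)[OF V]] piecewise_affine_continuous[OF V aff] refl inj]
    by blast
  have gf: "g (f p) = p" if "p \<in> body V" for p using g that by (simp add: homeomorphism_def)
  have "pl_map_on (f ` body V) g"
    unfolding pl_map_on_iff_geometric
  proof (intro exI[of _ "(`) f ` V"] conjI ballI)
    show "geometric ((`) f ` V)"
      using embeds_image_geometric[OF geometricD(1)[OF V] inj_on_body_imp_embeds[OF V aff inj]] .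
    show "body ((`) f ` V) = f ` body V" using body_image[OF V aff] .
    show "affine_on_simplex s g" if "s \<in> (`) f ` V" for s
      using affine_inverse_on_image[OF V aff inj gf] that by blast
  qed
  moreover have "pl_map_on (body V) f" unfolding pl_map_on_iff_geometric using V aff by blast
  ultimately show ?thesis using g unfolding pl_homeomorphic_def by blast
qed

text \<open>
  As \<open>f\<close> is injective, it carries its triangulation to one of \<open>f ` X\<close>. The common refinement of that
  triangulation with one for \<open>g\<close> is pulled back to \<open>X\<close> by the inverse of \<open>f\<close>, which is affine on its
  simplices.
\<close>

lemma pl_map_on_compose:
  fixes f :: "'e::euclidean_space \<Rightarrow> 'f::euclidean_space" and g :: "'f \<Rightarrow> 'g::euclidean_space"
  assumes f: "pl_map_on X f" and inj: "inj_on f X" and g: "pl_map_on (f ` X) g"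
  shows "pl_map_on X (g \<circ> f)"
proof -
  obtain V where V: "geometric V" "body V = X" "\<And>s. s \<in> V \<Longrightarrow> affine_on_simplex s f"
    using f unfolding pl_map_on_iff_geometric by blast
  obtain W where W: "geometric W" "body W = f ` X" "\<And>s. s \<in> W \<Longrightarrow> affine_on_simplex s g"
    using g unfolding pl_map_on_iff_geometric by blast
  have injV: "inj_on f (body V)" using inj V by simp
  let ?V' = "(`) f ` V"
  have V': "geometric ?V'" "body ?V' = f ` X"
    using embeds_image_geometric[OF geometricD(1)[OF V(1)] inj_on_body_imp_embeds[OF V(1,3) injV]]
      body_image[OF V(1,3)] V(2) by auto
  obtain Q where Q: "geometric Q" "body Q = body ?V' \<inter> body W"
    "\<And>q. q \<in> Q \<Longrightarrow> \<exists>s\<in>?V'. \<exists>t\<in>W. convex hull q \<subseteq> convex hull s \<and> convex hull q \<subseteq> convex hull t"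
    using common_refinement[OF V'(1) W(1)] by blast
  have Qb: "body Q = f ` X" using Q(2) V'(2) W(2) by simp
  define h where "h = inv_into X f"
  have hf: "h (f p) = p" if "p \<in> X" for p using inv_into_f_f[OF inj that] by (simp add: h_def)
  have hinj: "inj_on h (body Q)" unfolding Qb using hf by (auto simp: inj_on_def)
  have haff': "affine_on_simplex S h" if "S \<in> ?V'" for S
    using affine_inverse_on_image[OF V(1,3) injV] that hf V(2) by blast
  have haff: "affine_on_simplex q h" if q: "q \<in> Q" for q
  proof -
    obtain S where S: "S \<in> ?V'" "convex hull q \<subseteq> convex hull S" using Q(3)[OF q] by blast
    show ?thesis
      using affine_on_simplex_mono[OF geometricD(5)[OF V'(1) S(1)] haff'[OF S(1)] geometricD(3)[OF Q(1) q] S(2)] .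
  qed
  have gaff: "affine_on_simplex q g" if q: "q \<in> Q" for q
  proof -
    obtain S where S: "S \<in> W" "convex hull q \<subseteq> convex hull S" using Q(3)[OF q] by blast
    show ?thesis
      using affine_on_simplex_mono[OF geometricD(5)[OF W(1) S(1)] W(3)[OF S(1)] geometricD(3)[OF Q(1) q] S(2)] .
  qed
  let ?P = "(`) h ` Q"
  have P: "geometric ?P" "body ?P = X"
    using embeds_image_geometric[OF geometricD(1)[OF Q(1)] inj_on_body_imp_embeds[OF Q(1) haff hinj]]
      body_image[OF Q(1) haff] Qb hf by (auto simp: image_image)
  have fh: "f (h y) = y" if "y \<in> body Q" for y using that hf unfolding Qb by auto
  have "affine_on_simplex p (g \<circ> f)" if pP: "p \<in> ?P" for p
  proof -
    obtain q where q: "q \<in> Q" "p = h ` q" using pP by blast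
    have "affine_on_simplex (h ` q) f"
      using affine_inverse_on_image[OF Q(1) haff hinj fh q(1)] .
    moreover have "f ` (h ` q) = q"
    proof -
      have "q \<subseteq> body Q" using q by (auto simp: body_def hull_inc)
      then show ?thesis using fh by force
    qed
    ultimately show ?thesis
      using affine_on_simplex_comp[of "h ` q" f g] gaff[OF q(1)] q geometricD(3)[OF Q(1) q(1)] by simp
  qed
  then show ?thesis unfolding pl_map_on_iff_geometric using P by blast
qed

lemma pl_homeomorphic_trans:
  fixes X :: "'e::euclidean_space set" and Y :: "'f::euclidean_space set"
    and Z :: "'g::euclidean_space set"
  assumes "pl_homeomorphic X Y" "pl_homeomorphic Y Z"
  shows "pl_homeomorphic X Z"
proof -
  obtain f f' where f: "homeomorphism X Y f f'" "pl_map_on X f" "pl_map_on Y f'"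
    using assms(1) unfolding pl_homeomorphic_def by blast
  obtain g g' where g: "homeomorphism Y Z g g'" "pl_map_on Y g" "pl_map_on Z g'"
    using assms(2) unfolding pl_homeomorphic_def by blast
  have "homeomorphism X Z (g \<circ> f) (f' \<circ> g')" using homeomorphism_compose[OF f(1) g(1)] .
  moreover have "pl_map_on X (g \<circ> f)"
    using f g inj_on_inverseI[of X f' f] by (intro pl_map_on_compose) (auto simp: homeomorphism_def)
  moreover have "pl_map_on Z (f' \<circ> g')"
    using f g inj_on_inverseI[of Z g g'] by (intro pl_map_on_compose) (auto simp: homeomorphism_def)
  ultimately show ?thesis unfolding pl_homeomorphic_def by blast
qed

section \<open>Cofaces in a triangulated sphere\<close>

lemma openin_diff_closed: "closed C \<Longrightarrow> openin (top_of_set X) (X - C)"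
  unfolding openin_open by (rule exI[of _ "- C"]) (simp only: open_Compl Diff_eq simp_thms)

text \<open>
  If the image misses a point of the sphere, the complement of this point is homeomorphic to an affine
  space, to which the known invariance of domain applies; otherwise the image is the whole sphere.
\<close>

lemma invariance_of_domain_rel_frontier:
  fixes f :: "'a::euclidean_space \<Rightarrow> 'a"
  assumes contf: "continuous_on S f" and injf: "inj_on f S" and fim: "f ` S \<subseteq> rel_frontier U"
    and U: "bounded U" "convex U" and ope: "openin (top_of_set (rel_frontier U)) S"
  shows "openin (top_of_set (rel_frontier U)) (f ` S)"
proof (cases "f ` S = rel_frontier U")
  case False
  then obtain q where q: "q \<in> rel_frontier U" "q \<notin> f ` S" using fim by blast
  have Une: "U \<noteq> {}" using q(1) by auto
  obtain V :: "'a set" where V: "affine V" "aff_dim V = aff_dim U - 1"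
  proof (rule choose_affine_subset[OF affine_UNIV])
    show "- 1 \<le> aff_dim U - 1" using Une aff_dim_geq[of U] aff_dim_empty[of U] by linarith
    show "aff_dim U - 1 \<le> aff_dim (UNIV :: 'a set)" using aff_dim_le_DIM[of U] by simp
  qed
  have "rel_frontier U - {q} homeomorphic V"
    by (rule homeomorphic_punctured_sphere_affine_gen[OF U(2,1) q(1) V(1)]) (use V in simp)
  then obtain g h where gh: "homeomorphism (rel_frontier U - {q}) V g h"
    by (auto simp: homeomorphic_def)
  have sub: "f ` S \<subseteq> rel_frontier U - {q}" using fim q by blast
  have gV: "g ` (rel_frontier U - {q}) = V" and hg: "\<And>y. y \<in> rel_frontier U - {q} \<Longrightarrow> h (g y) = y"
    using gh by (auto simp: homeomorphism_def)
  have "openin (top_of_set V) ((g \<circ> f) ` S)"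
  proof (rule invariance_of_domain_sphere_affine_set_gen[OF _ _ _ U V(1) _ ope])
    show "continuous_on S (g \<circ> f)"
      using contf gh sub unfolding homeomorphism_def
      by (meson continuous_on_compose continuous_on_subset)
    show "inj_on (g \<circ> f) S"
      by (rule comp_inj_on[OF injf]) (metis hg inj_onI sub subsetD)
    show "g \<circ> f \<in> S \<rightarrow> V" unfolding gV[symmetric] using sub by fastforce
    show "aff_dim V < aff_dim U" using V by simp
  qed
  then have "openin (top_of_set (rel_frontier U - {q})) (h ` (g \<circ> f) ` S)"
    using homeomorphism_imp_open_map[OF homeomorphism_symD[OF gh]] by blast
  moreover have "h ` (g \<circ> f) ` S = f ` S"
  proof -
    have "h (g (f x)) = f x" if "x \<in> S" for x using hg that sub by blast
    then show ?thesis by (simp add: image_comp)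
  qed
  moreover have "openin (top_of_set (rel_frontier U)) (rel_frontier U - {q})"
    by (rule openin_delete) simp
  ultimately show ?thesis using openin_trans by metis
qed simp

definition barycenter :: "'p set \<Rightarrow> 'p \<Rightarrow> real" where
  "barycenter s v = (if v \<in> s then 1 / card s else 0)"

lemma weights_barycenter: "finite s \<Longrightarrow> s \<noteq> {} \<Longrightarrow> weights s (barycenter s)"
  by (auto simp: weights_def barycenter_def card_gt_0_iff)

lemma barycenter_pos: "finite s \<Longrightarrow> v \<in> s \<Longrightarrow> barycenter s v > 0"
  by (auto simp: barycenter_def card_gt_0_iff)

text \<open>
  A point with positive coordinates on \<open>s\<close> lies in no other simplex than the cofaces of \<open>s\<close>.
\<close>

lemma positive_weights_subset:
  assumes "geometric V" "s \<in> V" "t \<in> V" "weights s u" "\<And>v. v \<in> s \<Longrightarrow> u v > 0"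
    "point_at s u \<in> convex hull t"
  shows "s \<subseteq> t"
proof
  fix v assume v: "v \<in> s"
  obtain w where w: "weights t w" "point_at s u = point_at t w"
    using assms(6) mem_hull_iff geometricD(3)[OF assms(1,3)] by blast
  have "u = w" using geometric_weights_eq[OF assms(1-4) w] .
  then have "w v > 0" using assms(5)[OF v] by simp
  then show "v \<in> t" using w(1) unfolding weights_def by force
qed

lemma simplex_vertices:
  assumes "(int n + 1) simplex T"
  obtains C where "\<not> affine_dependent C" "finite C" "card C = n + 2" "T = convex hull C"
proof -
  obtain C where C: "\<not> affine_dependent C" "int (card C) = int n + 1 + 1" "T = convex hull C"
    using assms unfolding simplex_def by blast
  then have "card C = n + 2" by linarith
  then show ?thesis using that C aff_independent_finite by blast
qed

text \<open>
  Model \<open>A\<close> by the vertices of an \<open>(n+1)\<close>-simplex. In the boundary of the model, the points with positive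
  coordinates on \<open>A - I\<close> form an open set, which the affine map of the vertices embeds in the sphere, since
  every such point lies in a facet opposite to a vertex of \<open>I\<close>. By invariance of domain its image
  is open in the sphere. A simplex that contains \<open>A - I\<close> has interior points arbitrarily close to the
  barycentre of \<open>A - I\<close>, so one of them lies in the image, hence in one of the facets. If \<open>I = A\<close>,
  the image is open, compact and nonempty, so it is the whole sphere by connectedness, which requires
  \<open>n \<ge> 1\<close>.
\<close>

lemma sphere_star_of_facets:
  fixes V :: "'a::euclidean_space set set"
  assumes V: "geometric V" and T: "(int n + 1) simplex T" and n: "n \<ge> 1"
    and hom: "body V homeomorphic rel_frontier T"
    and A: "finite A" "card A = n + 2" and I: "I \<subseteq> A" "I \<noteq> {}"
    and facets: "\<And>i. i \<in> I \<Longrightarrow> A - {i} \<in> V" and s: "s \<in> V" "A - I \<subseteq> s"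
  shows "s \<subseteq> A"
proof -
  define B where "B = A - I"
  obtain C where C: "\<not> affine_dependent C" "finite C" "card C = n + 2" "T = convex hull C"
    using simplex_vertices[OF T] .
  obtain d where d: "bij_betw d A C" using finite_same_card_bij[OF A(1) C(2)] A(2) C(3) by auto
  then have dinj: "inj_on d A" and dim: "d ` A = C" by (auto simp: bij_betw_def)
  obtain h k where hk: "linear h" "\<And>v. v \<in> C \<Longrightarrow> h v + k = inv_into A d v"
    using exists_affine_through[OF C(1), of "inv_into A d"] by blast
  define \<phi> where "\<phi> y = h y + k" for y
  have \<phi>d: "\<phi> (d a) = a" if "a \<in> A" for a
    using hk(2)[of "d a"] inv_into_f_f[OF dinj that] dim that by (auto simp: \<phi>_def)
  have \<phi>w: "\<phi> (wsum A w d) = point_at A w" if "weights A w" for w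
  proof -
    have "\<phi> (wsum A w d) = (\<Sum>a\<in>A. w a *\<^sub>R h (d a)) + (\<Sum>a\<in>A. w a) *\<^sub>R k"
      using that hk(1) by (simp add: \<phi>_def wsum_def linear_sum linear_cmul weights_def)
    also have "\<dots> = (\<Sum>a\<in>A. w a *\<^sub>R \<phi> (d a))"
      by (simp add: \<phi>_def scaleR_add_right sum.distrib scaleR_sum_left)
    finally show ?thesis using \<phi>d by (simp add: wsum_def)
  qed
  have uniq: "w = w'" if "weights A w" "weights A w'" "wsum A w d = wsum A w' d" for w w'
  proof -
    define p where "p = push_weights d A w"
    define p' where "p' = push_weights d A w'"
    have "weights C p" "weights C p'" "point_at C p = point_at C p'"
      using weights_push[OF that(1) A(1), of d] weights_push[OF that(2) A(1), of d]
        wsum_push[OF A(1), of d w "\<lambda>v. v"] wsum_push[OF A(1), of d w' "\<lambda>v. v"] that(3) dim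
      by (auto simp: p_def p'_def)
    then have "p = p'" using independent_weights_eq[OF C(1,2)] by blast
    have single: "push_weights d A z (d a) = z a" if "a \<in> A" for a and z :: "'a \<Rightarrow> real"
    proof -
      have "{v\<in>A. d v = d a} = {a}" using dinj that by (auto simp: inj_on_def)
      then show ?thesis by (simp add: push_weights_def)
    qed
    have "w a = w' a" for a
    proof (cases "a \<in> A")
      case True
      then show ?thesis using single[of a w] single[of a w'] \<open>p = p'\<close> by (simp add: p_def p'_def)
    next
      case False
      then show ?thesis using that by (auto simp: weights_def)
    qed
    then show ?thesis by blast
  qed
  have frontier: "rel_frontier T = {wsum A w d |w. weights A w \<and> (\<exists>i\<in>A. w i = 0)}" (is "_ = ?R")
  proof
    show "?R \<subseteq> rel_frontier T"
    proof clarify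
      fix w i assume w: "weights A w" "i \<in> A" "w i = 0"
      have "weights (A - {i}) w"
        by (rule weights_restrict[OF w(1)]) (use w A in \<open>auto simp: weights_def\<close>)
      moreover have "wsum A w d = wsum (A - {i}) w d"
        by (rule wsum_weights_cong) (use w A calculation in auto)
      ultimately have "wsum A w d \<in> convex hull (d ` (A - {i}))"
        using wsum_in_hull[of "A - {i}" w d] A by simp
      also have "d ` (A - {i}) = C - {d i}" using dinj dim w(2) by (auto simp: inj_on_def)
      finally have "wsum A w d \<in> convex hull (C - {d i})" .
      moreover have "d i \<in> C" using dim w(2) by blast
      ultimately show "wsum A w d \<in> rel_frontier T"
        using rel_frontier_convex_hull_cases[OF C(1)] C(4) by blast
    qed
    show "rel_frontier T \<subseteq> ?R"
    proof
      fix y assume "y \<in> rel_frontier T"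
      then obtain x where x: "x \<in> C" "y \<in> convex hull (C - {x})"
        using rel_frontier_convex_hull_cases[OF C(1)] C(4) by blast
      obtain i where i: "i \<in> A" "x = d i" using x(1) dim by blast
      have "C - {x} = d ` (A - {i})" using dinj dim i by (auto simp: inj_on_def)
      then obtain w where w: "weights (A - {i}) w" "y = wsum (A - {i}) w d"
        using x(2) hull_image_iff[of "A - {i}" y d] A by auto
      have "weights A w" "y = wsum A w d"
        using weights_mono[OF w(1)] wsum_extend[OF w(1), of A d] A w(2) by auto
      moreover have "w i = 0" using w(1) by (simp add: weights_def)
      ultimately show "y \<in> ?R" using i by blast
    qed
  qed
  \<comment> \<open>The open star of \<open>A - I\<close> in the model: points off the facets opposite to vertices of \<open>A - I\<close>.\<close>
  define U where "U = rel_frontier T - (\<Union>b\<in>B. convex hull (d ` (A - {b})))"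
  have Bsub: "B \<subseteq> A" by (auto simp: B_def)
  have finB: "finite B" using Bsub A finite_subset by blast
  have Uform: "\<exists>w i. weights A w \<and> y = wsum A w d \<and> i \<in> I \<and> weights (A - {i}) w \<and>
      \<phi> y = point_at (A - {i}) w" if y: "y \<in> U" for y
  proof -
    obtain w i where w: "weights A w" "y = wsum A w d" "i \<in> A" "w i = 0"
      using y frontier unfolding U_def by blast
    have res: "weights (A - {j}) w" if "w j = 0" for j
      by (rule weights_restrict[OF w(1)]) (use that w A in \<open>auto simp: weights_def\<close>)
    have "i \<notin> B"
    proof
      assume "i \<in> B"
      have "y = wsum (A - {i}) w d" unfolding w(2)
        by (rule wsum_weights_cong[OF w(1) res[OF w(4)]]) (use A in auto)
      then have "y \<in> convex hull (d ` (A - {i}))"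
        using wsum_in_hull[OF res[OF w(4)]] A by auto
      then show False using y \<open>i \<in> B\<close> by (auto simp: U_def)
    qed
    moreover have "\<phi> y = point_at (A - {i}) w"
      unfolding w(2) \<phi>w[OF w(1)] by (rule wsum_weights_cong[OF w(1) res[OF w(4)]]) (use A in auto)
    ultimately show ?thesis using w res[OF w(4)] by (auto simp: B_def)
  qed
  have \<phi>U: "\<phi> y \<in> body V" if "y \<in> U" for y
    using Uform[OF that] facets body_iff[OF V] by blast
  have \<phi>inj: "inj_on \<phi> U"
  proof (rule inj_onI)
    fix y z assume yz: "y \<in> U" "z \<in> U" "\<phi> y = \<phi> z"
    obtain w i where w: "weights A w" "y = wsum A w d" "i \<in> I" "weights (A - {i}) w"
      "\<phi> y = point_at (A - {i}) w" using Uform[OF yz(1)] by blast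
    obtain w' i' where w': "weights A w'" "z = wsum A w' d" "i' \<in> I" "weights (A - {i'}) w'"
      "\<phi> z = point_at (A - {i'}) w'" using Uform[OF yz(2)] by blast
    have "w = w'"
      using geometric_weights_eq[OF V facets[OF w(3)] facets[OF w'(3)] w(4) w'(4)] w(5) w'(5) yz(3) by simp
    then show "y = z" using w w' by simp
  qed
  have \<phi>cont: "continuous_on X \<phi>" for X
    unfolding \<phi>_def by (intro continuous_intros linear_continuous_on) (simp add: hk(1) linear_conv_bounded_linear[symmetric])
  have Uopen: "openin (top_of_set (rel_frontier T)) U"
  proof -
    have "closed (\<Union>b\<in>B. convex hull (d ` (A - {b})))"
      using finB A by (intro closed_UN) (auto simp: compact_imp_closed compact_convex_hull finite_imp_compact)
    then show ?thesis unfolding U_def by (rule openin_diff_closed)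
  qed
  obtain g g' where g: "homeomorphism (body V) (rel_frontier T) g g'" using hom by (auto simp: homeomorphic_def)
  have cT: "convex T" "bounded T"
    using C by (auto simp: compact_imp_bounded compact_convex_hull finite_imp_compact)
  have "openin (top_of_set (rel_frontier T)) ((g \<circ> \<phi>) ` U)"
  proof (rule invariance_of_domain_rel_frontier[OF _ _ _ cT(2,1) Uopen])
    show "continuous_on U (g \<circ> \<phi>)"
      using \<phi>cont \<phi>U g unfolding homeomorphism_def
      by (metis continuous_on_compose continuous_on_subset image_subsetI)
    have "inj_on g (body V)" using g by (auto simp: homeomorphism_def intro: inj_on_inverseI)
    then show "inj_on (g \<circ> \<phi>) U"
      using \<phi>inj \<phi>U by (meson comp_inj_on image_subsetI inj_on_subset)
    show "(g \<circ> \<phi>) ` U \<subseteq> rel_frontier T" using \<phi>U g by (auto simp: homeomorphism_def)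
  qed
  then have "openin (top_of_set (body V)) (g' ` (g \<circ> \<phi>) ` U)"
    using homeomorphism_imp_open_map[OF homeomorphism_symD[OF g]] by blast
  moreover have "g' ` (g \<circ> \<phi>) ` U = \<phi> ` U"
  proof -
    have "g' (g (\<phi> x)) = \<phi> x" if "x \<in> U" for x using \<phi>U[OF that] g by (simp add: homeomorphism_def)
    then show ?thesis by (simp add: image_comp)
  qed
  ultimately have open\<phi>U: "openin (top_of_set (body V)) (\<phi> ` U)" by simp
  have fins: "finite s" using geometricD(3)[OF V s(1)] .
  have key: "s \<subseteq> A" if p: "weights s u" "\<And>v. v \<in> s \<Longrightarrow> u v > 0" "point_at s u \<in> \<phi> ` U" for u
  proof -
    obtain y where y: "y \<in> U" "point_at s u = \<phi> y" using p(3) by blast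
    obtain w i where w: "i \<in> I" "weights (A - {i}) w" "\<phi> y = point_at (A - {i}) w"
      using Uform[OF y(1)] by blast
    have "\<phi> y \<in> convex hull (A - {i})" unfolding w(3) using w(2) A by (intro iffD2[OF mem_hull_iff]) auto
    then have "s \<subseteq> A - {i}"
      using positive_weights_subset[OF V s(1) facets[OF w(1)] p(1,2)] y(2) by simp
    then show ?thesis by blast
  qed
  show "s \<subseteq> A"
  proof (cases "s = {}")
    case False
    note bs = weights_barycenter[OF fins False] barycenter_pos[OF fins]
    have sb: "point_at s (barycenter s) \<in> body V" using body_iff[OF V] s(1) bs(1) by blast
    show ?thesis
    proof (cases "B = {}")
      case True
      then have UT: "U = rel_frontier T" by (simp add: U_def)
      have "aff_dim T = int n + 1" using aff_dim_simplex[OF T] .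
      then have "connected (rel_frontier T)" using connected_sphere_gen[OF cT] n by simp
      then have conn: "connected (body V)" using homeomorphic_connectedness hom by blast
      have "compact (rel_frontier T)" using compact_rel_frontier_bounded cT(2) by blast
      then have "compact (\<phi> ` U)" unfolding UT using \<phi>cont compact_continuous_image by blast
      then have "closedin (top_of_set (body V)) (\<phi> ` U)"
        using \<phi>U by (intro closed_subset compact_imp_closed) auto
      moreover have "\<phi> ` U \<noteq> {}"
      proof -
        obtain i where i: "i \<in> I" using I by blast
        have "card (A - {i}) = n + 1" using A i I by auto
        then have "A - {i} \<noteq> {}" by (metis Suc_eq_plus1 card.empty nat.distinct(1))
        then have wb: "weights (A - {i}) (barycenter (A - {i}))" using A by (intro weights_barycenter) auto
        then have "weights A (barycenter (A - {i}))" using weights_mono A by blast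
        moreover have "barycenter (A - {i}) i = 0" by (simp add: barycenter_def)
        ultimately have "wsum A (barycenter (A - {i})) d \<in> rel_frontier T"
          unfolding frontier using i I by blast
        then show ?thesis using UT by blast
      qed
      ultimately have "\<phi> ` U = body V"
        using conn open\<phi>U unfolding connected_clopen by blast
      then show ?thesis using key[OF bs] sb by blast
    next
      case False
      let ?w = "barycenter B"
      have wB: "weights B ?w" using weights_barycenter[OF finB False] .
      have wA: "weights A ?w" using weights_mono[OF wB Bsub A(1)] .
      define p where "p = point_at s ?w"
      have ws: "weights s ?w" using weights_mono[OF wB _ fins] s(2) by (simp add: B_def)
      have p: "p = \<phi> (wsum A ?w d)"
        unfolding p_def \<phi>w[OF wA] by (rule wsum_weights_cong[OF ws wA fins A(1)])
      have "wsum A ?w d \<in> U"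
      proof -
        obtain i where i: "i \<in> I" using I by blast
        then have "?w i = 0" "i \<in> A" using I by (auto simp: barycenter_def B_def)
        then have "wsum A ?w d \<in> rel_frontier T" unfolding frontier using wA by blast
        moreover have "wsum A ?w d \<notin> convex hull (d ` (A - {b}))" if b: "b \<in> B" for b
        proof
          assume "wsum A ?w d \<in> convex hull (d ` (A - {b}))"
          then obtain w where w: "weights (A - {b}) w" "wsum A ?w d = wsum (A - {b}) w d"
            using hull_image_iff[of "A - {b}" _ d] A by auto
          have "weights A w" "wsum A w d = wsum (A - {b}) w d"
            using weights_mono[OF w(1)] wsum_extend[OF w(1), of A d] A by auto
          then have "?w = w" using uniq[OF wA] w(2) by simp
          moreover have "w b = 0" using w(1) by (simp add: weights_def)
          ultimately show False using barycenter_pos[OF finB b] by simp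
        qed
        ultimately show ?thesis by (simp add: U_def)
      qed
      then have pU: "p \<in> \<phi> ` U" unfolding p by blast
      obtain O' where O': "open O'" "\<phi> ` U = body V \<inter> O'" using open\<phi>U by (auto simp: openin_open)
      obtain e where e: "e > 0" "ball p e \<subseteq> O'" using O' pU openE by blast
      define q where "q = point_at s (barycenter s)"
      \<comment> \<open>A step from \<open>p\<close> towards the barycentre \<open>q\<close> of \<open>s\<close> that is shorter than \<open>e\<close>.\<close>
      define \<epsilon> where "\<epsilon> = e / (e + norm (q - p))"
      have \<epsilon>: "0 < \<epsilon>" "\<epsilon> \<le> 1" using e by (auto simp: \<epsilon>_def divide_simps add_pos_nonneg)
      define u where "u v = (1 - \<epsilon>) * ?w v + \<epsilon> * barycenter s v" for v
      have upos: "u v > 0" if "v \<in> s" for v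
        using \<epsilon> bs(2)[OF that] wB by (auto simp: u_def weights_def add_nonneg_pos)
      have u: "weights s u"
        using ws bs(1) \<epsilon> unfolding weights_def u_def
        by (auto simp: sum.distrib sum_distrib_left[symmetric])
      have ueq: "point_at s u = p + \<epsilon> *\<^sub>R (q - p)"
      proof -
        have "point_at s u = (1 - \<epsilon>) *\<^sub>R p + \<epsilon> *\<^sub>R q"
          unfolding p_def q_def wsum_def u_def scaleR_sum_right sum.distrib[symmetric]
          by (rule sum.cong) (auto simp: scaleR_add_left)
        then show ?thesis by (simp add: algebra_simps)
      qed
      have "norm (\<epsilon> *\<^sub>R (q - p)) < e"
      proof -
        have "e * norm (q - p) < e * (e + norm (q - p))" using e by simp
        then show ?thesis using e by (simp add: \<epsilon>_def divide_simps add_pos_nonneg)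
      qed
      then have "point_at s u \<in> ball p e" unfolding ueq by (simp add: dist_norm)
      moreover have "point_at s u \<in> body V" using body_iff[OF V] s(1) u by blast
      ultimately have "point_at s u \<in> \<phi> ` U" using O' e by blast
      then show ?thesis using key[OF u upos] by blast
    qed
  qed simp
qed

text \<open>
  The number is 0 or 2. Two \<open>n\<close>-simplices that contain \<open>\<rho>\<close> are facets of an abstract
  \<open>(n+1)\<close>-simplex, and the star of \<open>\<rho>\<close> is exhausted by these two. A single coface \<open>\<sigma>\<close> would contain a whole
  neighbourhood of the barycentre of \<open>\<rho>\<close>; by invariance of domain this neighbourhood would be open in the affine
  hull of \<open>\<sigma>\<close>, although the barycentre lies on the relative boundary of \<open>\<sigma>\<close>.
\<close>

lemma sphere_even_cofaces:
  fixes V :: "'a::euclidean_space set set"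
  assumes V: "geometric V" and T: "(int n + 1) simplex T" and n: "n \<ge> 1"
    and hom: "body V homeomorphic rel_frontier T"
    and dim: "\<And>s. s \<in> V \<Longrightarrow> card s \<le> Suc n" and \<rho>: "finite \<rho>" "card \<rho> = n"
  shows "even (card {\<sigma>\<in>V. card \<sigma> = Suc n \<and> \<rho> \<subseteq> \<sigma>})"
proof (cases "{\<sigma>\<in>V. card \<sigma> = Suc n \<and> \<rho> \<subseteq> \<sigma>} = {}")
  case False
  then obtain \<sigma>1 where \<sigma>1: "\<sigma>1 \<in> V" "card \<sigma>1 = Suc n" "\<rho> \<subseteq> \<sigma>1" by blast
  have fin1: "finite \<sigma>1" using geometricD(3)[OF V \<sigma>1(1)] .
  have apex: "\<exists>w. w \<notin> \<rho> \<and> \<sigma> = insert w \<rho>" if "\<sigma> \<in> V" "card \<sigma> = Suc n" "\<rho> \<subseteq> \<sigma>" for \<sigma>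
  proof -
    have "finite \<sigma>" using geometricD(3)[OF V that(1)] .
    then have "card (\<sigma> - \<rho>) = 1" using that \<rho> by (subst card_Diff_subset) auto
    then obtain w where "\<sigma> - \<rho> = {w}" using card_1_singletonE by blast
    then show ?thesis using that(3) by (intro exI[of _ w]) auto
  qed
  obtain w1 where w1: "w1 \<notin> \<rho>" "\<sigma>1 = insert w1 \<rho>" using apex[OF \<sigma>1] by blast
  show ?thesis
  proof (cases "\<exists>\<sigma>\<in>V. card \<sigma> = Suc n \<and> \<rho> \<subseteq> \<sigma> \<and> \<sigma> \<noteq> \<sigma>1")
    case True
    then obtain \<sigma>2 where \<sigma>2: "\<sigma>2 \<in> V" "card \<sigma>2 = Suc n" "\<rho> \<subseteq> \<sigma>2" "\<sigma>2 \<noteq> \<sigma>1" by blast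
    obtain w2 where w2: "w2 \<notin> \<rho>" "\<sigma>2 = insert w2 \<rho>" using apex[OF \<sigma>2(1-3)] by blast
    have ne: "w1 \<noteq> w2" using w1 w2 \<sigma>2(4) by blast
    define A where "A = insert w1 (insert w2 \<rho>)"
    have A: "finite A" "card A = n + 2" using \<rho> w1 w2 ne by (auto simp: A_def)
    have A1: "A - {w1} = \<sigma>2" "A - {w2} = \<sigma>1" using w1 w2 ne by (auto simp: A_def)
    have "{\<sigma>\<in>V. card \<sigma> = Suc n \<and> \<rho> \<subseteq> \<sigma>} = {\<sigma>1, \<sigma>2}"
    proof
      show "{\<sigma>\<in>V. card \<sigma> = Suc n \<and> \<rho> \<subseteq> \<sigma>} \<subseteq> {\<sigma>1, \<sigma>2}"
      proof
        fix \<sigma> assume \<sigma>: "\<sigma> \<in> {\<sigma>\<in>V. card \<sigma> = Suc n \<and> \<rho> \<subseteq> \<sigma>}"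
        have "\<sigma> \<subseteq> A"
        proof (rule sphere_star_of_facets[OF V T n hom A, of "{w1, w2}"])
          show "A - {i} \<in> V" if "i \<in> {w1, w2}" for i using that A1 \<sigma>1 \<sigma>2 by auto
        qed (use \<sigma> in \<open>auto simp: A_def\<close>)
        moreover obtain w where "w \<notin> \<rho>" "\<sigma> = insert w \<rho>" using apex \<sigma> by blast
        ultimately show "\<sigma> \<in> {\<sigma>1, \<sigma>2}" using w1 w2 by (auto simp: A_def)
      qed
    qed (use \<sigma>1 \<sigma>2 in auto)
    then show ?thesis using \<sigma>2(4) by simp
  next
    case only: False
    obtain g g' where g: "homeomorphism (body V) (rel_frontier T) g g'" using hom by (auto simp: homeomorphic_def)
    have cT: "convex T" "bounded T"
      using simplex_imp_polytope[OF T] by (auto simp: polytope_imp_convex polytope_imp_bounded)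
    \<comment> \<open>The open star of \<open>\<rho>\<close>.\<close>
    define W where "W = body V - (\<Union>s\<in>{s\<in>V. \<not> \<rho> \<subseteq> s}. convex hull s)"
    have coface: "s \<subseteq> \<sigma>1" if "s \<in> V" "\<rho> \<subseteq> s" for s
    proof (cases "card s = Suc n")
      case True
      then show ?thesis using only that by blast
    next
      case False
      then have "card s \<le> card \<rho>" using dim[OF that(1)] \<rho> by simp
      then have "s = \<rho>" using card_seteq[OF geometricD(3)[OF V that(1)] that(2)] by simp
      then show ?thesis using \<sigma>1 by simp
    qed
    have Wsub: "W \<subseteq> convex hull \<sigma>1"
    proof
      fix y assume y: "y \<in> W"
      then obtain s where s: "s \<in> V" "y \<in> convex hull s" by (auto simp: W_def body_def)
      then have "\<rho> \<subseteq> s" using y by (auto simp: W_def)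
      then show "y \<in> convex hull \<sigma>1" using coface[OF s(1)] s(2) hull_mono by blast
    qed
    have Wopen: "openin (top_of_set (body V)) W"
    proof -
      let ?F = "\<Union>s\<in>{s\<in>V. \<not> \<rho> \<subseteq> s}. convex hull s"
      have "closed ?F"
        using geometricD(2,3)[OF V] by (intro closed_UN) (auto simp: compact_imp_closed compact_convex_hull finite_imp_compact)
      then show ?thesis unfolding W_def by (rule openin_diff_closed)
    qed
    have gW: "openin (top_of_set (rel_frontier T)) (g ` W)" using homeomorphism_imp_open_map[OF g Wopen] .
    have WV: "W \<subseteq> body V" by (auto simp: W_def)
    have g'g: "g' (g y) = y" if "y \<in> body V" for y using g that by (simp add: homeomorphism_def)
    have "openin (top_of_set (affine hull \<sigma>1)) (g' ` (g ` W))"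
    proof (rule invariance_of_domain_sphere_affine_set_gen[OF _ _ _ cT(2,1) _ _ gW])
      show "continuous_on (g ` W) g'"
        using g WV unfolding homeomorphism_def by (metis continuous_on_subset image_mono)
      show "inj_on g' (g ` W)" using g'g WV by (auto simp: inj_on_def subset_iff)
      show "g' \<in> g ` W \<rightarrow> affine hull \<sigma>1"
        using g'g WV Wsub convex_hull_subset_affine_hull[of \<sigma>1] by (auto simp: subset_iff)
      have "aff_dim (affine hull \<sigma>1) = int n"
        using aff_dim_affine_independent[OF geometricD(5)[OF V \<sigma>1(1)]] \<sigma>1(2) by simp
      then show "aff_dim (affine hull \<sigma>1) < aff_dim T" using aff_dim_simplex[OF T] by simp
    qed simp
    moreover have "g' ` (g ` W) = W"
    proof -
      have "g' (g y) = y" if "y \<in> W" for y using g'g that WV by blast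
      then show ?thesis by (simp add: image_comp)
    qed
    ultimately have "openin (top_of_set (affine hull (convex hull \<sigma>1))) W" by simp
    then have Wint: "W \<subseteq> rel_interior (convex hull \<sigma>1)" using rel_interior_maximal Wsub by blast
    have \<rho>V: "\<rho> \<in> V" using geometricD(4)[OF V \<sigma>1(1,3)] .
    have \<rho>ne: "\<rho> \<noteq> {}" using \<rho> n by auto
    note b\<rho> = weights_barycenter[OF \<rho>(1) \<rho>ne] barycenter_pos[OF \<rho>(1)]
    define p where "p = point_at \<rho> (barycenter \<rho>)"
    have "p \<notin> convex hull s" if "s \<in> V" "\<not> \<rho> \<subseteq> s" for s
      using positive_weights_subset[OF V \<rho>V that(1) b\<rho>] that(2) by (auto simp: p_def)
    moreover have "p \<in> body V" unfolding p_def body_iff[OF V] using \<rho>V b\<rho>(1) by blast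
    ultimately have "p \<in> W" unfolding W_def by blast
    then have "p \<in> rel_interior (convex hull \<sigma>1)" using Wint by blast
    then obtain u where u: "\<forall>x\<in>\<sigma>1. 0 < u x" "sum u \<sigma>1 = 1" "(\<Sum>x\<in>\<sigma>1. u x *\<^sub>R x) = p"
      unfolding rel_interior_convex_hull_explicit[OF geometricD(5)[OF V \<sigma>1(1)]] by blast
    define u' where "u' v = (if v \<in> \<sigma>1 then u v else 0)" for v
    have u': "weights \<sigma>1 u'" "point_at \<sigma>1 u' = p"
      using u by (auto simp: weights_def wsum_def u'_def less_imp_le)
    have "\<sigma>1 \<subseteq> \<rho>"
    proof (rule positive_weights_subset[OF V \<sigma>1(1) \<rho>V u'(1)])
      show "0 < u' v" if "v \<in> \<sigma>1" for v using u(1) that by (simp add: u'_def)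
      show "point_at \<sigma>1 u' \<in> convex hull \<rho>"
        unfolding u'(2) p_def using mem_hull_iff[OF \<rho>(1)] b\<rho>(1) by blast
    qed
    then show ?thesis using w1 by blast
  qed
next
  case True
  then show ?thesis by (metis card.empty even_zero)
qed

section \<open>Parity of the number of solutions on a generic ray\<close>

definition nonneg_solutions :: "'e::euclidean_space set \<Rightarrow> 'e \<Rightarrow> ('e \<Rightarrow> real) set" where
  "nonneg_solutions J b = {y. (\<forall>c. 0 \<le> y c) \<and> (\<forall>c. c \<notin> J \<longrightarrow> y c = 0) \<and> (\<Sum>c\<in>J. y c *\<^sub>R c) = b}"

lemma nonneg_solutions_mono:
  assumes "I \<subseteq> J" "finite J" "y \<in> nonneg_solutions I b"
  shows "y \<in> nonneg_solutions J b"
proof -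
  have "(\<Sum>c\<in>I. y c *\<^sub>R c) = (\<Sum>c\<in>J. y c *\<^sub>R c)"
    by (rule sum.mono_neutral_left) (use assms in \<open>auto simp: nonneg_solutions_def\<close>)
  then show ?thesis using assms unfolding nonneg_solutions_def by auto
qed

lemma nonneg_solutions_restrict:
  assumes "I \<subseteq> J" "finite J" "y \<in> nonneg_solutions J b" "\<And>c. c \<notin> I \<Longrightarrow> y c = 0"
  shows "y \<in> nonneg_solutions I b"
proof -
  have "(\<Sum>c\<in>I. y c *\<^sub>R c) = (\<Sum>c\<in>J. y c *\<^sub>R c)"
    by (rule sum.mono_neutral_left) (use assms in auto)
  then show ?thesis using assms unfolding nonneg_solutions_def by auto
qed

lemma nonneg_solutions_support:
  assumes "finite J" "y \<in> nonneg_solutions J b"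
  shows "b \<in> span {c\<in>J. y c \<noteq> 0}"
proof -
  have "b = (\<Sum>c\<in>{c\<in>J. y c \<noteq> 0}. y c *\<^sub>R c)"
    using assms unfolding nonneg_solutions_def
    by (auto intro!: sum.mono_neutral_right)
  also have "\<dots> \<in> span {c\<in>J. y c \<noteq> 0}"
    by (rule span_sum) (auto intro: span_scale span_base)
  finally show ?thesis .
qed

lemma generic_basis:
  assumes J: "finite J" "card J = DIM('e)" and b: "b \<in> span J"
    and gen: "\<And>I. I \<subseteq> J \<Longrightarrow> card I < DIM('e::euclidean_space) \<Longrightarrow> (b::'e) \<notin> span I"
  shows "independent J"
proof
  assume "dependent J"
  then obtain d where d: "d \<in> J" "d \<in> span (J - {d})" unfolding dependent_def by blast
  have "span J = span (J - {d})" using d span_redundant[OF d(2)] by (simp add: insert_absorb)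
  moreover have "card (J - {d}) < DIM('e)" using J d by (metis card_Diff1_less)
  ultimately show False using gen[of "J - {d}"] b by blast
qed

lemma independent_kernel_zero:
  assumes "independent J" "finite J" "\<And>c. c \<notin> J \<Longrightarrow> y c = 0" "(\<Sum>c\<in>J. y c *\<^sub>R c) = 0"
  shows "y = (\<lambda>c. 0)"
proof
  fix c show "y c = 0"
    using assms dependent_finite[OF assms(2)] by (cases "c \<in> J") blast+
qed

lemma nonneg_solutions_unique:
  fixes b :: "'e::euclidean_space"
  assumes J: "finite J" "card J = DIM('e)"
    and gen: "\<And>I. I \<subseteq> J \<Longrightarrow> card I < DIM('e) \<Longrightarrow> b \<notin> span I"
    and y: "y \<in> nonneg_solutions J b" and z: "z \<in> nonneg_solutions J b"
  shows "z = y"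
proof -
  have "b \<in> span {e\<in>J. y e \<noteq> 0}" using nonneg_solutions_support[OF J(1) y] .
  then have "b \<in> span J" using span_mono[of "{e\<in>J. y e \<noteq> 0}" J] by blast
  then have ind: "independent J" using generic_basis[OF J] gen by blast
  have "(\<lambda>e. z e - y e) = (\<lambda>e. 0)"
    by (rule independent_kernel_zero[OF ind J(1)])
      (use z y in \<open>auto simp: nonneg_solutions_def scaleR_diff_left sum_subtractf\<close>)
  then show ?thesis by (metis eq_iff_diff_eq_0 ext)
qed

text \<open>
  There is one more column than there are equations. If there is a solution at all, the solutions with
  arbitrary signs form a line by genericity, and its nonnegative part is bounded by the hypothesis on the
  kernel, hence a segment. Genericity also excludes solutions with two vanishing coordinates, so exactly
  two coordinates vanish somewhere on the segment, one at each end.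
\<close>

lemma even_facet_solutions:
  fixes b :: "'e::euclidean_space"
  assumes J: "finite J" "card J = DIM('e) + 1"
    and gen: "\<And>I. I \<subseteq> J \<Longrightarrow> card I < DIM('e) \<Longrightarrow> b \<notin> span I"
    and ker: "\<And>y. y \<in> nonneg_solutions J 0 \<Longrightarrow> y = (\<lambda>c. 0)"
  shows "even (\<Sum>c\<in>J. card (nonneg_solutions (J - {c}) b))"
proof -
  have cardJ: "card (J - {c}) = DIM('e)" if "c \<in> J" for c using J that by simp
  have pos: "y d > 0" if "c \<in> J" "y \<in> nonneg_solutions (J - {c}) b" "d \<in> J" "d \<noteq> c" for c d y
  proof (rule ccontr)
    assume "\<not> y d > 0"
    then have 0: "y d = 0" using that(2) unfolding nonneg_solutions_def by (simp add: order.antisym)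
    have "{e\<in>J - {c}. y e \<noteq> 0} \<subseteq> J - {c} - {d}" using 0 by auto
    then have "b \<in> span (J - {c} - {d})"
      using nonneg_solutions_support[OF _ that(2)] J span_mono by blast
    moreover have "card (J - {c} - {d}) < DIM('e)"
      using that J cardJ[OF that(1)] card_Diff1_less[of "J - {c}" d] by simp
    ultimately show False using gen by (metis Diff_subset order_trans)
  qed
  have ind: "independent (J - {c})" if c: "c \<in> J" "y \<in> nonneg_solutions (J - {c}) b" for c y
  proof (rule generic_basis)
    have "b \<in> span {e\<in>J - {c}. y e \<noteq> 0}" using nonneg_solutions_support[OF _ c(2)] J(1) by blast
    then show "b \<in> span (J - {c})" using span_mono[of "{e\<in>J - {c}. y e \<noteq> 0}" "J - {c}"] by blast
    show "b \<notin> span I" if "I \<subseteq> J - {c}" "card I < DIM('e)" for I using gen that by blast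
  qed (use J c cardJ in auto)
  have one: "card (nonneg_solutions (J - {c}) b) = (if nonneg_solutions (J - {c}) b \<noteq> {} then 1 else 0)"
    if c: "c \<in> J" for c
  proof (cases "nonneg_solutions (J - {c}) b = {}")
    case False
    then obtain y where y: "y \<in> nonneg_solutions (J - {c}) b" by blast
    have "z = y" if z: "z \<in> nonneg_solutions (J - {c}) b" for z
      by (rule nonneg_solutions_unique[OF _ cardJ[OF c] _ y z]) (use J gen in auto)
    then have "nonneg_solutions (J - {c}) b = {y}" using y by blast
    then show ?thesis by simp
  qed simp
  define G where "G = {c\<in>J. nonneg_solutions (J - {c}) b \<noteq> {}}"
  have "(\<Sum>c\<in>J. card (nonneg_solutions (J - {c}) b)) = (\<Sum>c\<in>J. if nonneg_solutions (J - {c}) b \<noteq> {} then 1 else 0)"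
    by (rule sum.cong) (use one in auto)
  also have "\<dots> = card G" unfolding G_def using J(1) by (simp add: sum.If_cases Int_def)
  also have "even (card G)"
  proof (cases "G = {}")
    case False
    then obtain c0 where c0: "c0 \<in> G" by blast
    then have c0J: "c0 \<in> J" by (simp add: G_def)
    obtain y0 where y0: "y0 \<in> nonneg_solutions (J - {c0}) b" using c0 by (auto simp: G_def)
    note ind0 = ind[OF c0J y0]
    have y0J: "y0 \<in> nonneg_solutions J b"
      using nonneg_solutions_mono[OF _ J(1) y0] by blast
    have "dependent J" using dependent_biggerset[of J] J by auto
    then obtain k0 where k0: "\<exists>v\<in>J. k0 v \<noteq> 0" "(\<Sum>v\<in>J. k0 v *\<^sub>R v) = 0"
      using dependent_finite[OF J(1)] by blast
    have k0c0: "k0 c0 \<noteq> 0"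
    proof
      assume z: "k0 c0 = 0"
      have "(\<Sum>v\<in>J - {c0}. k0 v *\<^sub>R v) = 0"
        using k0(2) sum.remove[OF J(1) c0J, of "\<lambda>v. k0 v *\<^sub>R v"] z by simp
      then have "\<forall>v\<in>J - {c0}. k0 v = 0"
        using ind0 dependent_finite[of "J - {c0}"] J(1) by (metis finite_Diff)
      then show False using k0(1) z by blast
    qed
    \<comment> \<open>The direction of the segment, scaled so that the parameter on it is the coordinate at \<open>c0\<close>.\<close>
    define k where "k c = (if c \<in> J then k0 c / k0 c0 else 0)" for c
    have kc0: "k c0 = 1" using k0c0 c0J by (simp add: k_def)
    have koff: "k c = 0" if "c \<notin> J" for c using that by (simp add: k_def)
    have ksum: "(\<Sum>v\<in>J. k v *\<^sub>R v) = 0"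
    proof -
      have "(\<Sum>v\<in>J. k v *\<^sub>R v) = (1 / k0 c0) *\<^sub>R (\<Sum>v\<in>J. k0 v *\<^sub>R v)"
        unfolding scaleR_sum_right by (rule sum.cong) (auto simp: k_def)
      then show ?thesis using k0(2) by simp
    qed
    define N where "N = {d\<in>J. k d < 0}"
    have finN: "finite N" using J by (simp add: N_def)
    have "N \<noteq> {}"
    proof
      assume "N = {}"
      then have "\<forall>c. 0 \<le> k c" using koff unfolding N_def
        by (metis (mono_tags, lifting) empty_Collect_eq linorder_not_le order_refl)
      then have "k \<in> nonneg_solutions J 0" using koff ksum by (simp add: nonneg_solutions_def)
      then show False using ker kc0 by fastforce
    qed
    \<comment> \<open>The parameter at which the first coordinate vanishes.\<close>
    define r where "r = Min ((\<lambda>d. y0 d / - k d) ` N)"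
    obtain c1 where c1: "c1 \<in> N" "r = y0 c1 / - k c1"
      using Min_in[of "(\<lambda>d. y0 d / - k d) ` N"] finN \<open>N \<noteq> {}\<close> unfolding r_def by blast
    have c1J: "c1 \<in> J" "k c1 < 0" using c1 by (auto simp: N_def)
    have c10: "c1 \<noteq> c0" using c1J kc0 by auto
    have rpos: "r > 0" using pos[OF c0J y0 c1J(1) c10] c1J c1 by (simp add: divide_pos_neg)
    have rmin: "r \<le> y0 d / - k d" if "d \<in> N" for d
      unfolding r_def using finN that by (intro Min_le) auto
    have line: "(\<lambda>c. y0 c + \<rho> * k c) \<in> nonneg_solutions J b" if "\<And>c. 0 \<le> y0 c + \<rho> * k c" for \<rho>
    proof -
      have "(\<Sum>c\<in>J. (y0 c + \<rho> * k c) *\<^sub>R c) = (\<Sum>c\<in>J. y0 c *\<^sub>R c) + \<rho> *\<^sub>R (\<Sum>c\<in>J. k c *\<^sub>R c)"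
        by (simp add: scaleR_add_left sum.distrib scaleR_sum_right)
      also have "\<dots> = b" using ksum y0J by (simp add: nonneg_solutions_def)
      finally show ?thesis using that y0J koff by (simp add: nonneg_solutions_def)
    qed
    define y1 where "y1 c = y0 c + r * k c" for c
    have y1c1: "y1 c1 = 0" using c1 c1J by (simp add: y1_def)
    have "0 \<le> y1 c" for c
    proof (cases "c \<in> N")
      case True
      then have "r * - k c \<le> y0 c" using rmin[OF True] 
        by (subst (asm) pos_le_divide_eq) (auto simp: N_def)
      then show ?thesis by (simp add: y1_def)
    next
      case False
      then have "0 \<le> k c" using koff[of c] by (cases "c \<in> J") (auto simp: N_def)
      moreover have "0 \<le> y0 c" using y0J by (simp add: nonneg_solutions_def)
      ultimately show ?thesis using rpos by (simp add: y1_def)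
    qed
    then have y1J: "y1 \<in> nonneg_solutions J b" using line[of r] unfolding y1_def by blast
    have y1: "y1 \<in> nonneg_solutions (J - {c1}) b"
      by (rule nonneg_solutions_restrict[OF _ J(1) y1J])
        (use y1J y1c1 in \<open>auto simp: nonneg_solutions_def\<close>)
    have "c1 \<in> G" using y1 c1J by (auto simp: G_def)
    moreover have "c = c1" if cG: "c \<in> G" "c \<noteq> c0" for c
    proof -
      have cJ: "c \<in> J" using cG by (simp add: G_def)
      obtain z where z: "z \<in> nonneg_solutions (J - {c}) b" using cG by (auto simp: G_def)
      have zJ: "z \<in> nonneg_solutions J b" using nonneg_solutions_mono[OF _ J(1) z] by blast
      define \<rho> where "\<rho> = z c0"
      have \<rho>: "\<rho> > 0" using pos[OF cJ z c0J] cG by (simp add: \<rho>_def)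
      let ?d = "\<lambda>e. z e - y0 e - \<rho> * k e"
      have d0: "?d c0 = 0" using y0 kc0 by (simp add: \<rho>_def nonneg_solutions_def)
      have "(\<Sum>e\<in>J. ?d e *\<^sub>R e) = 0"
      proof -
        have "(\<Sum>e\<in>J. ?d e *\<^sub>R e) = (\<Sum>e\<in>J. z e *\<^sub>R e) - (\<Sum>e\<in>J. y0 e *\<^sub>R e) - \<rho> *\<^sub>R (\<Sum>e\<in>J. k e *\<^sub>R e)"
          by (simp add: scaleR_diff_left sum_subtractf scaleR_sum_right)
        then show ?thesis using zJ y0J ksum by (simp add: nonneg_solutions_def)
      qed
      then have "(\<Sum>e\<in>J - {c0}. ?d e *\<^sub>R e) = 0"
        using sum.remove[OF J(1) c0J, of "\<lambda>e. ?d e *\<^sub>R e"] d0 by simp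
      moreover have "?d e = 0" if "e \<notin> J - {c0}" for e
        using that d0 zJ y0J koff[of e] by (cases "e = c0") (auto simp: nonneg_solutions_def)
      ultimately have "?d = (\<lambda>c. 0)"
        using independent_kernel_zero[OF ind0, of ?d] J(1) by blast
      then have zeq: "z e = y0 e + \<rho> * k e" for e by (metis add_diff_cancel_left' diff_eq_diff_eq diff_zero eq_iff_diff_eq_0 diff_diff_eq)
      have zc: "z c = 0" using z by (simp add: nonneg_solutions_def)
      have y0c: "y0 c > 0" using pos[OF c0J y0 cJ] cG by simp
      have "\<rho> * k c < 0" using zeq[of c] zc y0c by linarith
      then have kc: "k c < 0" using \<rho> by (simp add: mult_less_0_iff)
      then have "r \<le> y0 c / - k c" using cJ by (intro rmin) (simp add: N_def)
      also have "y0 c / - k c = \<rho>" using zeq[of c] zc kc by (simp add: field_simps)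
      finally have "r \<le> \<rho>" .
      moreover have "\<rho> \<le> r"
      proof -
        have "0 \<le> z c1" using z by (simp add: nonneg_solutions_def)
        then have "\<rho> * - k c1 \<le> y0 c1" using zeq[of c1] by simp
        then show ?thesis unfolding c1(2) using c1J by (subst pos_le_divide_eq) auto
      qed
      ultimately have "z = y1" using zeq unfolding y1_def by (intro ext) simp
      then have "y1 c = 0" using zc by simp
      then show "c = c1" using pos[OF c1J(1) y1 cJ] by fastforce
    qed
    ultimately have "G = {c0, c1}" using c0 by blast
    then show ?thesis using c10 by simp
  qed simp
  finally show ?thesis .
qed

text \<open>
  If \<open>p\<close> and \<open>q\<close> have coordinates \<open>u\<close> and \<open>w\<close> with respect to \<open>S\<close> and \<open>T\<close>, and \<open>p - q = r v\<close> with
  \<open>r > 0\<close>, then \<open>u / r\<close> and \<open>w / r\<close> are the coefficients of a nonnegative solution for the right-hand side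
  \<open>(v, 0)\<close>; the last coordinate makes the two sums of coefficients equal.
\<close>

definition ray_columns :: "'e::euclidean_space set \<Rightarrow> 'e set \<Rightarrow> ('e \<times> real) set" where
  "ray_columns S T = (\<lambda>s. (s, 1)) ` S \<union> (\<lambda>t. (- t, - 1)) ` T"

text \<open>
  For generic \<open>v\<close> and simplices of dimension \<open>n\<close> in a space of dimension \<open>2n + 1\<close>, this is the number of
  pairs of points of the two simplices whose difference is a positive multiple of \<open>v\<close>.
\<close>

definition ray_count :: "'e::euclidean_space set \<Rightarrow> 'e set \<Rightarrow> 'e \<Rightarrow> nat" where
  "ray_count S T v = card (nonneg_solutions (ray_columns S T) (v, 0))"

definition generic_direction :: "'e::euclidean_space set \<Rightarrow> 'e \<Rightarrow> bool" where
  "generic_direction E v \<longleftrightarrow>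
     (\<forall>I. I \<subseteq> ray_columns E E \<longrightarrow> card I \<le> DIM('e) \<longrightarrow> (v, 0) \<notin> span I)"

lemma columns_mono: "S \<subseteq> S' \<Longrightarrow> T \<subseteq> T' \<Longrightarrow> ray_columns S T \<subseteq> ray_columns S' T'"
  unfolding ray_columns_def by blast

lemma finite_columns: "finite S \<Longrightarrow> finite T \<Longrightarrow> finite (ray_columns S T)"
  by (simp add: ray_columns_def)

lemma columns_sum:
  assumes "finite S" "finite T"
  shows "(\<Sum>c\<in>ray_columns S T. g c) = (\<Sum>s\<in>S. g (s, 1)) + (\<Sum>t\<in>T. g (- t, - 1))"
proof -
  have "(\<lambda>s. (s, 1::real)) ` S \<inter> (\<lambda>t. (- t, - 1)) ` T = {}" by auto
  then have "(\<Sum>c\<in>ray_columns S T. g c) = sum g ((\<lambda>s. (s, 1)) ` S) + sum g ((\<lambda>t. (- t, - 1)) ` T)"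
    unfolding ray_columns_def using assms by (intro sum.union_disjoint) auto
  also have "sum g ((\<lambda>s. (s, 1)) ` S) = (\<Sum>s\<in>S. g (s, 1))"
    by (subst sum.reindex) (auto simp: inj_on_def)
  also have "sum g ((\<lambda>t. (- t, - 1)) ` T) = (\<Sum>t\<in>T. g (- t, - 1))"
    by (subst sum.reindex) (auto simp: inj_on_def)
  finally show ?thesis .
qed

lemma card_columns:
  assumes "finite S" "finite T" shows "card (ray_columns S T) = card S + card T"
  using columns_sum[OF assms, of "\<lambda>_. 1::nat"] by simp

lemma columns_solution_iff:
  assumes "finite S" "finite T"
  shows "y \<in> nonneg_solutions (ray_columns S T) (v, 0) \<longleftrightarrow>
    (\<forall>c. 0 \<le> y c) \<and> (\<forall>c. c \<notin> ray_columns S T \<longrightarrow> y c = 0) \<and>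
    (\<Sum>s\<in>S. y (s, 1)) = (\<Sum>t\<in>T. y (- t, - 1)) \<and>
    (\<Sum>s\<in>S. y (s, 1) *\<^sub>R s) - (\<Sum>t\<in>T. y (- t, - 1) *\<^sub>R t) = v"
proof -
  have "(\<Sum>c\<in>ray_columns S T. y c *\<^sub>R c) = 
      (\<Sum>s\<in>S. (y (s, 1) *\<^sub>R s, y (s, 1))) + (\<Sum>t\<in>T. (- (y (- t, - 1) *\<^sub>R t), - y (- t, - 1)))"
    by (simp add: columns_sum[OF assms])
  also have "\<dots> = ((\<Sum>s\<in>S. y (s, 1) *\<^sub>R s) - (\<Sum>t\<in>T. y (- t, - 1) *\<^sub>R t),
      (\<Sum>s\<in>S. y (s, 1)) - (\<Sum>t\<in>T. y (- t, - 1)))"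
    by (simp add: prod_eq_iff fst_sum snd_sum sum_negf)
  finally show ?thesis unfolding nonneg_solutions_def by auto
qed

text \<open>
  The span of at most \<open>DIM('e)\<close> columns cannot contain the hyperplane of all \<open>(v, 0)\<close>: by dimension it
  would be equal to this hyperplane, but the last coordinate of a column is \<open>1\<close> or \<open>-1\<close>. So the bad
  \<open>v\<close> lie in finitely many proper subspaces.
\<close>

lemma AE_generic_direction:
  assumes "finite (E :: 'e::euclidean_space set)"
  shows "AE v in lborel. generic_direction E v"
proof -
  have one: "AE v in lborel. (v, 0::real) \<notin> span I"
    if I: "I \<subseteq> ray_columns E E" "card I \<le> DIM('e)" for I
  proof -
    let ?W = "{v::'e. (v, 0::real) \<in> span I}"
    have finI: "finite I" using I(1) finite_columns[OF assms assms] finite_subset by blast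
    have sub: "subspace ?W"
      unfolding subspace_def
    proof (intro conjI ballI allI)
      show "0 \<in> ?W" using span_zero[of I] by (simp add: zero_prod_def)
      fix x y c assume x: "x \<in> ?W"
      show "y \<in> ?W \<Longrightarrow> x + y \<in> ?W" using x span_add[of "(x, 0)" I "(y, 0)"] by simp
      show "c *\<^sub>R x \<in> ?W" using x span_scale[of "(x, 0)" I c] by simp
    qed
    have "dim ?W < DIM('e)"
    proof (rule ccontr)
      assume "\<not> dim ?W < DIM('e)"
      then have "dim ?W = DIM('e)" using dim_subset_UNIV[of ?W] by linarith
      then have "span ?W = UNIV" using dim_eq_full by blast
      then have W: "(v, 0) \<in> span I" for v using sub by (metis UNIV_I mem_Collect_eq span_eq_iff)
      show False
      proof (cases "I = {}")
        case True
        obtain b :: 'e where "b \<in> Basis" using nonempty_Basis by blast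
        then have "b \<noteq> 0" by (rule nonzero_Basis)
        then show ?thesis using W[of b] True by (simp add: zero_prod_def)
      next
        case False
        then obtain c where c: "c \<in> I" by blast
        then have sc: "snd c \<noteq> 0" using I(1) by (auto simp: ray_columns_def)
        have "x \<in> span I" for x :: "'e \<times> real"
        proof -
          let ?l = "snd x / snd c"
          have "x = ?l *\<^sub>R c + (fst x - ?l *\<^sub>R fst c, 0)"
            using sc by (simp add: prod_eq_iff)
          then show ?thesis using span_add[OF span_scale[OF span_base[OF c], of ?l] W] by metis
        qed
        then have "span I = UNIV" by blast
        then have "dim I = DIM('e \<times> real)" by (rule iffD2[OF dim_eq_full])
        moreover have "dim I \<le> card I" using dim_le_card'[OF finI] .
        ultimately show False using I(2) by simp
      qed
    qed
    then have "negligible ?W" by (rule negligible_lowdim)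
    then have "?W \<in> null_sets lebesgue" by (simp add: negligible_iff_null_sets)
    moreover have "?W \<in> sets lborel" using closed_subspace[OF sub] by simp
    ultimately have "?W \<in> null_sets lborel"
      by (simp add: null_sets_def emeasure_completion)
    then show ?thesis by (rule AE_I'[of ?W]) auto
  qed
  have "AE v in lborel. \<forall>I\<in>{I. I \<subseteq> ray_columns E E \<and> card I \<le> DIM('e)}. (v, 0::real) \<notin> span I"
    by (rule AE_finite_allI) (use finite_columns[OF assms assms] one in auto)
  then show ?thesis unfolding generic_direction_def by (rule AE_mp) (auto intro!: AE_I2)
qed

text \<open>
  A nonnegative element of the kernel would be a common point of the two hulls, up to scaling.
\<close>

lemma even_ray_count_facets:
  fixes S T E :: "'e::euclidean_space set"
  assumes fin: "finite S" "finite T" and sub: "S \<subseteq> E" "T \<subseteq> E" and card: "card S + card T = DIM('e) + 2"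
    and disj: "convex hull S \<inter> convex hull T = {}" and gen: "generic_direction E v"
  shows "even ((\<Sum>s\<in>S. ray_count (S - {s}) T v) + (\<Sum>t\<in>T. ray_count S (T - {t}) v))"
proof -
  let ?J = "ray_columns S T"
  have "even (\<Sum>c\<in>?J. card (nonneg_solutions (?J - {c}) (v, 0)))"
  proof (rule even_facet_solutions)
    show "finite ?J" using finite_columns fin by blast
    show "card ?J = DIM('e \<times> real) + 1" using card_columns[OF fin] card by simp
    show "(v, 0) \<notin> span I" if "I \<subseteq> ?J" "card I < DIM('e \<times> real)" for I
      using gen that columns_mono[OF sub] unfolding generic_direction_def by auto
    show "y = (\<lambda>c. 0)" if y: "y \<in> nonneg_solutions ?J 0" for y
    proof (rule ccontr)
      assume ny: "y \<noteq> (\<lambda>c. 0)"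
      define \<sigma> where "\<sigma> = (\<Sum>s\<in>S. y (s, 1))"
      have Y: "\<And>c. 0 \<le> y c" "\<And>c. c \<notin> ?J \<Longrightarrow> y c = 0" "\<sigma> = (\<Sum>t\<in>T. y (- t, - 1))"
        "(\<Sum>s\<in>S. y (s, 1) *\<^sub>R s) = (\<Sum>t\<in>T. y (- t, - 1) *\<^sub>R t)"
        using columns_solution_iff[OF fin, of y 0] y unfolding zero_prod_def[symmetric] \<sigma>_def by auto
      have "\<sigma> \<noteq> 0"
      proof
        assume "\<sigma> = 0"
        then have "\<forall>s\<in>S. y (s, 1) = 0" "\<forall>t\<in>T. y (- t, - 1) = 0"
          using Y(1,3) fin unfolding \<sigma>_def by (simp_all add: sum_nonneg_eq_0_iff)
        then have "y c = 0" for c using Y(2)[of c] by (auto simp: ray_columns_def)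
        then show False using ny by blast
      qed
      moreover have "\<sigma> \<ge> 0" unfolding \<sigma>_def using Y(1) by (simp add: sum_nonneg)
      ultimately have \<sigma>: "\<sigma> > 0" by simp
      have "(\<Sum>s\<in>S. (y (s, 1) / \<sigma>) *\<^sub>R s) \<in> convex hull S"
        using \<sigma> Y(1) by (intro convex_sum fin) (auto simp: hull_inc \<sigma>_def sum_divide_distrib[symmetric])
      moreover have "(\<Sum>t\<in>T. (y (- t, - 1) / \<sigma>) *\<^sub>R t) \<in> convex hull T"
        using \<sigma> Y(1,3) by (intro convex_sum fin) (auto simp: hull_inc sum_divide_distrib[symmetric])
      moreover have "(\<Sum>s\<in>S. (y (s, 1) / \<sigma>) *\<^sub>R s) = (1 / \<sigma>) *\<^sub>R (\<Sum>s\<in>S. y (s, 1) *\<^sub>R s)"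
        "(\<Sum>t\<in>T. (y (- t, - 1) / \<sigma>) *\<^sub>R t) = (1 / \<sigma>) *\<^sub>R (\<Sum>t\<in>T. y (- t, - 1) *\<^sub>R t)"
        by (simp_all add: scaleR_sum_right)
      ultimately show False using disj Y(4) by auto
    qed
  qed
  moreover have "?J - {(s, 1)} = ray_columns (S - {s}) T" for s by (auto simp: ray_columns_def)
  moreover have "?J - {(- t, - 1)} = ray_columns S (T - {t})" for t by (auto simp: ray_columns_def)
  ultimately show ?thesis unfolding columns_sum[OF fin] ray_count_def by simp
qed

text \<open>
  Double counting: \<open>\<rho>\<close> appears as a facet once for every member of \<open>Z\<close> that contains it.
\<close>

lemma even_sum_facets:
  fixes F :: "'q set \<Rightarrow> nat"
  assumes Z: "finite Z" "\<And>\<tau>. \<tau> \<in> Z \<Longrightarrow> finite \<tau> \<and> card \<tau> = Suc n"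
    and ev: "\<And>\<rho>. card \<rho> = n \<Longrightarrow> finite \<rho> \<Longrightarrow> even (F \<rho> * card {\<tau>\<in>Z. \<rho> \<subseteq> \<tau>})"
  shows "even (\<Sum>\<tau>\<in>Z. \<Sum>j\<in>\<tau>. F (\<tau> - {j}))"
proof -
  let ?P = "Sigma Z (\<lambda>\<tau>. \<tau>)" and ?r = "\<lambda>(\<tau>, j). \<tau> - {j}"
  have finP: "finite ?P" using Z by (intro finite_SigmaI) auto
  have "(\<Sum>\<tau>\<in>Z. \<Sum>j\<in>\<tau>. F (\<tau> - {j})) = (\<Sum>p\<in>?P. F (?r p))"
    using Z by (subst sum.Sigma) (auto simp: case_prod_unfold)
  also have "\<dots> = (\<Sum>\<rho>\<in>?r ` ?P. \<Sum>p\<in>{p\<in>?P. ?r p = \<rho>}. F (?r p))"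
    by (rule sum.image_gen[OF finP])
  also have "\<dots> = (\<Sum>\<rho>\<in>?r ` ?P. F \<rho> * card {\<tau>\<in>Z. \<rho> \<subseteq> \<tau>})"
  proof (rule sum.cong[OF refl])
    fix \<rho> assume "\<rho> \<in> ?r ` ?P"
    then obtain \<tau>0 j0 where 0: "\<tau>0 \<in> Z" "j0 \<in> \<tau>0" "\<rho> = \<tau>0 - {j0}" by auto
    then have \<rho>: "finite \<rho>" "card \<rho> = n" using Z(2)[OF 0(1)] by auto
    have "bij_betw fst {p\<in>?P. ?r p = \<rho>} {\<tau>\<in>Z. \<rho> \<subseteq> \<tau>}"
      unfolding bij_betw_def
    proof
      show "inj_on fst {p\<in>?P. ?r p = \<rho>}" by (rule inj_onI) auto
      show "fst ` {p\<in>?P. ?r p = \<rho>} = {\<tau>\<in>Z. \<rho> \<subseteq> \<tau>}"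
      proof
        show "{\<tau>\<in>Z. \<rho> \<subseteq> \<tau>} \<subseteq> fst ` {p\<in>?P. ?r p = \<rho>}"
        proof
          fix \<tau> assume \<tau>: "\<tau> \<in> {\<tau>\<in>Z. \<rho> \<subseteq> \<tau>}"
          then have "card (\<tau> - \<rho>) = 1" using Z(2)[of \<tau>] \<rho> by (subst card_Diff_subset) auto
          then obtain j where "\<tau> - \<rho> = {j}" using card_1_singletonE by blast
          then have "(\<tau>, j) \<in> {p\<in>?P. ?r p = \<rho>}" using \<tau> by auto
          then show "\<tau> \<in> fst ` {p\<in>?P. ?r p = \<rho>}" by force
        qed
      qed auto
    qed
    then have "card {p\<in>?P. ?r p = \<rho>} = card {\<tau>\<in>Z. \<rho> \<subseteq> \<tau>}" by (rule bij_betw_same_card)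
    then show "(\<Sum>p\<in>{p\<in>?P. ?r p = \<rho>}. F (?r p)) = F \<rho> * card {\<tau>\<in>Z. \<rho> \<subseteq> \<tau>}" by simp
  qed
  also have "even \<dots>"
  proof (rule dvd_sum)
    fix \<rho> assume "\<rho> \<in> ?r ` ?P"
    then obtain \<tau>0 j0 where 0: "\<tau>0 \<in> Z" "j0 \<in> \<tau>0" "\<rho> = \<tau>0 - {j0}" by auto
    then have "finite \<rho>" "card \<rho> = n" using Z(2)[OF 0(1)] by auto
    then show "even (F \<rho> * card {\<tau>\<in>Z. \<rho> \<subseteq> \<tau>})" using ev by blast
  qed
  finally show ?thesis .
qed

definition mod2_cycle :: "nat \<Rightarrow> 'q set set \<Rightarrow> bool" where
  "mod2_cycle n Z \<longleftrightarrow> finite Z \<and> (\<forall>\<tau>\<in>Z. finite \<tau> \<and> card \<tau> = Suc n) \<and>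
     (\<forall>\<rho>. finite \<rho> \<longrightarrow> card \<rho> = n \<longrightarrow> even (card {\<tau>\<in>Z. \<rho> \<subseteq> \<tau>}))"

lemma mod2_cycleD:
  assumes "mod2_cycle n Z"
  shows "finite Z" "\<And>\<tau>. \<tau> \<in> Z \<Longrightarrow> finite \<tau> \<and> card \<tau> = Suc n"
    "\<And>\<rho>. finite \<rho> \<Longrightarrow> card \<rho> = n \<Longrightarrow> even (card {\<tau>\<in>Z. \<rho> \<subseteq> \<tau>})"
  using assms unfolding mod2_cycle_def by auto

definition chain_count :: "'e::euclidean_space set \<Rightarrow> 'q set set \<Rightarrow> ('q \<Rightarrow> 'e) \<Rightarrow> 'e \<Rightarrow> nat" where
  "chain_count S Z z v = (\<Sum>\<tau>\<in>Z. ray_count S (z ` \<tau>) v)"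

text \<open>
  The boundary of a simplex that is disjoint from a cycle has linking number 0 with it. Each product of
  \<open>W\<close> with a simplex of \<open>Z\<close> contributes an even number from its facets; the facets that come from \<open>Z\<close>
  cancel, because \<open>Z\<close> is a cycle.
\<close>

lemma even_chain_count_boundary:
  fixes W E :: "'e::euclidean_space set"
  assumes dim: "DIM('e) = 2 * n + 1" and W: "finite W" "card W = n + 2" "W \<subseteq> E"
    and Z: "mod2_cycle n Z" and z: "\<And>\<tau>. \<tau> \<in> Z \<Longrightarrow> inj_on z \<tau> \<and> z ` \<tau> \<subseteq> E"
    and disj: "\<And>\<tau>. \<tau> \<in> Z \<Longrightarrow> convex hull W \<inter> convex hull (z ` \<tau>) = {}"
    and gen: "generic_direction E v"
  shows "even (\<Sum>w\<in>W. chain_count (W - {w}) Z z v)"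
proof -
  note Z' = mod2_cycleD[OF Z]
  have "even (\<Sum>\<tau>\<in>Z. (\<Sum>w\<in>W. ray_count (W - {w}) (z ` \<tau>) v) + (\<Sum>j\<in>\<tau>. ray_count W (z ` (\<tau> - {j})) v))"
  proof (rule dvd_sum)
    fix \<tau> assume \<tau>: "\<tau> \<in> Z"
    have inj: "inj_on z \<tau>" using z[OF \<tau>] by blast
    have "(\<Sum>j\<in>\<tau>. ray_count W (z ` (\<tau> - {j})) v) = (\<Sum>t\<in>z ` \<tau>. ray_count W (z ` \<tau> - {t}) v)"
      unfolding sum.reindex[OF inj] o_def
      by (rule sum.cong[OF refl]) (use inj in \<open>simp add: inj_on_image_set_diff\<close>)
    moreover have "even ((\<Sum>w\<in>W. ray_count (W - {w}) (z ` \<tau>) v) + (\<Sum>t\<in>z ` \<tau>. ray_count W (z ` \<tau> - {t}) v))"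
      by (rule even_ray_count_facets[OF W(1) _ W(3) _ _ disj[OF \<tau>] gen])
        (use Z'(2)[OF \<tau>] z[OF \<tau>] W(2) dim in \<open>auto simp: card_image\<close>)
    ultimately show "even ((\<Sum>w\<in>W. ray_count (W - {w}) (z ` \<tau>) v) + (\<Sum>j\<in>\<tau>. ray_count W (z ` (\<tau> - {j})) v))"
      by simp
  qed
  moreover have "even (\<Sum>\<tau>\<in>Z. \<Sum>j\<in>\<tau>. ray_count W (z ` (\<tau> - {j})) v)"
    by (rule even_sum_facets[OF Z'(1,2)]) (use Z'(3) in auto)
  ultimately have "even (\<Sum>\<tau>\<in>Z. \<Sum>w\<in>W. ray_count (W - {w}) (z ` \<tau>) v)"
    unfolding sum.distrib by simp
  then show ?thesis unfolding chain_count_def by (subst sum.swap)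
qed

text \<open>
  The simplices spanned by \<open>b\<close> and the simplices at \<open>w\<close> have as facets the old simplices, the new ones, and
  those opposite to the remaining vertices. The last ones cancel, as the link of \<open>w\<close> is a cycle.
\<close>

lemma chain_count_move_vertex:
  fixes E :: "'e::euclidean_space set" and a :: "'p \<Rightarrow> 'e"
  assumes dim: "DIM('e) = 2 * n + 1"
    and C: "finite C" "\<And>\<sigma>. \<sigma> \<in> C \<Longrightarrow> finite \<sigma> \<and> card \<sigma> = Suc n"
    and link: "\<And>\<rho>. finite \<rho> \<Longrightarrow> card \<rho> = n \<Longrightarrow> w \<in> \<rho> \<Longrightarrow> even (card {\<sigma>\<in>C. \<rho> \<subseteq> \<sigma>})"
    and a: "\<And>\<sigma>. \<sigma> \<in> C \<Longrightarrow> w \<in> \<sigma> \<Longrightarrow> inj_on a \<sigma> \<and> b \<notin> a ` \<sigma> \<and> a ` \<sigma> \<subseteq> E" and b: "b \<in> E"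
    and Z: "mod2_cycle n Z" and z: "\<And>\<tau>. \<tau> \<in> Z \<Longrightarrow> inj_on z \<tau> \<and> z ` \<tau> \<subseteq> E"
    and disj: "\<And>\<sigma> \<tau>. \<sigma> \<in> C \<Longrightarrow> w \<in> \<sigma> \<Longrightarrow> \<tau> \<in> Z \<Longrightarrow>
        convex hull (insert b (a ` \<sigma>)) \<inter> convex hull (z ` \<tau>) = {}"
    and gen: "generic_direction E v"
  shows "even ((\<Sum>\<sigma>\<in>C. chain_count (a ` \<sigma>) Z z v) + (\<Sum>\<sigma>\<in>C. chain_count (a(w := b) ` \<sigma>) Z z v))"
proof -
  let ?G = "\<lambda>S. chain_count S Z z v"
  \<comment> \<open>The contribution of the facets opposite to vertices other than \<open>w\<close> and \<open>b\<close>.\<close>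
  define F where "F \<rho> = (if w \<in> \<rho> then ?G (insert b (a ` \<rho>)) else 0)" for \<rho>
  have "even (?G (a ` \<sigma>) + ?G (a(w := b) ` \<sigma>) + (\<Sum>x\<in>\<sigma>. F (\<sigma> - {x})))" if \<sigma>: "\<sigma> \<in> C" for \<sigma>
  proof (cases "w \<in> \<sigma>")
    case False
    then have "a(w := b) ` \<sigma> = a ` \<sigma>" by auto
    then show ?thesis using False by (simp add: F_def)
  next
    case True
    note a' = a[OF \<sigma> True] and C' = C(2)[OF \<sigma>]
    let ?W = "insert b (a ` \<sigma>)"
    have "even (\<Sum>x\<in>?W. ?G (?W - {x}))"
      by (rule even_chain_count_boundary[OF dim _ _ _ Z z disj[OF \<sigma> True] gen])
        (use a' C' b in \<open>auto simp: card_image\<close>)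
    also have "(\<Sum>x\<in>?W. ?G (?W - {x})) = ?G (a ` \<sigma>) + (\<Sum>x\<in>\<sigma>. ?G (?W - {a x}))"
      using a' C' by (simp add: sum.reindex)
    also have "(\<Sum>x\<in>\<sigma>. ?G (?W - {a x})) = ?G (?W - {a w}) + (\<Sum>x\<in>\<sigma> - {w}. ?G (?W - {a x}))"
      using C' True by (simp add: sum.remove)
    also have "?W - {a w} = a(w := b) ` \<sigma>"
      using a' True by (auto simp: inj_on_def)
    also have "(\<Sum>x\<in>\<sigma> - {w}. ?G (?W - {a x})) = (\<Sum>x\<in>\<sigma> - {w}. F (\<sigma> - {x}))"
    proof (rule sum.cong[OF refl])
      fix x assume x: "x \<in> \<sigma> - {w}"
      have "?W - {a x} = insert b (a ` (\<sigma> - {x}))"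
        using a' x by (auto simp: inj_on_def)
      then show "?G (?W - {a x}) = F (\<sigma> - {x})" using x True by (auto simp: F_def)
    qed
    also have "(\<Sum>x\<in>\<sigma> - {w}. F (\<sigma> - {x})) = (\<Sum>x\<in>\<sigma>. F (\<sigma> - {x}))"
      using C' True by (simp add: sum.remove F_def)
    finally show ?thesis by (simp add: add.assoc)
  qed
  then have "even (\<Sum>\<sigma>\<in>C. ?G (a ` \<sigma>) + ?G (a(w := b) ` \<sigma>) + (\<Sum>x\<in>\<sigma>. F (\<sigma> - {x})))"
    by (rule dvd_sum)
  moreover have "even (\<Sum>\<sigma>\<in>C. \<Sum>x\<in>\<sigma>. F (\<sigma> - {x}))"
    by (rule even_sum_facets[OF C]) (use link in \<open>auto simp: F_def\<close>)
  ultimately show ?thesis unfolding sum.distrib by simp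
qed

text \<open>
  The vertices are moved one after the other. The hypotheses on \<open>\<alpha>\<close> and \<open>\<beta>\<close> ensure that no intermediate
  position identifies two vertices of a simplex or meets the cycle.
\<close>

lemma chain_count_move_vertices:
  fixes E :: "'e::euclidean_space set" and \<alpha> \<beta> :: "'p \<Rightarrow> 'e"
  assumes dim: "DIM('e) = 2 * n + 1" and P: "finite P"
    and C: "finite C" "\<And>\<sigma>. \<sigma> \<in> C \<Longrightarrow> finite \<sigma> \<and> card \<sigma> = Suc n"
    and link: "\<And>\<rho>. finite \<rho> \<Longrightarrow> card \<rho> = n \<Longrightarrow> \<rho> \<inter> P \<noteq> {} \<Longrightarrow> even (card {\<sigma>\<in>C. \<rho> \<subseteq> \<sigma>})"
    and off: "\<And>x. x \<notin> P \<Longrightarrow> \<alpha> x = \<beta> x"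
    and inj: "\<And>\<sigma>. \<sigma> \<in> C \<Longrightarrow> inj_on \<alpha> \<sigma> \<and> inj_on \<beta> \<sigma> \<and> \<alpha> ` \<sigma> \<subseteq> E \<and> \<beta> ` \<sigma> \<subseteq> E"
    and ne: "\<And>\<sigma> x y. \<sigma> \<in> C \<Longrightarrow> x \<in> \<sigma> \<inter> P \<Longrightarrow> y \<in> \<sigma> \<Longrightarrow> \<beta> x \<noteq> \<alpha> y"
    and Z: "mod2_cycle n Z" and z: "\<And>\<tau>. \<tau> \<in> Z \<Longrightarrow> inj_on z \<tau> \<and> z ` \<tau> \<subseteq> E"
    and disj: "\<And>\<sigma> \<tau>. \<sigma> \<in> C \<Longrightarrow> \<sigma> \<inter> P \<noteq> {} \<Longrightarrow> \<tau> \<in> Z \<Longrightarrow>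
        convex hull (\<alpha> ` \<sigma> \<union> \<beta> ` \<sigma>) \<inter> convex hull (z ` \<tau>) = {}"
    and gen: "generic_direction E v"
  shows "even ((\<Sum>\<sigma>\<in>C. chain_count (\<beta> ` \<sigma>) Z z v) + (\<Sum>\<sigma>\<in>C. chain_count (\<alpha> ` \<sigma>) Z z v))"
proof -
  \<comment> \<open>The positions after the vertices in \<open>M\<close> have been moved.\<close>
  define a where "a M x = (if x \<in> M then \<alpha> x else \<beta> x)" for M x
  let ?N = "\<lambda>M. \<Sum>\<sigma>\<in>C. chain_count (a M ` \<sigma>) Z z v"
  have "even (?N {} + ?N M)" if "M \<subseteq> P" for M
    using finite_subset[OF that P] that
  proof (induction M rule: finite_induct)
    case (insert w M)
    have step: "even (?N M + (\<Sum>\<sigma>\<in>C. chain_count ((a M)(w := \<alpha> w) ` \<sigma>) Z z v))"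
      if ex: "\<exists>\<sigma>\<in>C. w \<in> \<sigma>"
    proof (rule chain_count_move_vertex[OF dim C _ _ _ Z z _ gen])
      show "even (card {\<sigma>\<in>C. \<rho> \<subseteq> \<sigma>})" if "finite \<rho>" "card \<rho> = n" "w \<in> \<rho>" for \<rho>
        using link[OF that(1,2)] that(3) insert.prems by blast
      show "inj_on (a M) \<sigma> \<and> \<alpha> w \<notin> a M ` \<sigma> \<and> a M ` \<sigma> \<subseteq> E" if \<sigma>: "\<sigma> \<in> C" "w \<in> \<sigma>" for \<sigma>
      proof (intro conjI)
        show "inj_on (a M) \<sigma>"
        proof (rule inj_onI)
          fix x y assume xy: "x \<in> \<sigma>" "y \<in> \<sigma>" "a M x = a M y"
          have mixed: False if "x \<in> \<sigma>" "y \<in> \<sigma>" "x \<in> M" "y \<notin> M" "\<alpha> x = \<beta> y" for x y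
          proof (cases "y \<in> P")
            case True
            then show ?thesis using ne[OF \<sigma>(1), of y x] that by simp
          next
            case False
            then have "\<alpha> x = \<alpha> y" using off that(5) by simp
            then have "x = y" using inj[OF \<sigma>(1)] that by (auto dest: inj_onD)
            then show ?thesis using that by simp
          qed
          show "x = y"
          proof (cases "x \<in> M"; cases "y \<in> M")
            assume "x \<in> M" "y \<in> M"
            then show ?thesis using xy inj[OF \<sigma>(1)] by (auto simp: a_def dest: inj_onD)
          next
            assume "x \<notin> M" "y \<notin> M"
            then show ?thesis using xy inj[OF \<sigma>(1)] by (auto simp: a_def dest: inj_onD)
          next
            assume "x \<in> M" "y \<notin> M"
            then show ?thesis using xy mixed[of x y] by (simp add: a_def)
          next
            assume "x \<notin> M" "y \<in> M"
            then show ?thesis using xy mixed[of y x] by (simp add: a_def)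
          qed
        qed
        show "\<alpha> w \<notin> a M ` \<sigma>"
        proof
          assume "\<alpha> w \<in> a M ` \<sigma>"
          then obtain y where y: "y \<in> \<sigma>" "\<alpha> w = a M y" by blast
          show False
          proof (cases "y \<in> M \<or> y \<notin> P")
            case True
            then have "\<alpha> w = \<alpha> y" using y off by (auto simp: a_def)
            then have "w = y" using inj[OF \<sigma>(1)] \<sigma>(2) y(1) by (auto dest: inj_onD)
            then show ?thesis using True insert by auto
          next
            case False
            then show ?thesis using ne[OF \<sigma>(1), of y w] y \<sigma>(2) by (simp add: a_def)
          qed
        qed
        show "a M ` \<sigma> \<subseteq> E" using inj[OF \<sigma>(1)] by (auto simp: a_def)
      qed
      show "\<alpha> w \<in> E" using ex inj by blast
      show "convex hull insert (\<alpha> w) (a M ` \<sigma>) \<inter> convex hull (z ` \<tau>) = {}"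
        if \<sigma>: "\<sigma> \<in> C" "w \<in> \<sigma>" "\<tau> \<in> Z" for \<sigma> \<tau>
      proof -
        have "convex hull insert (\<alpha> w) (a M ` \<sigma>) \<subseteq> convex hull (\<alpha> ` \<sigma> \<union> \<beta> ` \<sigma>)"
          by (rule hull_mono) (use \<sigma> in \<open>auto simp: a_def\<close>)
        moreover have "\<sigma> \<inter> P \<noteq> {}" using \<sigma> insert.prems by blast
        ultimately show ?thesis using disj[OF \<sigma>(1) _ \<sigma>(3)] by blast
      qed
    qed
    have "(a M)(w := \<alpha> w) = a (insert w M)" by (auto simp: a_def)
    moreover have "(\<Sum>\<sigma>\<in>C. chain_count ((a M)(w := \<alpha> w) ` \<sigma>) Z z v) = ?N M" if "\<not> (\<exists>\<sigma>\<in>C. w \<in> \<sigma>)"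
    proof (rule sum.cong[OF refl])
      fix \<sigma> assume "\<sigma> \<in> C"
      then have "(a M)(w := \<alpha> w) ` \<sigma> = a M ` \<sigma>" using that by (intro image_cong) auto
      then show "chain_count ((a M)(w := \<alpha> w) ` \<sigma>) Z z v = chain_count (a M ` \<sigma>) Z z v" by simp
    qed
    ultimately have "even (?N M + ?N (insert w M))" using step by (cases "\<exists>\<sigma>\<in>C. w \<in> \<sigma>") auto
    moreover have "even (?N {} + ?N M)" using insert by blast
    ultimately show ?case by (metis (no_types, lifting) even_add)
  qed simp
  from this[of P] have "even (?N {} + ?N P)" by simp
  moreover have "a {} = \<beta>" "a P = \<alpha>" using off by (auto simp: a_def)
  ultimately show ?thesis by simp
qed

section \<open>Counting the preimages of the Gauss map\<close>

text \<open>
  A generic \<open>(v, 0)\<close> needs more than \<open>2n + 1\<close> columns, and two simplices of dimension at most \<open>n\<close> offer no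
  more than \<open>2n + 2\<close>.
\<close>

lemma generic_full_support:
  fixes S T E :: "'e::euclidean_space set"
  assumes dim: "DIM('e) = 2 * n + 1" and fin: "finite S" "finite T" and sub: "S \<subseteq> E" "T \<subseteq> E"
    and card: "card S \<le> Suc n" "card T \<le> Suc n" and gen: "generic_direction E v"
    and y: "y \<in> nonneg_solutions (ray_columns S T) (v, 0)"
  shows "card S = Suc n" "card T = Suc n" "\<And>s. s \<in> S \<Longrightarrow> y (s, 1) > 0" "\<And>t. t \<in> T \<Longrightarrow> y (- t, - 1) > 0"
proof -
  let ?J = "ray_columns S T" and ?I = "{c\<in>ray_columns S T. y c \<noteq> 0}"
  have finJ: "finite ?J" using finite_columns[OF fin] .
  have "(v, 0) \<in> span ?I" using nonneg_solutions_support[OF finJ y] .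
  moreover have "?I \<subseteq> ray_columns E E" using columns_mono[OF sub] by blast
  ultimately have "\<not> card ?I \<le> DIM('e)" using gen unfolding generic_direction_def by blast
  moreover have "card ?I \<le> card ?J" using finJ by (intro card_mono) auto
  moreover have cJ: "card ?J = card S + card T" using card_columns[OF fin] .
  ultimately have c: "card S = Suc n" "card T = Suc n" "card ?J \<le> card ?I" using card dim by linarith+
  show "card S = Suc n" "card T = Suc n" by (rule c(1), rule c(2))
  have "?I = ?J" by (rule card_seteq[OF finJ _ c(3)]) auto
  then have "y c > 0" if "c \<in> ?J" for c
    using that y unfolding nonneg_solutions_def by (metis (mono_tags, lifting) mem_Collect_eq order_le_less)
  then show "\<And>s. s \<in> S \<Longrightarrow> y (s, 1) > 0" "\<And>t. t \<in> T \<Longrightarrow> y (- t, - 1) > 0"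
    by (auto simp: ray_columns_def)
qed

lemma gauss_solution:
  fixes p q v :: "'e::euclidean_space"
  assumes fin: "finite S" "finite T" and u: "weights S u" "p = point_at S u"
    and w: "weights T w" "q = point_at T w" and v: "v \<noteq> 0" and sg: "sgn (p - q) = sgn v"
  obtains y where "y \<in> nonneg_solutions (ray_columns S T) (v, 0)"
    "u = (\<lambda>s. y (s, 1) * (norm (p - q) / norm v))" "w = (\<lambda>t. y (- t, - 1) * (norm (p - q) / norm v))"
    "norm (p - q) / norm v > 0"
proof -
  have ne: "p \<noteq> q" using sg v by (metis eq_iff_diff_eq_0 sgn_zero_iff)
  define r where "r = norm (p - q) / norm v"
  have r: "r > 0" using ne v by (simp add: r_def)
  have pq: "p - q = r *\<^sub>R v"
  proof -
    have "p - q = norm (p - q) *\<^sub>R sgn (p - q)" using ne by (simp add: sgn_div_norm)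
    also have "\<dots> = r *\<^sub>R v" unfolding sg by (simp add: sgn_div_norm r_def divide_inverse)
    finally show ?thesis .
  qed
  define y where "y c = (if snd c = 1 then u (fst c) / r else if snd c = - 1 then w (- fst c) / r else 0)" for c :: "'e \<times> real"
  have off: "y c = 0" if "c \<notin> ray_columns S T" for c
  proof -
    obtain a b where ab: "c = (a, b)" by (cases c)
    have "u a = 0" if "b = 1" using that \<open>c \<notin> ray_columns S T\<close> ab u(1) by (auto simp: ray_columns_def weights_def)
    moreover have "w (- a) = 0" if "b = - 1"
    proof -
      have "- a \<notin> T"
      proof
        assume "- a \<in> T"
        then have "(- (- a), - 1) \<in> ray_columns S T" unfolding ray_columns_def by blast
        then show False using \<open>c \<notin> ray_columns S T\<close> ab that by simp
      qed
      then show ?thesis using w(1) by (simp add: weights_def)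
    qed
    ultimately show ?thesis using ab by (simp add: y_def)
  qed
  have "(\<Sum>s\<in>S. u s / r) = 1 / r" "(\<Sum>t\<in>T. w t / r) = 1 / r"
    using u(1) w(1) by (simp_all add: weights_def sum_divide_distrib[symmetric])
  moreover have "(\<Sum>s\<in>S. (u s / r) *\<^sub>R s) - (\<Sum>t\<in>T. (w t / r) *\<^sub>R t) = v"
  proof -
    have "(\<Sum>s\<in>S. (u s / r) *\<^sub>R s) = (1 / r) *\<^sub>R p" "(\<Sum>t\<in>T. (w t / r) *\<^sub>R t) = (1 / r) *\<^sub>R q"
      unfolding u(2) w(2) wsum_def by (simp_all add: scaleR_sum_right)
    then have "(\<Sum>s\<in>S. (u s / r) *\<^sub>R s) - (\<Sum>t\<in>T. (w t / r) *\<^sub>R t) = (1 / r) *\<^sub>R (p - q)"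
      by (simp add: scaleR_diff_right)
    then show ?thesis using r by (simp add: pq)
  qed
  moreover have "0 \<le> y c" for c using u(1) w(1) r by (simp add: y_def weights_def)
  ultimately have "y \<in> nonneg_solutions (ray_columns S T) (v, 0)"
    unfolding columns_solution_iff[OF fin] using off by (simp add: y_def)
  moreover have "u = (\<lambda>s. y (s, 1) * r)" "w = (\<lambda>t. y (- t, - 1) * r)"
    using r by (auto simp: y_def)
  ultimately show ?thesis using that r unfolding r_def by blast
qed

text \<open>
  By genericity every preimage has positive coordinates with respect to two \<open>n\<close>-simplices. These are
  then determined by the preimage, and the preimages in a given pair of simplices correspond to the
  solutions of the linear system of this pair, of which there is at most one.
\<close>

lemma card_gauss_preimage:
  fixes V W :: "'e::euclidean_space set set"
  assumes dim: "DIM('e) = 2 * n + 1" and V: "geometric V" and W: "geometric W"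
    and dV: "\<And>s. s \<in> V \<Longrightarrow> card s \<le> Suc n" and dW: "\<And>s. s \<in> W \<Longrightarrow> card s \<le> Suc n"
    and E: "\<Union>V \<subseteq> E" "\<Union>W \<subseteq> E" and gen: "generic_direction E v"
  shows "card (gauss_preimage (body V) (body W) v) =
    (\<Sum>\<sigma>\<in>{\<sigma>\<in>V. card \<sigma> = Suc n}. \<Sum>\<tau>\<in>{\<tau>\<in>W. card \<tau> = Suc n}. ray_count \<sigma> \<tau> v)"
proof -
  let ?V = "{\<sigma>\<in>V. card \<sigma> = Suc n}" and ?W = "{\<tau>\<in>W. card \<tau> = Suc n}"
  define G where "G = (\<lambda>(\<sigma>, \<tau>). {(p, q). p \<in> convex hull \<sigma> \<and> q \<in> convex hull \<tau> \<and> sgn (p - q) = sgn (v :: 'e)})"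
  have v0: "v \<noteq> 0"
  proof
    assume "v = 0"
    have "(v, 0::real) \<notin> span {}" using gen unfolding generic_direction_def by (metis card.empty empty_subsetI zero_le)
    then show False using \<open>v = 0\<close> by (simp add: zero_prod_def)
  qed
  have pos: "card \<sigma> = Suc n \<and> card \<tau> = Suc n \<and> (\<forall>s\<in>\<sigma>. u s > 0) \<and> (\<forall>t\<in>\<tau>. w t > 0)"
    if st: "\<sigma> \<in> V" "\<tau> \<in> W" and uw: "weights \<sigma> u" "p = point_at \<sigma> u" "weights \<tau> w" "q = point_at \<tau> w"
      and sg: "sgn (p - q) = sgn v" for \<sigma> \<tau> u w p q
  proof -
    have fin: "finite \<sigma>" "finite \<tau>" using geometricD(3) V W st by auto
    obtain y where y: "y \<in> nonneg_solutions (ray_columns \<sigma> \<tau>) (v, 0)"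
      "u = (\<lambda>s. y (s, 1) * (norm (p - q) / norm v))" "w = (\<lambda>t. y (- t, - 1) * (norm (p - q) / norm v))"
      "norm (p - q) / norm v > 0"
      using gauss_solution[OF fin uw v0 sg] .
    have sub: "\<sigma> \<subseteq> E" "\<tau> \<subseteq> E" using st E by auto
    note full = generic_full_support[OF dim fin sub dV[OF st(1)] dW[OF st(2)] gen y(1)]
    have "u s > 0" if "s \<in> \<sigma>" for s unfolding y(2) using full(3)[OF that] y(4) by (rule mult_pos_pos)
    moreover have "w t > 0" if "t \<in> \<tau>" for t unfolding y(3) using full(4)[OF that] y(4) by (rule mult_pos_pos)
    ultimately show ?thesis using full(1,2) by blast
  qed
  have pre: "gauss_preimage (body V) (body W) v = (\<Union>st\<in>?V \<times> ?W. G st)"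
  proof
    show "(\<Union>st\<in>?V \<times> ?W. G st) \<subseteq> gauss_preimage (body V) (body W) v"
      by (auto simp: G_def gauss_preimage_def body_def)
    show "gauss_preimage (body V) (body W) v \<subseteq> (\<Union>st\<in>?V \<times> ?W. G st)"
    proof clarify
      fix p q assume "(p, q) \<in> gauss_preimage (body V) (body W) v"
      then have pq: "p \<in> body V" "q \<in> body W" and sg: "sgn (p - q) = sgn v" by (auto simp: gauss_preimage_def)
      obtain \<sigma> u where s: "\<sigma> \<in> V" "weights \<sigma> u" "p = point_at \<sigma> u" using pq(1) body_iff[OF V] by blast
      obtain \<tau> w where t: "\<tau> \<in> W" "weights \<tau> w" "q = point_at \<tau> w" using pq(2) body_iff[OF W] by blast
      have "card \<sigma> = Suc n" "card \<tau> = Suc n" using pos[OF s(1) t(1) s(2,3) t(2,3) sg] by auto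
      moreover have "p \<in> convex hull \<sigma>" "q \<in> convex hull \<tau>"
        using s t geometricD(3)[OF V s(1)] geometricD(3)[OF W t(1)] mem_hull_iff by blast+
      ultimately show "(p, q) \<in> (\<Union>st\<in>?V \<times> ?W. G st)" using s(1) t(1) sg by (auto simp: G_def)
    qed
  qed
  have cG: "finite (G (\<sigma>, \<tau>)) \<and> card (G (\<sigma>, \<tau>)) = ray_count \<sigma> \<tau> v" if st: "\<sigma> \<in> ?V" "\<tau> \<in> ?W" for \<sigma> \<tau>
  proof -
    have fin: "finite \<sigma>" "finite \<tau>" using geometricD(3) V W st by auto
    let ?J = "ray_columns \<sigma> \<tau>" and ?S = "nonneg_solutions (ray_columns \<sigma> \<tau>) (v, 0)"
    define L where "L y = (\<Sum>s\<in>\<sigma>. y (s, 1::real))" for y :: "'e \<times> real \<Rightarrow> real"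
    \<comment> \<open>Both coordinate sums equal \<open>L y\<close>, the reciprocal of the factor between \<open>p - q\<close> and \<open>v\<close>.\<close>
    define \<Phi> where "\<Phi> y = (\<Sum>s\<in>\<sigma>. (y (s, 1) / L y) *\<^sub>R s, \<Sum>t\<in>\<tau>. (y (- t, - 1) / L y) *\<^sub>R t)" for y :: "'e \<times> real \<Rightarrow> real"
    have uniq: "z = y" if "y \<in> ?S" "z \<in> ?S" for y z
    proof (rule nonneg_solutions_unique[OF _ _ _ that])
      show "finite ?J" using finite_columns[OF fin] .
      show "card ?J = DIM('e \<times> real)" using card_columns[OF fin] st dim by simp
      show "(v, 0) \<notin> span I" if "I \<subseteq> ?J" "card I < DIM('e \<times> real)" for I
      proof -
        have "I \<subseteq> ray_columns E E" using that(1) columns_mono[of \<sigma> E \<tau> E] st E by blast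
        then show ?thesis using gen that(2) unfolding generic_direction_def by simp
      qed
    qed
    have finS: "finite ?S"
    proof (cases "?S = {}")
      case False
      then obtain y where "y \<in> ?S" by blast
      then have "?S \<subseteq> {y}" using uniq by blast
      then show ?thesis using finite_subset by blast
    qed simp
    have "G (\<sigma>, \<tau>) = \<Phi> ` ?S"
    proof
      show "\<Phi> ` ?S \<subseteq> G (\<sigma>, \<tau>)"
      proof (rule image_subsetI)
        fix y assume y: "y \<in> ?S"
        have eqs: "L y = (\<Sum>t\<in>\<tau>. y (- t, - 1))" "(\<Sum>s\<in>\<sigma>. y (s, 1) *\<^sub>R s) - (\<Sum>t\<in>\<tau>. y (- t, - 1) *\<^sub>R t) = v"
          "\<And>c. 0 \<le> y c"
          using y unfolding columns_solution_iff[OF fin] L_def by auto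
        have sub: "\<sigma> \<subseteq> E" "\<tau> \<subseteq> E" using st E by auto
        have "\<sigma> \<noteq> {}" using st by auto
        then have L: "L y > 0" unfolding L_def
          using generic_full_support(3)[OF dim fin sub _ _ gen y] st fin by (intro sum_pos) auto
        have "(\<Sum>s\<in>\<sigma>. (y (s, 1) / L y) *\<^sub>R s) \<in> convex hull \<sigma>"
          using L eqs(3) by (intro convex_sum fin) (auto simp: hull_inc L_def sum_divide_distrib[symmetric])
        moreover have "(\<Sum>t\<in>\<tau>. (y (- t, - 1) / L y) *\<^sub>R t) \<in> convex hull \<tau>"
          using L eqs(1,3) by (intro convex_sum fin) (auto simp: hull_inc sum_divide_distrib[symmetric])
        moreover have "(\<Sum>s\<in>\<sigma>. (y (s, 1) / L y) *\<^sub>R s) - (\<Sum>t\<in>\<tau>. (y (- t, - 1) / L y) *\<^sub>R t) = (1 / L y) *\<^sub>R v"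
        proof -
          have "(\<Sum>s\<in>\<sigma>. (y (s, 1) / L y) *\<^sub>R s) = (1 / L y) *\<^sub>R (\<Sum>s\<in>\<sigma>. y (s, 1) *\<^sub>R s)"
            "(\<Sum>t\<in>\<tau>. (y (- t, - 1) / L y) *\<^sub>R t) = (1 / L y) *\<^sub>R (\<Sum>t\<in>\<tau>. y (- t, - 1) *\<^sub>R t)"
            by (simp_all add: scaleR_sum_right)
          then show ?thesis unfolding eqs(2)[symmetric] by (simp add: scaleR_diff_right)
        qed
        moreover have "sgn ((1 / L y) *\<^sub>R v) = sgn v" using L by (simp add: sgn_scaleR)
        ultimately show "\<Phi> y \<in> G (\<sigma>, \<tau>)" by (simp add: \<Phi>_def G_def)
      qed
      show "G (\<sigma>, \<tau>) \<subseteq> \<Phi> ` ?S"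
      proof (rule subrelI)
        fix p q assume "(p, q) \<in> G (\<sigma>, \<tau>)"
        then have pq: "p \<in> convex hull \<sigma>" "q \<in> convex hull \<tau>" and sg: "sgn (p - q) = sgn v" by (auto simp: G_def)
        obtain u where u: "weights \<sigma> u" "p = point_at \<sigma> u" using pq(1) mem_hull_iff fin by blast
        obtain w where w: "weights \<tau> w" "q = point_at \<tau> w" using pq(2) mem_hull_iff fin by blast
        obtain y where y: "y \<in> ?S"
          "u = (\<lambda>s. y (s, 1) * (norm (p - q) / norm v))" "w = (\<lambda>t. y (- t, - 1) * (norm (p - q) / norm v))"
          "norm (p - q) / norm v > 0"
          using gauss_solution[OF fin u w v0 sg] .
        define r where "r = norm (p - q) / norm v"
        have "1 = sum u \<sigma>" using u(1) by (simp add: weights_def)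
        also have "\<dots> = L y * r" unfolding y(2) L_def r_def by (rule sum_distrib_right[symmetric])
        finally have r: "r = 1 / L y" by (metis mult_zero_left nonzero_eq_divide_eq mult.commute zero_neq_one)
        have uw: "u s = y (s, 1) / L y" "w s = y (- s, - 1) / L y" for s
          unfolding y(2,3) r_def[symmetric] r by simp_all
        have "(p, q) = \<Phi> y" unfolding \<Phi>_def u(2) w(2) wsum_def uw ..
        then show "(p, q) \<in> \<Phi> ` ?S" using y(1) by blast
      qed
    qed
    moreover have "inj_on \<Phi> ?S" by (rule inj_onI) (use uniq in blast)
    ultimately show ?thesis unfolding ray_count_def using finS card_image by (metis finite_imageI)
  qed
  have "card (\<Union>st\<in>?V \<times> ?W. G st) = (\<Sum>st\<in>?V \<times> ?W. card (G st))"
  proof (rule card_UN_disjoint)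
    show "finite (?V \<times> ?W)" using geometricD(2)[OF V] geometricD(2)[OF W] by simp
    show "\<forall>st\<in>?V \<times> ?W. finite (G st)" using cG by auto
    show "\<forall>st\<in>?V \<times> ?W. \<forall>st'\<in>?V \<times> ?W. st \<noteq> st' \<longrightarrow> G st \<inter> G st' = {}"
    proof (intro ballI impI)
      have sub: "\<sigma> \<subseteq> \<sigma>' \<and> \<tau> \<subseteq> \<tau>'" if st: "\<sigma> \<in> V" "\<tau> \<in> W" "\<sigma>' \<in> V" "\<tau>' \<in> W" "(p, q) \<in> G (\<sigma>, \<tau>)" "(p, q) \<in> G (\<sigma>', \<tau>')"
        for \<sigma> \<tau> \<sigma>' \<tau>' p q
      proof -
        obtain u where u: "weights \<sigma> u" "p = point_at \<sigma> u"
          using st mem_hull_iff[OF geometricD(3)[OF V st(1)]] by (auto simp: G_def)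
        obtain w where w: "weights \<tau> w" "q = point_at \<tau> w"
          using st mem_hull_iff[OF geometricD(3)[OF W st(2)]] by (auto simp: G_def)
        have sg: "sgn (p - q) = sgn v" and h: "p \<in> convex hull \<sigma>'" "q \<in> convex hull \<tau>'"
          using st by (auto simp: G_def)
        have "\<forall>s\<in>\<sigma>. u s > 0" "\<forall>t\<in>\<tau>. w t > 0" using pos[OF st(1,2) u w sg] by auto
        then show ?thesis
          using positive_weights_subset[OF V st(1,3) u(1)] positive_weights_subset[OF W st(2,4) w(1)] h u(2) w(2)
          by blast
      qed
      fix st st' assume a: "st \<in> ?V \<times> ?W" "st' \<in> ?V \<times> ?W" "st \<noteq> st'"
      obtain \<sigma> \<tau> \<sigma>' \<tau>' where e: "st = (\<sigma>, \<tau>)" "st' = (\<sigma>', \<tau>')" by (cases st; cases st')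
      show "G st \<inter> G st' = {}"
      proof (rule ccontr)
        assume "G st \<inter> G st' \<noteq> {}"
        then obtain p q where "(p, q) \<in> G (\<sigma>, \<tau>)" "(p, q) \<in> G (\<sigma>', \<tau>')" unfolding e by auto
        moreover have "\<sigma> \<in> V" "\<tau> \<in> W" "\<sigma>' \<in> V" "\<tau>' \<in> W" using a(1,2) e by auto
        ultimately have "\<sigma> \<subseteq> \<sigma>' \<and> \<tau> \<subseteq> \<tau>'" "\<sigma>' \<subseteq> \<sigma> \<and> \<tau>' \<subseteq> \<tau>" using sub by blast+
        then have "\<sigma> = \<sigma>'" "\<tau> = \<tau>'" by blast+
        then show False using a(3) e by simp
      qed
    qed
  qed
  also have "\<dots> = (\<Sum>st\<in>?V \<times> ?W. case st of (\<sigma>, \<tau>) \<Rightarrow> ray_count \<sigma> \<tau> v)"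
    by (rule sum.cong[OF refl]) (use cG in auto)
  also have "\<dots> = (\<Sum>\<sigma>\<in>?V. \<Sum>\<tau>\<in>?W. ray_count \<sigma> \<tau> v)" by (rule sum.cartesian_product[symmetric])
  finally show ?thesis unfolding pre .
qed

section \<open>Standard realizations and stellar subdivision\<close>

definition support :: "real ^ 'v \<Rightarrow> 'v::finite set" where
  "support y = {v. y $ v \<noteq> 0}"

lemma weights_wsum_vertex_point:
  fixes s :: "'v::finite set"
  assumes "weights s u" shows "wsum s u vertex_point $ v = u v"
proof -
  have "wsum s u vertex_point $ v = (\<Sum>w\<in>s. if w = v then u v else 0)"
    unfolding wsum_def vertex_point_def by (simp add: axis_def if_distrib cong: if_cong) 
  also have "\<dots> = u v" using assms by (auto simp: weights_def)
  finally show ?thesis .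
qed

text \<open>
  A point of the standard realization is its own coordinate function.
\<close>

lemma mem_realization_iff_weights:
  fixes L :: "'v::finite set set"
  shows "y \<in> realization L \<longleftrightarrow> (\<exists>s\<in>L. weights s (($) y))"
proof -
  have "y \<in> convex hull (vertex_point ` s) \<longleftrightarrow> weights s (($) y)" for s :: "'v set"
  proof -
    have fin: "finite s" by simp
    have "weights s (($) y)" if "weights s u" "y = wsum s u vertex_point" for u
    proof -
      have "($) y = u" using weights_wsum_vertex_point[OF that(1)] that(2) by auto
      then show ?thesis using that by simp
    qed
    moreover have "y = wsum s (($) y) vertex_point" if "weights s (($) y)"
      using weights_wsum_vertex_point[OF that] by (simp add: vec_eq_iff)
    ultimately show ?thesis unfolding hull_image_iff[OF fin] by blast
  qed
  then show ?thesis by (simp add: realization_def)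
qed

lemma weights_support_subset:
  fixes s :: "'v::finite set"
  shows "weights s (($) y) \<longleftrightarrow> weights UNIV (($) y) \<and> support y \<subseteq> s"
proof
  assume "weights s (($) y)"
  then show "weights UNIV (($) y) \<and> support y \<subseteq> s"
    using weights_mono[of s "($) y" UNIV] by (auto simp: support_def weights_def)
next
  assume "weights UNIV (($) y) \<and> support y \<subseteq> s"
  then show "weights s (($) y)" using weights_restrict[of UNIV "($) y" s] by (auto simp: support_def)
qed

lemma support_nonempty: "weights UNIV (($) y) \<Longrightarrow> support y \<noteq> {}"
proof
  assume "weights UNIV (($) y)" "support y = {}"
  then have "(\<Sum>v\<in>UNIV. y $ v) = 1" "\<And>v. y $ v = 0" by (auto simp: weights_def support_def)
  then show False by simp
qed

lemma is_complexD:
  "is_complex L \<Longrightarrow> s \<in> L \<Longrightarrow> t \<subseteq> s \<Longrightarrow> t \<noteq> {} \<Longrightarrow> t \<in> L"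
  "is_complex L \<Longrightarrow> s \<in> L \<Longrightarrow> s \<noteq> {}"
  unfolding is_complex_def by blast+

lemma mem_realization_iff:
  fixes L :: "'v::finite set set"
  assumes "is_complex L"
  shows "y \<in> realization L \<longleftrightarrow> weights UNIV (($) y) \<and> support y \<in> L"
proof
  assume "y \<in> realization L"
  then obtain s where "s \<in> L" "weights s (($) y)"
    using mem_realization_iff_weights by blast
  then have s: "s \<in> L" "weights UNIV (($) y)" "support y \<subseteq> s"
    using iffD1[OF weights_support_subset[of s y]] by blast+
  then show "weights UNIV (($) y) \<and> support y \<in> L"
    using is_complexD(1)[OF assms s(1,3) support_nonempty] by simp
next
  assume "weights UNIV (($) y) \<and> support y \<in> L"
  then have "weights (support y) (($) y)" "support y \<in> L"
    using iffD2[OF weights_support_subset[of "support y" y]] by blast+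
  then show "y \<in> realization L" using mem_realization_iff_weights by blast
qed

lemma realization_geometric:
  fixes L :: "'v::finite set set"
  assumes "is_complex L"
  shows "geometric ((`) vertex_point ` insert {} L)" "body ((`) vertex_point ` insert {} L) = realization L"
proof -
  have "scheme (insert {} L)"
    using is_complexD[OF assms] by (auto simp: scheme_def)
  moreover have "embeds (insert {} L) (vertex_point :: 'v \<Rightarrow> real ^ 'v)"
    unfolding embeds_def
  proof (intro ballI allI impI)
    fix s t :: "'v set" and u w
    assume uw: "weights s u \<and> weights t w \<and> wsum s u vertex_point = wsum t w (vertex_point :: 'v \<Rightarrow> real ^ 'v)"
    then show "u = w" using weights_wsum_vertex_point by (metis ext)
  qed
  ultimately show "geometric ((`) vertex_point ` insert {} L)" by (rule embeds_image_geometric)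
  show "body ((`) vertex_point ` insert {} L) = realization L" by (auto simp: body_def realization_def)
qed

lemma inj_vertex_point: "inj vertex_point"
  by (rule injI) (simp add: vertex_point_def axis_eq_axis)

lemma realization_Int_empty:
  fixes L M :: "'v::finite set set"
  assumes "is_complex L" "is_complex M"
  shows "realization L \<inter> realization M = {} \<longleftrightarrow> L \<inter> M = {}"
proof -
  have "realization L \<inter> realization M \<noteq> {}" if s: "s \<in> L" "s \<in> M" for s
  proof -
    have ne: "s \<noteq> {}" using is_complexD assms s by blast
    define y :: "real ^ 'v" where "y = wsum s (barycenter s) vertex_point"
    have "($) y = barycenter s"
      using weights_wsum_vertex_point[OF weights_barycenter[OF _ ne]] by (auto simp: y_def)
    then have "weights s (($) y)" using weights_barycenter[OF _ ne] by simp
    then show ?thesis using mem_realization_iff_weights s by blast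
  qed
  moreover have "L \<inter> M \<noteq> {}" if "realization L \<inter> realization M \<noteq> {}"
    using that mem_realization_iff assms by blast
  ultimately show ?thesis by blast
qed

lemma full_simplex_complex: "is_complex (full_simplex (B :: 'v::finite set))"
  by (auto simp: is_complex_def full_simplex_def)

text \<open>
  The star of \<open>B\<close> is replaced by the cone from \<open>x\<close> over its boundary. The set \<open>s\<close> may be empty, which
  accounts for the vertex \<open>x\<close> itself.
\<close>

definition stellar :: "'v set \<Rightarrow> 'v \<Rightarrow> 'v set set \<Rightarrow> 'v set set" where
  "stellar B x L = {s\<in>L. \<not> B \<subseteq> s} \<union> {insert x s |s. \<not> B \<subseteq> s \<and> s \<union> B \<in> L}"

text \<open>
  The linear map that fixes all vertices except \<open>x\<close> and takes \<open>x\<close> to the barycentre of \<open>B\<close>.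
\<close>

definition star_map :: "'v::finite set \<Rightarrow> 'v \<Rightarrow> real ^ 'v \<Rightarrow> real ^ 'v" where
  "star_map B x y = y + (y $ x) *\<^sub>R ((\<chi> v. barycenter B v) - axis x 1)"

lemma star_map_nth: "star_map B x y $ v = y $ v + y $ x * (barycenter B v - (if v = x then 1 else 0))"
  by (simp add: star_map_def axis_def)

lemma linear_star_map: "linear (star_map B x)"
  by (rule linearI) (simp_all add: star_map_def scaleR_add_left scaleR_add_right)

lemma star_map_id: "y $ x = 0 \<Longrightarrow> star_map B x y = y"
  by (simp add: star_map_def)

lemma is_complex_stellar:
  fixes L :: "'v::finite set set"
  assumes L: "is_complex L"
  shows "is_complex (stellar B x L)"
  unfolding is_complex_def
proof (intro conjI ballI allI impI)
  fix s assume s: "s \<in> stellar B x L"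
  then show "s \<noteq> {}" using is_complexD(2)[OF L] by (auto simp: stellar_def)
  fix t assume t: "t \<subseteq> s \<and> t \<noteq> {}"
  from s consider "s \<in> L" "\<not> B \<subseteq> s" | r where "s = insert x r" "\<not> B \<subseteq> r" "r \<union> B \<in> L"
    by (auto simp: stellar_def)
  then show "t \<in> stellar B x L"
  proof cases
    case 1
    then have "t \<in> L" "\<not> B \<subseteq> t" using is_complexD(1)[OF L] t by blast+
    then show ?thesis by (simp add: stellar_def)
  next
    case 2
    show ?thesis
    proof (cases "x \<in> t")
      case True
      have "\<not> B \<subseteq> (t - {x}) \<inter> r" using 2(2) by blast
      moreover have "((t - {x}) \<inter> r) \<union> B \<in> L"
      proof (rule is_complexD(1)[OF L 2(3)])
        show "((t - {x}) \<inter> r) \<union> B \<noteq> {}" using 2(2) by blast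
      qed blast
      moreover have "t = insert x ((t - {x}) \<inter> r)" using True t 2(1) by blast
      ultimately show ?thesis unfolding stellar_def by blast
    next
      case False
      then have "t \<subseteq> r" using t 2(1) by blast
      then have "t \<in> L" "\<not> B \<subseteq> t" using is_complexD(1)[OF L 2(3)] t 2(2) by blast+
      then show ?thesis by (simp add: stellar_def)
    qed
  qed
qed (auto intro: finite_subset)

text \<open>
  Points with positive \<open>x\<close>-coordinate are mapped into the interiors of simplices that contain \<open>B\<close>; all other
  points of the subdivision stay where they are.
\<close>

lemma stellar_point:
  fixes L :: "'v::finite set set"
  assumes L: "is_complex L" and x: "x \<notin> \<Union>L" and y: "y \<in> realization (stellar B x L)"
  shows "weights UNIV (($) y)" "\<not> B \<subseteq> support y"
    "y $ x = 0 \<Longrightarrow> support y \<in> L"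
    "y $ x \<noteq> 0 \<Longrightarrow> (support y - {x}) \<union> B \<in> L"
    "y $ x \<noteq> 0 \<Longrightarrow> support (star_map B x y) = (support y - {x}) \<union> B"
proof -
  have Y: "weights UNIV (($) y)" "support y \<in> stellar B x L"
    using y unfolding mem_realization_iff[OF is_complex_stellar[OF L]] by auto
  show "weights UNIV (($) y)" by (rule Y)
  have ge: "0 \<le> y $ v" for v using Y(1) by (simp add: weights_def)
  from Y(2) consider "support y \<in> L" "\<not> B \<subseteq> support y"
    | r where "support y = insert x r" "\<not> B \<subseteq> r" "r \<union> B \<in> L"
    by (auto simp: stellar_def)
  then have "\<not> B \<subseteq> support y \<and> (y $ x = 0 \<longrightarrow> support y \<in> L) \<and> (y $ x \<noteq> 0 \<longrightarrow> (support y - {x}) \<union> B \<in> L)"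
  proof cases
    case 1
    then have "y $ x = 0" using x by (auto simp: support_def)
    then show ?thesis using 1 by blast
  next
    case 2
    have "x \<notin> r \<union> B" using 2(3) x by blast
    moreover have "y $ x \<noteq> 0" using 2(1) by (auto simp: support_def)
    moreover have "support y - {x} = r" using 2(1) calculation by auto
    ultimately show ?thesis using 2 by auto
  qed
  then show "\<not> B \<subseteq> support y" "y $ x = 0 \<Longrightarrow> support y \<in> L" and *: "y $ x \<noteq> 0 \<Longrightarrow> (support y - {x}) \<union> B \<in> L"
    by auto
  show "support (star_map B x y) = (support y - {x}) \<union> B" if "y $ x \<noteq> 0"
  proof -
    have "x \<notin> B" using *[OF that] x by blast
    have pos: "y $ x > 0" using that ge[of x] by simp
    have "star_map B x y $ v \<noteq> 0 \<longleftrightarrow> v \<in> (support y - {x}) \<union> B" for v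
    proof (cases "v \<in> B")
      case True
      then have "star_map B x y $ v > 0"
        using pos ge[of v] barycenter_pos[of B v] \<open>x \<notin> B\<close> by (auto simp: star_map_nth intro!: add_nonneg_pos)
      then show ?thesis using True by simp
    next
      case False
      then show ?thesis by (simp add: star_map_nth barycenter_def support_def)
    qed
    then show ?thesis by (auto simp: support_def)
  qed
qed

text \<open>
  As some \<open>B\<close>-coordinate of \<open>y\<close> vanishes, the least \<open>B\<close>-coordinate of the image is the share
  \<open>y $ x / card B\<close> that comes from \<open>x\<close>. So \<open>y $ x\<close> is recovered from the image, and then the other
  coordinates are.
\<close>

lemma star_map_bij:
  fixes L :: "'v::finite set set"
  assumes L: "is_complex L" and x: "x \<notin> \<Union>L" and B: "B \<in> L"
  shows "inj_on (star_map B x) (realization (stellar B x L))"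
    "star_map B x ` realization (stellar B x L) = realization L"
proof -
  note SP = stellar_point[OF L x, of _ B]
  have Bne: "B \<noteq> {}" using is_complexD(2)[OF L B] .
  have xB: "x \<notin> B" using B x by blast
  have cB: "real (card B) > 0" using Bne by (simp add: card_gt_0_iff)
  show "inj_on (star_map B x) (realization (stellar B x L))"
  proof (rule inj_onI)
    fix y z assume yz: "y \<in> realization (stellar B x L)" "z \<in> realization (stellar B x L)"
      and eq: "star_map B x y = star_map B x z"
    have x0: "y $ x = 0 \<longleftrightarrow> z $ x = 0" if "y \<in> realization (stellar B x L)" "z \<in> realization (stellar B x L)"
      "star_map B x y = star_map B x z" for y z
    proof -
      have "B \<subseteq> support (star_map B x y) \<longleftrightarrow> y $ x \<noteq> 0" if "y \<in> realization (stellar B x L)" for y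
        using SP[OF that] star_map_id[of y x B] by (cases "y $ x = 0") auto
      then show ?thesis using that by metis
    qed
    have le: "y $ x \<le> z $ x" if yz: "y \<in> realization (stellar B x L)" "z \<in> realization (stellar B x L)"
      "star_map B x y = star_map B x z" for y z
    proof -
      obtain b where b: "b \<in> B" "z $ b = 0" using SP(2)[OF yz(2)] by (auto simp: support_def)
      have "star_map B x y $ b = star_map B x z $ b" using yz(3) by simp
      then have "y $ b + y $ x / card B = z $ x / card B"
        using b xB by (cases "b = x") (auto simp: star_map_nth barycenter_def)
      moreover have "0 \<le> y $ b" using SP(1)[OF yz(1)] by (simp add: weights_def)
      ultimately have "y $ x / card B \<le> z $ x / card B" by linarith
      then show ?thesis using cB by (simp add: divide_le_cancel)
    qed
    have xx: "y $ x = z $ x" using le[OF yz eq] le[OF yz(2,1) eq[symmetric]] by simp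
    have "y $ v = z $ v" for v
    proof -
      have "star_map B x y $ v = star_map B x z $ v" using eq by simp
      then show ?thesis using xx by (simp add: star_map_nth)
    qed
    then show "y = z" by (simp add: vec_eq_iff)
  qed
  show "star_map B x ` realization (stellar B x L) = realization L"
  proof
    show "star_map B x ` realization (stellar B x L) \<subseteq> realization L"
    proof clarify
      fix y assume y: "y \<in> realization (stellar B x L)"
      show "star_map B x y \<in> realization L"
      proof (cases "y $ x = 0")
        case True
        then show ?thesis using SP[OF y] star_map_id[OF True] mem_realization_iff[OF L] by simp
      next
        case False
        have Y: "\<And>v. 0 \<le> y $ v" "(\<Sum>v\<in>UNIV. y $ v) = 1" using SP(1)[OF y] by (auto simp: weights_def)
        have "(\<Sum>v\<in>UNIV. barycenter B v) = 1"
          using weights_mono[OF weights_barycenter[OF _ Bne], of UNIV] by (simp add: weights_def)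
        then have "(\<Sum>v\<in>UNIV. star_map B x y $ v) = 1"
          using Y(2) by (simp add: star_map_nth sum.distrib sum_distrib_left[symmetric] sum_subtractf)
        moreover have "0 \<le> star_map B x y $ v" for v
          using Y(1)[of v] Y(1)[of x] xB by (auto simp: star_map_nth barycenter_def)
        ultimately have "weights UNIV (($) (star_map B x y))" by (simp add: weights_def)
        then show ?thesis using SP(4,5)[OF y False] mem_realization_iff[OF L] by simp
      qed
    qed
    show "realization L \<subseteq> star_map B x ` realization (stellar B x L)"
    proof
      fix p assume "p \<in> realization L"
      then have p: "weights UNIV (($) p)" "support p \<in> L" using mem_realization_iff[OF L] by auto
      have px: "p $ x = 0" using p(2) x by (auto simp: support_def)
      have ge: "0 \<le> p $ v" for v using p(1) by (simp add: weights_def)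
      show "p \<in> star_map B x ` realization (stellar B x L)"
      proof (cases "B \<subseteq> support p")
        case False
        then have "support p \<in> stellar B x L" using p(2) by (simp add: stellar_def)
        then have "p \<in> realization (stellar B x L)"
          using mem_realization_iff[OF is_complex_stellar[OF L]] p(1) by blast
        then show ?thesis using star_map_id[OF px, of B] by (metis image_eqI)
      next
        case True
        define m where "m = Min (($) p ` B)"
        obtain b0 where b0: "b0 \<in> B" "m = p $ b0"
          using Min_in[of "($) p ` B"] Bne unfolding m_def by (metis finite finite_imageI image_iff image_is_empty)
        have mle: "m \<le> p $ b" if "b \<in> B" for b unfolding m_def using that by (intro Min_le) auto
        have mpos: "m > 0" using b0 True ge[of b0] by (auto simp: support_def order_less_le)
        \<comment> \<open>The least \<open>B\<close>-coordinate is taken from all vertices of \<open>B\<close> and collected at \<open>x\<close>.\<close>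
        define y :: "real ^ 'v" where
          "y = (\<chi> v. if v = x then card B * m else if v \<in> B then p $ v - m else p $ v)"
        have star: "star_map B x y = p"
          using xB cB px by (auto simp: vec_eq_iff star_map_nth y_def barycenter_def)
        have yge: "0 \<le> y $ v" for v using ge[of v] mle[of v] mpos by (auto simp: y_def)
        have "(\<Sum>v\<in>UNIV. star_map B x y $ v) = (\<Sum>v\<in>UNIV. y $ v)"
        proof -
          have "(\<Sum>v\<in>UNIV. barycenter B v) = 1"
            using weights_mono[OF weights_barycenter[OF _ Bne], of UNIV] by (simp add: weights_def)
          then show ?thesis by (simp add: star_map_nth sum.distrib sum_distrib_left[symmetric] sum_subtractf)
        qed
        then have wy: "weights UNIV (($) y)" using star p(1) yge by (simp add: weights_def)
        let ?s = "support y - {x}"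
        have yx: "y $ x \<noteq> 0" using cB mpos Bne by (simp add: y_def)
        have "y $ b0 = 0" using b0 xB by (auto simp: y_def)
        then have "\<not> B \<subseteq> ?s" using b0(1) by (auto simp: support_def)
        moreover have "?s \<union> B = support p"
        proof -
          have "v \<in> ?s \<union> B \<longleftrightarrow> v \<in> support p" for v
            using True px xB by (cases "v \<in> B"; cases "v = x") (auto simp: support_def y_def)
          then show ?thesis by blast
        qed
        moreover have "support y = insert x ?s" using yx by (auto simp: support_def)
        ultimately have "\<exists>s. support y = insert x s \<and> \<not> B \<subseteq> s \<and> s \<union> B \<in> L"
          using p(2) by (intro exI[of _ ?s]) simp
        then have "support y \<in> stellar B x L" unfolding stellar_def by simp
        then have "y \<in> realization (stellar B x L)"
          using mem_realization_iff[OF is_complex_stellar[OF L]] wy by blast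
        then show ?thesis using star by blast
      qed
    qed
  qed
qed

lemma pl_homeomorphic_stellar:
  fixes L :: "'v::finite set set"
  assumes L: "is_complex L" and x: "x \<notin> \<Union>L" and B: "B \<in> L"
  shows "pl_homeomorphic (realization (stellar B x L)) (realization L)"
proof -
  note G = realization_geometric[OF is_complex_stellar[OF L, of B x]]
  have "pl_homeomorphic (body ((`) vertex_point ` insert {} (stellar B x L)))
      (star_map B x ` body ((`) vertex_point ` insert {} (stellar B x L)))"
    by (rule piecewise_affine_pl_homeomorphic[OF G(1)])
      (use linear_affine_on_simplex[OF linear_star_map] star_map_bij(1)[OF assms] G(2) in auto)
  then show ?thesis unfolding G(2) star_map_bij(2)[OF assms] .
qed

lemma pl_sphere_stellar:
  fixes L :: "'v::finite set set"
  assumes L: "is_complex L" and x: "x \<notin> \<Union>L" and B: "B \<in> L" and S: "pl_sphere n (realization L)"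
  shows "pl_sphere n (realization (stellar B x L))"
  using S pl_homeomorphic_trans[OF pl_homeomorphic_stellar[OF L x B]] unfolding pl_sphere_def by blast

section \<open>General position\<close>

lemma negligible_affine_hull_few:
  fixes f :: "'p \<Rightarrow> 'e::euclidean_space"
  assumes "finite S" "card S \<le> DIM('e)" shows "negligible (affine hull (f ` S))"
proof -
  have "aff_dim (affine hull (f ` S)) \<le> int (card (f ` S)) - 1"
    using aff_dim_le_card[of "f ` S"] assms(1) by simp
  moreover have "card (f ` S) \<le> card S" using card_image_le[OF assms(1)] .
  ultimately have "aff_dim (affine hull (f ` S)) \<noteq> DIM('e)" using assms(2) by linarith
  then have "interior (affine hull (f ` S)) = {}" by (rule low_dim_interior)
  then show ?thesis by (simp add: negligible_convex_interior affine_imp_convex)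
qed

lemma affine_combination_in_hull:
  fixes f :: "'p \<Rightarrow> 'e::real_vector"
  assumes "finite S" "sum u S = 1" shows "(\<Sum>x\<in>S. u x *\<^sub>R f x) \<in> affine hull (f ` S)"
proof -
  define w where "w y = (\<Sum>x\<in>{x\<in>S. f x = y}. u x)" for y
  have "sum w (f ` S) = sum u S" unfolding w_def by (rule sum.image_gen[OF assms(1), symmetric])
  moreover have "(\<Sum>y\<in>f ` S. w y *\<^sub>R y) = (\<Sum>x\<in>S. u x *\<^sub>R f x)"
  proof -
    have "(\<Sum>x\<in>S. u x *\<^sub>R f x) = (\<Sum>y\<in>f ` S. \<Sum>x\<in>{x\<in>S. f x = y}. u x *\<^sub>R f x)"
      by (rule sum.image_gen[OF assms(1)])
    also have "\<dots> = (\<Sum>y\<in>f ` S. w y *\<^sub>R y)"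
      unfolding w_def by (intro sum.cong refl) (simp add: scaleR_left.sum)
    finally show ?thesis by simp
  qed
  ultimately show ?thesis using assms affine_hull_finite[of "f ` S"] by auto
qed

text \<open>
  Vertex by vertex: the affine hulls of at most \<open>DIM('e)\<close> of the other vertices are finitely many
  negligible sets, and a point outside all of them enters no affine relation among at most
  \<open>DIM('e) + 1\<close> vertices. Later moves change the relations of an earlier vertex only through vertices
  that no short relation involves.
\<close>

lemma exists_general_position:
  fixes \<alpha> :: "'p \<Rightarrow> 'e::euclidean_space"
  assumes X: "finite X" and P: "finite P" "P \<subseteq> X" and F: "finite F" and \<delta>: "\<delta> > 0"
  shows "\<exists>\<beta>. (\<forall>x. x \<notin> P \<longrightarrow> \<beta> x = \<alpha> x) \<and> (\<forall>x. norm (\<beta> x - \<alpha> x) < \<delta>) \<and> (\<forall>x\<in>P. \<beta> x \<notin> F) \<and>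
    (\<forall>c. sum c X = 0 \<longrightarrow> (\<Sum>x\<in>X. c x *\<^sub>R \<beta> x) = 0 \<longrightarrow> card {x\<in>X. c x \<noteq> 0} \<le> DIM('e) + 1 \<longrightarrow>
      (\<forall>x\<in>P. c x = 0))"
  using P
proof (induction P rule: finite_induct)
  case empty
  then show ?case using \<delta> by (intro exI[of _ \<alpha>]) auto
next
  case (insert w P)
  then obtain \<beta> where \<beta>: "\<And>x. x \<notin> P \<Longrightarrow> \<beta> x = \<alpha> x" "\<And>x. norm (\<beta> x - \<alpha> x) < \<delta>" "\<And>x. x \<in> P \<Longrightarrow> \<beta> x \<notin> F"
    "\<And>c. sum c X = 0 \<Longrightarrow> (\<Sum>x\<in>X. c x *\<^sub>R \<beta> x) = 0 \<Longrightarrow> card {x\<in>X. c x \<noteq> 0} \<le> DIM('e) + 1 \<Longrightarrow>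
      (\<forall>x\<in>P. c x = 0)" by blast
  have w: "w \<in> X" using insert by simp
  \<comment> \<open>The places from which \<open>w\<close> has to stay away.\<close>
  define Bad where "Bad = F \<union> (\<Union>S\<in>{S. S \<subseteq> X \<and> card S \<le> DIM('e)}. affine hull (\<beta> ` S))"
  have "negligible Bad" unfolding Bad_def
  proof (rule negligible_Un)
    show "negligible F" using F negligible_finite by blast
    show "negligible (\<Union>S\<in>{S. S \<subseteq> X \<and> card S \<le> DIM('e)}. affine hull (\<beta> ` S))"
      using X by (intro negligible_Union) (auto intro: negligible_affine_hull_few finite_subset)
  qed
  moreover have "\<not> negligible (ball (\<alpha> w) \<delta>)" using \<delta> by (intro open_not_negligible) auto
  ultimately obtain b where b: "b \<in> ball (\<alpha> w) \<delta>" "b \<notin> Bad" using negligible_subset by blast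
  let ?\<beta> = "\<beta>(w := b)"
  have "\<forall>x\<in>insert w P. c x = 0"
    if c: "sum c X = 0" "(\<Sum>x\<in>X. c x *\<^sub>R ?\<beta> x) = 0" "card {x\<in>X. c x \<noteq> 0} \<le> DIM('e) + 1" for c
  proof -
    have cw: "c w = 0"
    proof (rule ccontr)
      assume nz: "c w \<noteq> 0"
      \<comment> \<open>Solving the relation for \<open>b\<close> puts it into the affine hull of the other vertices involved.\<close>
    define S where "S = {x\<in>X. c x \<noteq> 0} - {w}"
      have S: "finite S" "S \<subseteq> X" using X by (auto simp: S_def)
      have cS: "card S \<le> DIM('e)" using c(3) w nz X by (simp add: S_def)
      have split: "(\<Sum>x\<in>X. g x) = g w + (\<Sum>x\<in>S. g x)" if "\<And>x. c x = 0 \<Longrightarrow> g x = 0" for g :: "'p \<Rightarrow> 'z::comm_monoid_add"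
      proof -
        have "(\<Sum>x\<in>X. g x) = g w + (\<Sum>x\<in>X - {w}. g x)" using X w by (rule sum.remove)
        also have "(\<Sum>x\<in>X - {w}. g x) = (\<Sum>x\<in>S. g x)"
          by (rule sum.mono_neutral_right) (use X that in \<open>auto simp: S_def\<close>)
        finally show ?thesis .
      qed
      have "c w + sum c S = 0" using split[of c] c(1) by simp
      then have 1: "(\<Sum>x\<in>S. - c x / c w) = 1"
        using nz by (simp add: sum_divide_distrib[symmetric] sum_negf divide_simps)
      have "c w *\<^sub>R b + (\<Sum>x\<in>S. c x *\<^sub>R \<beta> x) = 0"
      proof -
        have "(\<Sum>x\<in>S. c x *\<^sub>R ?\<beta> x) = (\<Sum>x\<in>S. c x *\<^sub>R \<beta> x)"
          by (rule sum.cong) (auto simp: S_def)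
        then show ?thesis using split[of "\<lambda>x. c x *\<^sub>R ?\<beta> x"] c(2) by simp
      qed
      then have "c w *\<^sub>R b = - (\<Sum>x\<in>S. c x *\<^sub>R \<beta> x)" by (simp add: eq_neg_iff_add_eq_0)
      then have "(1 / c w) *\<^sub>R (c w *\<^sub>R b) = (1 / c w) *\<^sub>R (- (\<Sum>x\<in>S. c x *\<^sub>R \<beta> x))" by simp
      then have "b = (\<Sum>x\<in>S. (- c x / c w) *\<^sub>R \<beta> x)"
        using nz by (simp add: scaleR_sum_right sum_negf)
      then have "b \<in> affine hull (\<beta> ` S)" using affine_combination_in_hull[OF S(1) 1] by simp
      then show False using b(2) S(2) cS by (auto simp: Bad_def)
    qed
    have "(\<Sum>x\<in>X. c x *\<^sub>R \<beta> x) = (\<Sum>x\<in>X. c x *\<^sub>R ?\<beta> x)"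
      by (rule sum.cong) (use cw in auto)
    then have "(\<Sum>x\<in>X. c x *\<^sub>R \<beta> x) = 0" unfolding c(2) .
    from \<beta>(4)[OF c(1) this c(3)] show ?thesis using cw by blast
  qed
  moreover have "norm (?\<beta> x - \<alpha> x) < \<delta>" for x
    using \<beta>(2)[of x] b(1) by (auto simp: dist_norm norm_minus_commute)
  moreover have "?\<beta> x \<notin> F" if "x \<in> insert w P" for x using that \<beta>(3) b(2) by (auto simp: Bad_def)
  moreover have "?\<beta> x = \<alpha> x" if "x \<notin> insert w P" for x using that \<beta>(1) by auto
  ultimately show ?case by (intro exI[of _ ?\<beta>]) blast
qed

section \<open>Triangulations of a standard realization\<close>

lemma hull_support:
  fixes s :: "(real ^ 'v::finite) set"
  assumes fin: "finite s" and std: "\<And>y. y \<in> s \<Longrightarrow> weights UNIV (($) y)"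
    and u: "weights s u" "\<And>y. y \<in> s \<Longrightarrow> u y > 0" and q: "q \<in> convex hull s"
  shows "weights UNIV (($) q)" "support q \<subseteq> support (point_at s u)"
proof -
  obtain w where w: "weights s w" "q = point_at s w" using q mem_hull_iff[OF fin] by blast
  have nth: "point_at s z $ k = (\<Sum>y\<in>s. z y * y $ k)" for z k by (simp add: wsum_def)
  have ge: "0 \<le> y $ k" if "y \<in> s" for y k using std[OF that] by (simp add: weights_def)
  have one: "(\<Sum>k\<in>UNIV. y $ k) = 1" if "y \<in> s" for y using std[OF that] by (simp add: weights_def)
  have wge: "0 \<le> w y" for y using w(1) by (simp add: weights_def)
  have "(\<Sum>k\<in>UNIV. q $ k) = (\<Sum>y\<in>s. \<Sum>k\<in>UNIV. w y * y $ k)"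
    unfolding w(2) nth by (rule sum.swap)
  also have "\<dots> = (\<Sum>y\<in>s. w y)"
    by (rule sum.cong) (simp_all add: sum_distrib_left[symmetric] one)
  finally have "(\<Sum>k\<in>UNIV. q $ k) = 1" using w(1) by (simp add: weights_def)
  moreover have "0 \<le> q $ k" for k unfolding w(2) nth using ge wge by (simp add: sum_nonneg)
  ultimately show "weights UNIV (($) q)" by (simp add: weights_def)
  show "support q \<subseteq> support (point_at s u)"
  proof
    fix k assume "k \<in> support q"
    then have "(\<Sum>y\<in>s. w y * y $ k) \<noteq> 0" by (simp add: support_def w(2) nth)
    then obtain y where y: "y \<in> s" "w y * y $ k \<noteq> 0" using sum.neutral[of s "\<lambda>y. w y * y $ k"] by blast
    then have "y $ k > 0" using ge[OF y(1), of k] by (simp add: order_less_le)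
    then have "0 < u y * y $ k" using u(2)[OF y(1)] by simp
    also have "\<dots> \<le> (\<Sum>y\<in>s. u y * y $ k)"
      using fin y(1) ge u(2) by (intro member_le_sum) (auto simp: less_imp_le)
    finally show "k \<in> support (point_at s u)" by (simp add: support_def nth)
  qed
qed

text \<open>
  In the standard realization, a convex set cannot bend from one simplex into another: the support of
  a point with positive coordinates on \<open>s\<close> contains the supports of all points of the hull of \<open>s\<close>. Hence every
  triangulation of a standard realization subdivides the simplices of the complex.
\<close>

lemma hull_in_realization:
  fixes s :: "(real ^ 'v::finite) set"
  assumes fin: "finite s" and std: "\<And>y. y \<in> s \<Longrightarrow> weights UNIV (($) y)"
    and u: "weights s u" "\<And>y. y \<in> s \<Longrightarrow> u y > 0" and L: "is_complex L"
    and p: "support (point_at s u) \<in> L"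
  shows "convex hull s \<subseteq> realization L"
proof
  fix q assume "q \<in> convex hull s"
  note q = hull_support[OF fin std u this]
  have "support q \<in> L" using is_complexD(1)[OF L p q(2) support_nonempty[OF q(1)]] .
  then show "q \<in> realization L" using mem_realization_iff[OF L] q(1) by blast
qed

definition restrict_to :: "(real ^ 'v::finite) set set \<Rightarrow> 'v set set \<Rightarrow> (real ^ 'v) set set" where
  "restrict_to V L = {s\<in>V. convex hull s \<subseteq> realization L}"

lemma geometric_restrict_to:
  assumes "geometric V" shows "geometric (restrict_to V L)"
proof (rule geometric_subset[OF assms])
  show "t \<in> restrict_to V L" if "s \<in> restrict_to V L" "t \<subseteq> s" for s t
    using that geometricD(4)[OF assms] hull_mono[OF that(2), of convex] by (auto simp: restrict_to_def)
qed (auto simp: restrict_to_def)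

lemma body_restrict_to:
  fixes V :: "(real ^ 'v::finite) set set"
  assumes V: "geometric V" and std: "\<And>y. y \<in> body V \<Longrightarrow> weights UNIV (($) y)"
    and L: "is_complex L" "realization L \<subseteq> body V"
  shows "body (restrict_to V L) = realization L"
proof
  show "body (restrict_to V L) \<subseteq> realization L" by (auto simp: body_def restrict_to_def)
  show "realization L \<subseteq> body (restrict_to V L)"
  proof
    fix y assume y: "y \<in> realization L"
    then obtain s u where s: "s \<in> V" "weights s u" "y = point_at s u"
      using L(2) body_iff[OF V] by blast
    have fin: "finite s" using geometricD(3)[OF V s(1)] .
    define t where "t = {v\<in>s. u v \<noteq> 0}"
    have t: "t \<in> V" "finite t" using geometricD(4)[OF V s(1)] fin by (auto simp: t_def)
    have u: "weights t u"
      by (rule weights_restrict[OF s(2) fin t(2)]) (use s(2) in \<open>auto simp: t_def weights_def\<close>)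
    have upos: "u v > 0" if "v \<in> t" for v
      using that s(2) by (auto simp: t_def weights_def order_less_le)
    have yt: "y = point_at t u" unfolding s(3) by (rule wsum_weights_cong[OF s(2) u fin t(2)])
    have "support (point_at t u) \<in> L" using y yt mem_realization_iff[OF L(1)] by simp
    moreover have "weights UNIV (($) z)" if "z \<in> t" for z
      by (rule std) (use simplex_subset_body[OF t(1)] that in blast)
    ultimately have "convex hull t \<subseteq> realization L"
      using hull_in_realization[OF t(2) _ u upos L(1)] by blast
    then have "t \<in> restrict_to V L" using t(1) by (simp add: restrict_to_def)
    then show "y \<in> body (restrict_to V L)"
      unfolding body_iff[OF geometric_restrict_to[OF V]] using u yt by blast
  qed
qed

lemma card_simplex_in_hull:
  fixes s t :: "'e::euclidean_space set"
  assumes "\<not> affine_dependent s" "finite t" "convex hull s \<subseteq> convex hull t"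
  shows "card s \<le> card t"
proof -
  have "aff_dim s \<le> aff_dim t"
    using aff_dim_subset[OF assms(3)] by (simp add: aff_dim_convex_hull)
  moreover have "aff_dim s = int (card s) - 1" using aff_dim_affine_independent[OF assms(1)] by simp
  moreover have "aff_dim t \<le> int (card t) - 1" using aff_dim_le_card[OF assms(2)] .
  ultimately show ?thesis by linarith
qed

text \<open>
  The hull of \<open>s\<close> lies in the simplex on the support of any of its interior points, so it has no larger
  dimension.
\<close>

lemma card_simplex_support:
  fixes s :: "(real ^ 'v::finite) set"
  assumes ind: "\<not> affine_dependent s" and std: "\<And>y. y \<in> s \<Longrightarrow> weights UNIV (($) y)"
    and u: "weights s u" "\<And>y. y \<in> s \<Longrightarrow> u y > 0" 
  shows "card s \<le> card (support (point_at s u))"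
proof -
  have fin: "finite s" using ind aff_independent_finite by blast
  let ?t = "support (point_at s u)"
  have "convex hull s \<subseteq> convex hull (vertex_point ` ?t)"
  proof
    fix q assume "q \<in> convex hull s"
    note q = hull_support[OF fin std u this]
    then have "weights ?t (($) q)" using iffD2[OF weights_support_subset] by blast
    then have "q \<in> realization {?t}" using mem_realization_iff_weights by blast
    then show "q \<in> convex hull (vertex_point ` ?t)" by (simp add: realization_def)
  qed
  then have "card s \<le> card (vertex_point ` ?t :: (real ^ 'v) set)"
    using card_simplex_in_hull[OF ind, of "vertex_point ` ?t"] by simp
  also have "\<dots> \<le> card ?t" by (rule card_image_le) simp
  finally show ?thesis .
qed

lemma card_restrict_to:
  fixes V :: "(real ^ 'v::finite) set set"
  assumes V: "geometric V" and s: "s \<in> restrict_to V L" and L: "is_complex L"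
    and dim: "\<And>t. t \<in> L \<Longrightarrow> card t \<le> m"
  shows "card s \<le> m"
proof (cases "s = {}")
  case False
  have sV: "s \<in> V" "convex hull s \<subseteq> realization L" using s by (auto simp: restrict_to_def)
  have fin: "finite s" using geometricD(3)[OF V sV(1)] .
  note b = weights_barycenter[OF fin False] barycenter_pos[OF fin]
  have "point_at s (barycenter s) \<in> convex hull s" using mem_hull_iff[OF fin] b(1) by blast
  then have "support (point_at s (barycenter s)) \<in> L"
    using sV(2) mem_realization_iff[OF L] by blast
  moreover have "weights UNIV (($) y)" if "y \<in> s" for y
    using subsetD[OF sV(2) hull_inc[OF that]] mem_realization_iff[OF L, of y] by blast
  ultimately show ?thesis
    using card_simplex_support[OF geometricD(5)[OF V sV(1)] _ b] dim by (meson order_trans)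
qed simp

lemma card_gauss_preimage_image:
  fixes V :: "'a::real_vector set set" and W :: "'b::real_vector set set"
    and f :: "'a \<Rightarrow> 'e::euclidean_space"
  assumes dim: "DIM('e) = 2 * n + 1"
    and V: "geometric V" "\<And>s. s \<in> V \<Longrightarrow> affine_on_simplex s f" "inj_on f (body V)" "\<And>s. s \<in> V \<Longrightarrow> card s \<le> Suc n"
    and W: "geometric W" "\<And>s. s \<in> W \<Longrightarrow> affine_on_simplex s h" "inj_on h (body W)" "\<And>s. s \<in> W \<Longrightarrow> card s \<le> Suc n"
    and E: "f ` \<Union>V \<subseteq> E" "h ` \<Union>W \<subseteq> E" and gen: "generic_direction E v"
  shows "card (gauss_preimage (f ` body V) (h ` body W) v) =
    (\<Sum>\<sigma>\<in>{\<sigma>\<in>V. card \<sigma> = Suc n}. chain_count (f ` \<sigma>) {\<tau>\<in>W. card \<tau> = Suc n} h v)"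
proof -
  have reindex: "(\<Sum>\<sigma>\<in>{\<sigma>\<in>(`) k ` U. card \<sigma> = Suc n}. F \<sigma>) = (\<Sum>\<sigma>\<in>{\<sigma>\<in>U. card \<sigma> = Suc n}. F (k ` \<sigma>))"
    and small: "\<And>s. s \<in> (`) k ` U \<Longrightarrow> card s \<le> Suc n"
    and geo: "geometric ((`) k ` U)" and bod: "body ((`) k ` U) = k ` body U"
    if U: "geometric U" "\<And>s. s \<in> U \<Longrightarrow> affine_on_simplex s k" "inj_on k (body U)" "\<And>s. s \<in> U \<Longrightarrow> card s \<le> Suc n"
    for U :: "'z::real_vector set set" and k :: "'z \<Rightarrow> 'e" and F :: "'e set \<Rightarrow> nat"
  proof -
    have emb: "embeds U k" using inj_on_body_imp_embeds[OF U(1-3)] .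
    have inj: "inj_on k (\<Union>U)" using embeds_inj_vertices[OF geometricD(1)[OF U(1)] emb] .
    have sub: "s \<subseteq> \<Union>U" if "s \<in> U" for s using that by blast
    have cardk: "card (k ` s) = card s" if "s \<in> U" for s
      using card_image inj_on_subset[OF inj sub[OF that]] by blast
    have "{\<sigma>\<in>(`) k ` U. card \<sigma> = Suc n} = (`) k ` {\<sigma>\<in>U. card \<sigma> = Suc n}" using cardk by auto
    moreover have "inj_on ((`) k) {\<sigma>\<in>U. card \<sigma> = Suc n}"
      using inj_on_image_eq_iff[OF inj] sub by (intro inj_onI) blast
    ultimately show "(\<Sum>\<sigma>\<in>{\<sigma>\<in>(`) k ` U. card \<sigma> = Suc n}. F \<sigma>) = (\<Sum>\<sigma>\<in>{\<sigma>\<in>U. card \<sigma> = Suc n}. F (k ` \<sigma>))"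
      by (simp add: sum.reindex)
    show "card s \<le> Suc n" if "s \<in> (`) k ` U" for s using that cardk U(4) by auto
    show "geometric ((`) k ` U)" using embeds_image_geometric[OF geometricD(1)[OF U(1)] emb] .
    show "body ((`) k ` U) = k ` body U" by (rule body_image[OF U(1,2)])
  qed
  have "card (gauss_preimage (body ((`) f ` V)) (body ((`) h ` W)) v) =
    (\<Sum>\<sigma>\<in>{\<sigma>\<in>(`) f ` V. card \<sigma> = Suc n}. \<Sum>\<tau>\<in>{\<tau>\<in>(`) h ` W. card \<tau> = Suc n}. ray_count \<sigma> \<tau> v)"
    by (rule card_gauss_preimage[OF dim geo[OF V] geo[OF W] small[OF V] small[OF W] _ _ gen])
      (use E in blast)+
  also have "\<dots> = (\<Sum>\<sigma>\<in>{\<sigma>\<in>V. card \<sigma> = Suc n}. \<Sum>\<tau>\<in>{\<tau>\<in>(`) h ` W. card \<tau> = Suc n}. ray_count (f ` \<sigma>) \<tau> v)"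
    by (rule reindex[OF V])
  also have "\<dots> = (\<Sum>\<sigma>\<in>{\<sigma>\<in>V. card \<sigma> = Suc n}. chain_count (f ` \<sigma>) {\<tau>\<in>W. card \<tau> = Suc n} h v)"
    unfolding chain_count_def by (intro sum.cong refl reindex[OF W])
  finally show ?thesis using bod[OF V] bod[OF W] by simp
qed

lemma lk2_eq_1_iff: "lk2 X Y = 1 \<longleftrightarrow> (AE v in lborel. odd (card (gauss_preimage X Y v)))"
  by (simp add: lk2_def)

lemma not_AE_lborel_False: "\<not> (AE v in (lborel :: 'e::euclidean_space measure). False)"
proof
  assume "AE v in (lborel :: 'e measure). False"
  then have "emeasure (lborel :: 'e measure) (space lborel) = 0"
    using AE_iff_null_sets[of UNIV "lborel :: 'e measure"] by (simp add: null_sets_def)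
  then show False by simp
qed

section \<open>Unfolding the cones onto the facets\<close>

locale triangle_Y =
  fixes n :: nat and K :: "'v::finite set set" and A :: "'v set" and x :: 'v
  assumes n: "n \<ge> 1" and nK: "is_n_complex n K" and cardA: "card A = n + 2"
    and boundary: "subcomplex (simplex_boundary A) K" and new: "x \<notin> \<Union>K"
begin

abbreviation KY :: "'v set set" where "KY \<equiv> Delta_Y_exchange n A x K"

text \<open>
  The simplices of \<open>K\<close> that survive the exchange.
\<close>

definition common_part :: "'v set set" where
  "common_part = {s\<in>K. \<not> (s \<subseteq> A \<and> card s = Suc n)}"

text \<open>
  \<open>K\<^sub>Y\<close> is the union of the surviving simplices of \<open>K\<close> and, for every \<open>a\<close> in \<open>A\<close>, the cone from \<open>x\<close> over the
  boundary of the facet \<open>A - {a}\<close>. The cone is the stellar subdivision of this facet at its barycentre.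
\<close>

definition part :: "'v option \<Rightarrow> 'v set set" where
  "part i = (case i of None \<Rightarrow> common_part | Some a \<Rightarrow> stellar (A - {a}) x (full_simplex (A - {a})))"

text \<open>
  On points with positive \<open>x\<close>-coordinate the maps of the cones are bijections onto the interiors of the
  facets; on the common part and on the bases of the cones all maps are the identity.
\<close>

definition unfold_part :: "'v option \<Rightarrow> real ^ 'v \<Rightarrow> real ^ 'v" where
  "unfold_part i = (case i of None \<Rightarrow> id | Some a \<Rightarrow> star_map (A - {a}) x)"

definition parts :: "'v option set" where
  "parts = insert None (Some ` A)"

lemma complex_K: "is_complex K" and dim_K: "s \<in> K \<Longrightarrow> card s \<le> Suc n"
  using nK by (auto simp: is_n_complex_def)

lemma proper_face_in_K: "s \<subseteq> A \<Longrightarrow> s \<noteq> {} \<Longrightarrow> s \<noteq> A \<Longrightarrow> s \<in> K"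
  using boundary by (auto simp: subcomplex_def simplex_boundary_def)

lemma A_notin_K: "A \<notin> K"
  using dim_K[of A] cardA by auto

lemma card_facet: "a \<in> A \<Longrightarrow> card (A - {a}) = Suc n"
  using cardA by simp

lemma facet_in_K: "a \<in> A \<Longrightarrow> A - {a} \<in> K"
proof (rule proper_face_in_K)
  assume "a \<in> A"
  then have "card (A - {a}) = Suc n" by (rule card_facet)
  then show "A - {a} \<noteq> {}" by (metis card.empty nat.distinct(1))
qed auto

lemma facet_cases:
  assumes "s \<subseteq> A" "card s = Suc n" obtains a where "a \<in> A" "s = A - {a}"
proof -
  have "card (A - s) = 1" using assms cardA by (simp add: card_Diff_subset)
  then obtain a where "A - s = {a}" using card_1_singletonE by blast
  then have "a \<in> A" "s = A - {a}" using assms(1) by auto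
  then show ?thesis by (rule that)
qed

lemma x_notin_A: "x \<notin> A"
proof
  assume "x \<in> A"
  moreover have "{x} \<noteq> A" using cardA by auto
  ultimately have "{x} \<in> K" using proper_face_in_K[of "{x}"] by simp
  then show False using new by blast
qed

lemma complex_common_part: "is_complex common_part"
  unfolding is_complex_def
proof (intro conjI ballI allI impI)
  fix s assume s: "s \<in> common_part"
  then have sK: "s \<in> K" "\<not> (s \<subseteq> A \<and> card s = Suc n)" by (auto simp: common_part_def)
  show "s \<noteq> {}" using is_complexD(2)[OF complex_K sK(1)] .
  fix t assume t: "t \<subseteq> s \<and> t \<noteq> {}"
  have "\<not> (t \<subseteq> A \<and> card t = Suc n)"
  proof
    assume tA: "t \<subseteq> A \<and> card t = Suc n"
    then have "t = s" using card_seteq[of s t] t dim_K[OF sK(1)] by simp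
    then show False using sK tA by blast
  qed
  then show "t \<in> common_part" using is_complexD(1)[OF complex_K sK(1)] t by (auto simp: common_part_def)
qed (auto intro: finite_subset)

lemma common_part_subset: "common_part \<subseteq> K"
  by (auto simp: common_part_def)

lemma facet_notin_common_part: "a \<in> A \<Longrightarrow> A - {a} \<notin> common_part"
  using card_facet by (auto simp: common_part_def)

lemma mem_KY: "s \<in> KY \<longleftrightarrow> s \<in> common_part \<or> (\<exists>r. s = insert x r \<and> r \<subseteq> A \<and> card r \<le> n)"
proof -
  define S where "S = skeleton (n - 1) (full_simplex A)"
  have S: "r \<in> S \<longleftrightarrow> r \<subseteq> A \<and> r \<noteq> {} \<and> card r \<le> n" for r
    using n by (auto simp: S_def skeleton_def full_simplex_def)
  have "Y_complex n A x = S \<union> {{x}} \<union> insert x ` S"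
    unfolding Y_complex_def S_def join_complex_def by auto
  then have KY: "s \<in> KY \<longleftrightarrow> s \<in> K - {s \<in> simplex_boundary A. card s = n + 1} \<or> s \<in> S \<or> s = {x} \<or>
      s \<in> insert x ` S"
    unfolding Delta_Y_exchange_def by blast
  have "s \<in> K - {s \<in> simplex_boundary A. card s = n + 1} \<longleftrightarrow> s \<in> common_part"
    using cardA is_complexD(2)[OF complex_K] by (auto simp: common_part_def simplex_boundary_def)
  moreover have "s \<in> common_part" if "s \<in> S"
  proof -
    have s: "s \<subseteq> A" "s \<noteq> {}" "card s \<le> n" using that S by auto
    then have "s \<noteq> A" using cardA by auto
    then show ?thesis using s proper_face_in_K[OF s(1,2)] by (simp add: common_part_def)
  qed
  moreover have "s = {x} \<or> s \<in> insert x ` S \<longleftrightarrow> (\<exists>r. s = insert x r \<and> r \<subseteq> A \<and> card r \<le> n)"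
  proof
    assume "\<exists>r. s = insert x r \<and> r \<subseteq> A \<and> card r \<le> n"
    then obtain r where "s = insert x r" "r \<subseteq> A" "card r \<le> n" by blast
    then show "s = {x} \<or> s \<in> insert x ` S" using S[of r] by (cases "r = {}") auto
  next
    assume "s = {x} \<or> s \<in> insert x ` S"
    then consider "s = insert x {}" | r where "s = insert x r" "r \<in> S" by blast
    then show "\<exists>r. s = insert x r \<and> r \<subseteq> A \<and> card r \<le> n"
    proof cases
      case 1
      then show ?thesis by (intro exI[of _ "{}"]) simp
    next
      case 2
      then show ?thesis using S by blast
    qed
  qed
  ultimately show ?thesis unfolding KY by blast
qed

lemma dim_KY: "s \<in> KY \<Longrightarrow> card s \<le> Suc n"
  unfolding mem_KY using dim_K common_part_subset card_insert_le_m1[of "Suc n"] 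
  by (auto simp: card_insert_if)

lemma complex_KY: "is_complex KY"
  using is_n_complex_Delta_Y_exchange[OF n nK cardA new] boundary
  by (auto simp: is_n_complex_def subcomplex_def)

lemma mem_cone:
  assumes "a \<in> A"
  shows "s \<in> part (Some a) \<longleftrightarrow> (s \<subset> A - {a} \<and> s \<noteq> {}) \<or> (\<exists>r. s = insert x r \<and> r \<subset> A - {a})"
proof -
  have "A - {a} \<noteq> {}" using is_complexD(2)[OF complex_K facet_in_K[OF assms]] .
  then have "\<not> A - {a} \<subseteq> r \<and> r \<union> (A - {a}) \<in> full_simplex (A - {a}) \<longleftrightarrow> r \<subset> A - {a}" for r
    by (auto simp: full_simplex_def)
  then show ?thesis by (auto simp: part_def stellar_def full_simplex_def)
qed

lemma proper_facet_face_common: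
  assumes "a \<in> A" "s \<subset> A - {a}" "s \<noteq> {}" shows "s \<in> common_part"
proof -
  have "card s < card (A - {a})" using assms by (intro psubset_card_mono) auto
  then have "card s \<le> n" using card_facet[OF assms(1)] by simp
  then show ?thesis using assms proper_face_in_K[of s] by (auto simp: common_part_def)
qed

lemma complex_part: "i \<in> parts \<Longrightarrow> is_complex (part i)"
  using complex_common_part is_complex_stellar[OF full_simplex_complex]
  by (auto simp: parts_def part_def)

lemma part_subset_KY: assumes "i \<in> parts" shows "part i \<subseteq> KY"
proof
  fix s assume s: "s \<in> part i"
  show "s \<in> KY"
  proof (cases i)
    case None
    then show ?thesis using s by (simp add: part_def mem_KY)
  next
    case (Some a)
    then have a: "a \<in> A" using assms by (auto simp: parts_def)
    have "card r \<le> n" if "r \<subset> A - {a}" for r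
      using psubset_card_mono[OF _ that] card_facet[OF a] by simp
    then show ?thesis
      using s proper_facet_face_common[OF a, of s] unfolding Some mem_cone[OF a] mem_KY by blast
  qed
qed

lemma linear_unfold_part: "linear (unfold_part i)"
  by (cases i) (simp_all add: unfold_part_def linear_star_map linear_id)

lemma x_notin_full: "x \<notin> \<Union>(full_simplex (A - {a}))"
  using x_notin_A by (auto simp: full_simplex_def)

lemma facet_in_full: "a \<in> A \<Longrightarrow> A - {a} \<in> full_simplex (A - {a})"
  using is_complexD(2)[OF complex_K facet_in_K] by (auto simp: full_simplex_def)

lemma unfold_part_fixed:
  assumes "i \<in> parts" "q \<in> realization (part i)" "q $ x = 0"
  shows "unfold_part i q = q" "support q \<in> common_part"
proof -
  show "unfold_part i q = q"
    using assms(3) by (cases i) (auto simp: unfold_part_def star_map_id)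
  have s: "support q \<in> part i" "x \<notin> support q"
    using mem_realization_iff[OF complex_part[OF assms(1)]] assms(2,3) by (auto simp: support_def)
  show "support q \<in> common_part"
  proof (cases i)
    case None
    then show ?thesis using s by (simp add: part_def)
  next
    case (Some a)
    then have a: "a \<in> A" using assms by (auto simp: parts_def)
    show ?thesis using s proper_facet_face_common[OF a] unfolding Some mem_cone[OF a] by blast
  qed
qed

lemma unfold_part_interior:
  assumes "i \<in> parts" "q \<in> realization (part i)" "q $ x \<noteq> 0"
  obtains a where "i = Some a" "a \<in> A" "support (unfold_part i q) = A - {a}"
proof (cases i)
  case None
  have "support q \<in> common_part" using assms None complex_common_part mem_realization_iff by (auto simp: part_def)
  then have "x \<in> \<Union>K" using assms(3) common_part_subset by (auto simp: support_def)
  then show ?thesis using new by blast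
next
  case (Some a)
  then have a: "a \<in> A" using assms by (auto simp: parts_def)
  have q: "q \<in> realization (stellar (A - {a}) x (full_simplex (A - {a})))" using assms Some by (simp add: part_def)
  note sp = stellar_point(4,5)[OF full_simplex_complex x_notin_full q assms(3)]
  have "support q - {x} \<union> (A - {a}) = A - {a}" using sp(1) by (auto simp: full_simplex_def)
  then have "support (unfold_part i q) = A - {a}" using sp(2) Some by (simp add: unfold_part_def)
  then show ?thesis using that[of a] Some a by blast
qed

lemma unfold_part_in_K:
  assumes "i \<in> parts" "q \<in> realization (part i)"
  shows "unfold_part i q \<in> realization K"
proof (cases i)
  case None
  then have "support q \<in> K" "weights UNIV (($) q)"
    using assms mem_realization_iff[OF complex_common_part] common_part_subset by (auto simp: part_def)
  then show ?thesis using None mem_realization_iff[OF complex_K] by (simp add: unfold_part_def)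
next
  case (Some a)
  then have a: "a \<in> A" using assms by (auto simp: parts_def)
  have "unfold_part i q \<in> realization (full_simplex (A - {a}))"
    using assms(2) star_map_bij(2)[OF full_simplex_complex x_notin_full facet_in_full[OF a]] Some
    by (auto simp: part_def unfold_part_def)
  then have "weights UNIV (($) (unfold_part i q))" "support (unfold_part i q) \<in> full_simplex (A - {a})"
    unfolding mem_realization_iff[OF full_simplex_complex] by auto
  then have "weights UNIV (($) (unfold_part i q))" "support (unfold_part i q) \<subseteq> A - {a}" "support (unfold_part i q) \<noteq> {}"
    unfolding full_simplex_def by auto
  then show ?thesis
    using is_complexD(1)[OF complex_K facet_in_K[OF a]] mem_realization_iff[OF complex_K] by blast
qed

text \<open>
  A point with positive \<open>x\<close>-coordinate is mapped to the interior of a facet, which determines the part it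
  comes from, and all other points are fixed.
\<close>

lemma unfold_part_eq:
  assumes i: "i \<in> parts" "q \<in> realization (part i)" and j: "j \<in> parts" "r \<in> realization (part j)"
    and eq: "unfold_part i q = unfold_part j r"
  shows "q = r" "q $ x \<noteq> 0 \<Longrightarrow> i = j"
proof -
  have zero: "r $ x = 0" if h: "i \<in> parts" "q \<in> realization (part i)" "j \<in> parts" "r \<in> realization (part j)"
    "unfold_part i q = unfold_part j r" "q $ x = 0" for i j q r
  proof (rule ccontr)
    assume "r $ x \<noteq> 0"
    then obtain a where "a \<in> A" "support (unfold_part j r) = A - {a}"
      using unfold_part_interior[OF h(3,4)] by blast
    then show False using unfold_part_fixed[OF h(1,2,6)] h(5) facet_notin_common_part by metis
  qed
  have "q = r \<and> (q $ x \<noteq> 0 \<longrightarrow> i = j)"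
  proof (cases "q $ x = 0")
    case True
    then show ?thesis using zero[OF i j eq True] unfold_part_fixed(1)[OF i True] unfold_part_fixed(1)[OF j] eq by simp
  next
    case False
    then have rx: "r $ x \<noteq> 0" using zero[OF j i eq[symmetric]] by blast
    obtain a where a: "i = Some a" "a \<in> A" "support (unfold_part i q) = A - {a}"
      using unfold_part_interior[OF i False] .
    obtain b where b: "j = Some b" "b \<in> A" "support (unfold_part j r) = A - {b}"
      using unfold_part_interior[OF j rx] .
    have "A - {a} = A - {b}" using a b eq by simp
    then have "a = b" using a(2) b(2) by blast
    then have ij: "i = j" using a b by simp
    have "inj_on (unfold_part i) (realization (part i))"
      using star_map_bij(1)[OF full_simplex_complex x_notin_full facet_in_full[OF a(2)]]
      by (simp add: a(1) part_def unfold_part_def)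
    then show ?thesis using ij i j eq by (auto dest: inj_onD)
  qed
  then show "q = r" "q $ x \<noteq> 0 \<Longrightarrow> i = j" by auto
qed

lemma unfold_parts_cover: "(\<Union>i\<in>parts. unfold_part i ` realization (part i)) = realization K"
proof
  show "(\<Union>i\<in>parts. unfold_part i ` realization (part i)) \<subseteq> realization K" using unfold_part_in_K by blast
  show "realization K \<subseteq> (\<Union>i\<in>parts. unfold_part i ` realization (part i))"
  proof
    fix p assume "p \<in> realization K"
    then have p: "weights UNIV (($) p)" "support p \<in> K" using mem_realization_iff[OF complex_K] by auto
    show "p \<in> (\<Union>i\<in>parts. unfold_part i ` realization (part i))"
    proof (cases "support p \<in> common_part")
      case True
      then have "p \<in> realization (part None)" using p mem_realization_iff[OF complex_common_part] by (simp add: part_def)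
      then have "unfold_part None p \<in> unfold_part None ` realization (part None)" by blast
      then show ?thesis by (auto simp: parts_def unfold_part_def)
    next
      case False
      then have "support p \<subseteq> A" "card (support p) = Suc n" using p by (auto simp: common_part_def)
      then obtain a where a: "a \<in> A" "support p = A - {a}" using facet_cases by blast
      have "p \<in> realization (full_simplex (A - {a}))"
        unfolding mem_realization_iff[OF full_simplex_complex] using p(1) facet_in_full[OF a(1)] a(2) by simp
      then have "p \<in> unfold_part (Some a) ` realization (part (Some a))"
        using star_map_bij(2)[OF full_simplex_complex x_notin_full facet_in_full[OF a(1)]]
        by (simp add: part_def unfold_part_def)
      then show ?thesis using a(1) by (auto simp: parts_def)
    qed
  qed
qed

text \<open>
  The map from \<open>K\<close> to \<open>K\<^sub>Y\<close> that takes the facets to the cones.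
\<close>

definition fold_back :: "real ^ 'v \<Rightarrow> real ^ 'v" where
  "fold_back p = (SOME q. \<exists>i\<in>parts. q \<in> realization (part i) \<and> unfold_part i q = p)"

lemma fold_back_unfold:
  assumes "i \<in> parts" "q \<in> realization (part i)"
  shows "fold_back (unfold_part i q) = q"
proof -
  have "\<exists>j\<in>parts. fold_back (unfold_part i q) \<in> realization (part j) \<and>
      unfold_part j (fold_back (unfold_part i q)) = unfold_part i q"
    unfolding fold_back_def by (rule someI[of _ q]) (use assms in blast)
  then show ?thesis using unfold_part_eq(1)[OF assms] by metis
qed

end

locale triangulated_Y = triangle_Y n K A x
  for n :: nat and K :: "'v::finite set set" and A x +
  fixes V :: "(real ^ 'v) set set"
  assumes V: "geometric V" and body_V: "body V = realization KY"
begin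

lemma std_V: "y \<in> body V \<Longrightarrow> weights UNIV (($) y)"
  using body_V mem_realization_iff[OF complex_KY] by blast

lemma realization_sub:
  assumes "is_complex L" "L \<subseteq> KY" shows "realization L \<subseteq> body V"
  unfolding body_V using assms mem_realization_iff[OF assms(1)] mem_realization_iff[OF complex_KY] by blast

lemma body_restrict: "is_complex L \<Longrightarrow> L \<subseteq> KY \<Longrightarrow> body (restrict_to V L) = realization L"
  using body_restrict_to[OF V std_V] realization_sub by blast

text \<open>
  The triangulation of \<open>K\<close> that is transported from the parts of \<open>K\<^sub>Y\<close>. On each of its simplices
  \<^const>\<open>fold_back\<close> is affine.
\<close>

definition V' :: "(real ^ 'v) set set" where
  "V' = (\<Union>i\<in>parts. (`) (unfold_part i) ` restrict_to V (part i))"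

lemma restrict_part:
  assumes "i \<in> parts"
  shows "geometric (restrict_to V (part i))" "body (restrict_to V (part i)) = realization (part i)"
    "inj_on (unfold_part i) (realization (part i))"
    "geometric ((`) (unfold_part i) ` restrict_to V (part i))"
    "body ((`) (unfold_part i) ` restrict_to V (part i)) = unfold_part i ` realization (part i)"
proof -
  show g: "geometric (restrict_to V (part i))" by (rule geometric_restrict_to[OF V])
  show b: "body (restrict_to V (part i)) = realization (part i)"
    using body_restrict[OF complex_part part_subset_KY] assms by blast
  show inj: "inj_on (unfold_part i) (realization (part i))"
    using unfold_part_eq(1)[OF assms _ assms] by (auto intro: inj_onI)
  have aff: "affine_on_simplex s (unfold_part i)" for s by (rule linear_affine_on_simplex[OF linear_unfold_part])
  have "embeds (restrict_to V (part i)) (unfold_part i)"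
    by (rule inj_on_body_imp_embeds[OF g aff]) (use inj b in simp)
  then show "geometric ((`) (unfold_part i) ` restrict_to V (part i))"
    using embeds_image_geometric geometricD(1)[OF g] by blast
  show "body ((`) (unfold_part i) ` restrict_to V (part i)) = unfold_part i ` realization (part i)"
    using body_image[OF g aff] b by simp
qed

lemma mem_V'E:
  assumes "S \<in> V'"
  obtains i s where "i \<in> parts" "s \<in> V" "convex hull s \<subseteq> realization (part i)" "S = unfold_part i ` s"
    "finite s" "convex hull S = unfold_part i ` (convex hull s)"
proof -
  obtain i s where si: "i \<in> parts" "s \<in> V" "convex hull s \<subseteq> realization (part i)" "S = unfold_part i ` s"
    using assms by (auto simp: V'_def restrict_to_def)
  have fin: "finite s" using geometricD(3)[OF V si(2)] .
  have "convex hull S = unfold_part i ` (convex hull s)"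
    unfolding si(4) by (rule convex_hull_linear_image[OF linear_unfold_part, symmetric])
  then show ?thesis using that si fin by blast
qed

text \<open>
  A common point of simplices from two different parts is fixed by both maps and has vanishing
  \<open>x\<close>-coordinate, so it lies in the hull of the common vertices with vanishing \<open>x\<close>-coordinate, which are
  fixed too.
\<close>

lemma geometric_V': "geometric V'"
proof (rule geometricI)
  show "scheme V'"
    unfolding scheme_def
  proof (intro conjI ballI subsetI)
    have "finite parts" by (simp add: parts_def)
    then show "finite V'" unfolding V'_def using geometricD(2)[OF restrict_part(4)] by (intro finite_UN_I) auto
    fix S assume "S \<in> V'"
    then obtain i where i: "i \<in> parts" "S \<in> (`) (unfold_part i) ` restrict_to V (part i)" by (auto simp: V'_def)
    show "finite S" using geometricD(3)[OF restrict_part(4)[OF i(1)] i(2)] .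
    fix T assume "T \<in> Pow S"
    then have "T \<in> (`) (unfold_part i) ` restrict_to V (part i)"
      using geometricD(4)[OF restrict_part(4)[OF i(1)] i(2)] by blast
    then show "T \<in> V'" using i(1) unfolding V'_def by blast
  qed
  show "\<not> affine_dependent S" if S: "S \<in> V'" for S
  proof -
    obtain i where i: "i \<in> parts" "S \<in> (`) (unfold_part i) ` restrict_to V (part i)" using S by (auto simp: V'_def)
    show ?thesis using geometricD(5)[OF restrict_part(4)[OF i(1)] i(2)] .
  qed
  fix S T assume ST: "S \<in> V'" "T \<in> V'"
  obtain i s where si: "i \<in> parts" "s \<in> V" "convex hull s \<subseteq> realization (part i)" "S = unfold_part i ` s"
    "finite s" "convex hull S = unfold_part i ` (convex hull s)" using mem_V'E[OF ST(1)] .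
  obtain j t where jt: "j \<in> parts" "t \<in> V" "convex hull t \<subseteq> realization (part j)" "T = unfold_part j ` t"
    "finite t" "convex hull T = unfold_part j ` (convex hull t)" using mem_V'E[OF ST(2)] .
  show "convex hull S \<inter> convex hull T \<subseteq> convex hull (S \<inter> T)"
  proof
    fix p assume "p \<in> convex hull S \<inter> convex hull T"
    then obtain q r where q: "q \<in> convex hull s" "p = unfold_part i q" and r: "r \<in> convex hull t" "p = unfold_part j r"
      using si(6) jt(6) by auto
    have qi: "q \<in> realization (part i)" "r \<in> realization (part j)" using q r si jt by auto
    note eq = unfold_part_eq[OF si(1) qi(1) jt(1) qi(2)]
    have qr: "q = r" using eq(1) q r by simp
    have qst: "q \<in> convex hull (s \<inter> t)" using geometric_Int[OF V si(2) jt(2)] q r qr by blast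
    show "p \<in> convex hull (S \<inter> T)"
    proof (cases "q $ x = 0")
      case False
      then have ij: "i = j" using eq(2) q r by simp
      have "p \<in> unfold_part i ` (convex hull (s \<inter> t))" using qst q by blast
      also have "\<dots> = convex hull (unfold_part i ` (s \<inter> t))"
        by (rule convex_hull_linear_image[OF linear_unfold_part])
      also have "\<dots> \<subseteq> convex hull (S \<inter> T)" by (rule hull_mono) (use si jt ij in auto)
      finally show ?thesis .
    next
      case True
      define z where "z = {v\<in>s \<inter> t. v $ x = 0}"
      have fin: "finite (s \<inter> t)" "finite z" using si by (auto simp: z_def)
      obtain u where u: "weights (s \<inter> t) u" "q = point_at (s \<inter> t) u" using qst mem_hull_iff[OF fin(1)] by blast
      have vge: "0 \<le> v $ x" if "v \<in> s" for v
        using std_V[of v] simplex_subset_body[OF si(2)] that by (auto simp: weights_def)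
      have "(\<Sum>v\<in>s \<inter> t. u v * v $ x) = 0" using True u(2) by (simp add: wsum_def)
      then have uz: "u v * v $ x = 0" if "v \<in> s \<inter> t" for v
        using that fin(1) vge u(1) sum_nonneg_eq_0_iff[of "s \<inter> t" "\<lambda>v. u v * v $ x"] by (auto simp: weights_def)
      have wz: "weights z u"
        by (rule weights_restrict[OF u(1) fin]) (use uz u(1) in \<open>auto simp: z_def weights_def\<close>)
      have "q = point_at z u" unfolding u(2) by (rule wsum_weights_cong[OF u(1) wz fin])
      then have "q \<in> convex hull z" using mem_hull_iff[OF fin(2)] wz by blast
      moreover have "z \<subseteq> S \<inter> T"
      proof
        fix v assume v: "v \<in> z"
        then have vst: "v \<in> s" "v \<in> t" "v $ x = 0" by (auto simp: z_def)
        have "v \<in> realization (part i)" "v \<in> realization (part j)"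
          using subsetD[OF si(3) hull_inc[OF vst(1)]] subsetD[OF jt(3) hull_inc[OF vst(2)]] by auto
        then have "unfold_part i v = v" "unfold_part j v = v" using unfold_part_fixed(1) si(1) jt(1) vst(3) by auto
        then show "v \<in> S \<inter> T" using vst si(4) jt(4) by force
      qed
      moreover have "p = q" using unfold_part_fixed(1)[OF si(1) qi(1) True] q by simp
      ultimately show ?thesis using hull_mono by blast
    qed
  qed
qed

lemma body_V': "body V' = realization K"
proof -
  have "body V' = (\<Union>i\<in>parts. body ((`) (unfold_part i) ` restrict_to V (part i)))"
    by (auto simp: body_def V'_def)
  also have "\<dots> = (\<Union>i\<in>parts. unfold_part i ` realization (part i))"
    by (rule SUP_cong) (use restrict_part(5) in auto)
  finally show ?thesis unfolding unfold_parts_cover .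
qed

lemma std_V': "y \<in> body V' \<Longrightarrow> weights UNIV (($) y)"
  using body_V' mem_realization_iff[OF complex_K] by blast

lemma body_restrict': 
  assumes "is_complex L" "L \<subseteq> K" shows "body (restrict_to V' L) = realization L"
proof (rule body_restrict_to[OF geometric_V' std_V' assms(1)])
  show "realization L \<subseteq> body V'"
    unfolding body_V' using mem_realization_iff[OF assms(1)] mem_realization_iff[OF complex_K] assms(2) by blast
qed

lemma card_V: "s \<in> V \<Longrightarrow> card s \<le> Suc n"
proof -
  assume s: "s \<in> V"
  have "s \<in> restrict_to V KY" using s body_V by (auto simp: restrict_to_def body_def)
  then show ?thesis using card_restrict_to[OF V _ complex_KY dim_KY] by blast
qed

lemma card_V': "s \<in> V' \<Longrightarrow> card s \<le> Suc n"
proof -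
  assume s: "s \<in> V'"
  have "s \<in> restrict_to V' K" using s body_V' by (auto simp: restrict_to_def body_def)
  then show ?thesis using card_restrict_to[OF geometric_V' _ complex_K dim_K] by blast
qed

end

section \<open>The perturbed embedding\<close>

locale mapped_Y = triangulated_Y n K A x V
  for n :: nat and K :: "'v::finite set set" and A x V +
  fixes f :: "real ^ 'v \<Rightarrow> real ^ 'd::finite"
  assumes dim: "CARD('d) = 2 * n + 1" and aff: "\<And>s. s \<in> V \<Longrightarrow> affine_on_simplex s f"
    and inj: "inj_on f (body V)"
begin

text \<open>
  The vertex positions of \<open>f\<close> composed with the folding of \<open>K\<close> onto \<open>K\<^sub>Y\<close>.
\<close>

definition target :: "real ^ 'v \<Rightarrow> real ^ 'd" where
  "target w = f (fold_back w)"

text \<open>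
  The vertices in the interiors of the facets.
\<close>

definition moved :: "(real ^ 'v) set" where
  "moved = {w \<in> \<Union>V'. fold_back w $ x \<noteq> 0}"

text \<open>
  A sphere disjoint from one that contains the facet \<open>A - {a}\<close> has all its simplices here.
\<close>

definition far :: "'v \<Rightarrow> 'v set set" where
  "far a = {s\<in>common_part. s \<inter> (A - {a}) = {}}"

lemma finite_vertices: "finite (\<Union>V)" "finite (\<Union>V')"
  using geometricD(2,3)[OF V] geometricD(2,3)[OF geometric_V'] by blast+

lemma embeds_f: "embeds V f"
  using inj_on_body_imp_embeds[OF V aff inj] .

lemma complex_far: "is_complex (far a)"
  unfolding is_complex_def
proof (intro conjI ballI allI impI)
  fix s t assume s: "s \<in> far a" and t: "t \<subseteq> s \<and> t \<noteq> {}"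
  then have "t \<in> common_part" using is_complexD(1)[OF complex_common_part, of s t] by (simp add: far_def)
  then show "t \<in> far a" using s t by (auto simp: far_def)
qed (use is_complexD(2)[OF complex_common_part] in \<open>auto simp: far_def\<close>)

lemma far_subset: "far a \<subseteq> KY"
  by (auto simp: far_def mem_KY)

lemma cone_disjoint_far:
  assumes a: "a \<in> A" shows "realization (part (Some a)) \<inter> realization (far a) = {}"
proof -
  have pa: "Some a \<in> parts" using a by (simp add: parts_def)
  have "part (Some a) \<inter> far a = {}"
  proof (rule ccontr)
    assume "part (Some a) \<inter> far a \<noteq> {}"
    then obtain s where s: "s \<in> part (Some a)" "s \<in> common_part" "s \<inter> (A - {a}) = {}" by (auto simp: far_def)
    have "x \<notin> s" using s(2) common_part_subset new by blast
    then show False using s unfolding mem_cone[OF a] by blast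
  qed
  then show ?thesis using realization_Int_empty[OF complex_part[OF pa] complex_far] by blast
qed

lemma compact_image_realization:
  assumes "is_complex L" "L \<subseteq> KY" shows "compact (f ` realization L)"
proof -
  have "compact (realization L)"
    using compact_body[OF geometricD(1)[OF realization_geometric(1)[OF assms(1)]]] realization_geometric(2)[OF assms(1)]
    by simp
  moreover have "continuous_on (realization L) f"
    using continuous_on_subset[OF piecewise_affine_continuous[OF V aff] realization_sub[OF assms]] .
  ultimately show ?thesis by (rule compact_continuous_image[rotated])
qed

text \<open>
  Compactness separates the images of each cone and of the disjoint subcomplex.
\<close>

lemma exists_gap:
  "\<exists>\<delta>>0. \<forall>a\<in>A. \<forall>p\<in>f ` realization (part (Some a)). \<forall>q\<in>f ` realization (far a). \<delta> \<le> dist p q"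
proof -
  have "\<exists>d>0. \<forall>p\<in>f ` realization (part (Some a)). \<forall>q\<in>f ` realization (far a). d \<le> dist p q" if a: "a \<in> A" for a
  proof (rule separate_compact_closed)
    have pa: "Some a \<in> parts" using a by (simp add: parts_def)
    show "compact (f ` realization (part (Some a)))"
      using compact_image_realization complex_part[OF pa] part_subset_KY[OF pa] by blast
    show "closed (f ` realization (far a))"
      using compact_image_realization[OF complex_far far_subset] compact_imp_closed by blast
    have "realization (part (Some a)) \<subseteq> body V" "realization (far a) \<subseteq> body V"
      using realization_sub complex_part[OF pa] part_subset_KY[OF pa] complex_far far_subset by blast+
    then show "f ` realization (part (Some a)) \<inter> f ` realization (far a) = {}"
      using inj_on_image_Int[OF inj] cone_disjoint_far[OF a] by (metis image_empty)
  qed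
  then obtain d where d: "\<And>a. a \<in> A \<Longrightarrow> d a > 0"
    "\<And>a p q. a \<in> A \<Longrightarrow> p \<in> f ` realization (part (Some a)) \<Longrightarrow> q \<in> f ` realization (far a) \<Longrightarrow> d a \<le> dist p q"
    by metis
  have A: "finite A" "A \<noteq> {}" using cardA by auto
  define \<delta> where "\<delta> = Min (d ` A)"
  have "\<delta> > 0" using A d(1) by (simp add: \<delta>_def)
  moreover have "\<delta> \<le> d a" if "a \<in> A" for a using A that by (simp add: \<delta>_def)
  ultimately show ?thesis using d(2) by (meson order_trans)
qed

lemma fold_back_simplex:
  assumes "i \<in> parts" "convex hull s \<subseteq> realization (part i)" "v \<in> s"
  shows "fold_back (unfold_part i v) = v"
  using fold_back_unfold[OF assms(1) subsetD[OF assms(2) hull_inc[OF assms(3)]]] .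

lemma unmoved_face:
  assumes "S \<in> V'"
  shows "S - moved \<in> V" "\<And>v. v \<in> S - moved \<Longrightarrow> fold_back v = v"
proof -
  obtain i s where si: "i \<in> parts" "s \<in> V" "convex hull s \<subseteq> realization (part i)" "S = unfold_part i ` s"
    using mem_V'E[OF assms] by metis
  have "v \<in> s \<and> fold_back v = v" if v: "v \<in> S - moved" for v
  proof -
    obtain v0 where v0: "v0 \<in> s" "v = unfold_part i v0" using v si(4) by blast
    have fb: "fold_back v = v0" using fold_back_simplex[OF si(1,3) v0(1)] v0(2) by simp
    then have "v0 $ x = 0" using v assms by (auto simp: moved_def)
    then have "v = v0" using unfold_part_fixed(1)[OF si(1)] subsetD[OF si(3) hull_inc[OF v0(1)]] v0(2) by simp
    then show ?thesis using v0(1) fb by simp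
  qed
  then show "S - moved \<in> V" "\<And>v. v \<in> S - moved \<Longrightarrow> fold_back v = v"
    using geometricD(4)[OF V si(2)] by blast+
qed

text \<open>
  Two equal combinations over simplices of dimension at most \<open>n\<close> give an affine relation with at most
  \<open>2n + 2\<close> terms. So the coefficients agree at all moved vertices. What remains, after normalization, is an equality of
  images under \<open>f\<close> of points in faces spanned by fixed vertices, and \<open>f\<close> is injective.
\<close>

lemma general_position_embeds:
  assumes off: "\<And>w. w \<notin> moved \<Longrightarrow> \<beta> w = target w"
    and gp: "\<And>c. sum c (\<Union>V') = 0 \<Longrightarrow> (\<Sum>v\<in>\<Union>V'. c v *\<^sub>R \<beta> v) = 0 \<Longrightarrow>
      card {v\<in>\<Union>V'. c v \<noteq> 0} \<le> DIM(real ^ 'd) + 1 \<Longrightarrow> \<forall>v\<in>moved. c v = 0"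
  shows "embeds V' \<beta>"
  unfolding embeds_def
proof (intro ballI allI impI)
  fix S T u w assume ST: "S \<in> V'" "T \<in> V'" and uw: "weights S u \<and> weights T w \<and> wsum S u \<beta> = wsum T w \<beta>"
  let ?X = "\<Union>V'"
  have fX: "finite ?X" by (rule finite_vertices)
  have fST: "finite S" "finite T" using geometricD(3)[OF geometric_V'] ST by auto
  have sub: "S \<subseteq> ?X" "T \<subseteq> ?X" using ST by auto
  have mX: "moved \<subseteq> ?X" by (auto simp: moved_def)
  have u: "weights S u" and w: "weights T w" using uw by auto
  have uX: "weights ?X u" "weights ?X w" using weights_mono[OF u sub(1) fX] weights_mono[OF w sub(2) fX] by auto
  have eq: "wsum ?X u \<beta> = wsum ?X w \<beta>"
    using wsum_extend[OF u sub(1) fX, of \<beta>] wsum_extend[OF w sub(2) fX, of \<beta>] uw by simp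
  have supp: "u v = 0" if "v \<notin> S" for v using u that by (simp add: weights_def)
  have supp': "w v = 0" if "v \<notin> T" for v using w that by (simp add: weights_def)
  have ge: "0 \<le> u v" "0 \<le> w v" for v using u w by (auto simp: weights_def)
  have mv: "u v = w v" if "v \<in> moved" for v
  proof -
    have "sum (\<lambda>v. u v - w v) ?X = 0" using uX by (simp add: sum_subtractf weights_def)
    moreover have "(\<Sum>v\<in>?X. (u v - w v) *\<^sub>R \<beta> v) = 0"
      using eq by (simp add: wsum_def scaleR_diff_left sum_subtractf)
    moreover have "card {v\<in>?X. u v - w v \<noteq> 0} \<le> DIM(real ^ 'd) + 1"
    proof -
      have "{v\<in>?X. u v - w v \<noteq> 0} \<subseteq> S \<union> T"
      proof
        fix v assume "v \<in> {v\<in>?X. u v - w v \<noteq> 0}"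
        then show "v \<in> S \<union> T" using supp[of v] supp'[of v] by (cases "v \<in> S"; cases "v \<in> T") auto
      qed
      then have "card {v\<in>?X. u v - w v \<noteq> 0} \<le> card (S \<union> T)" using fST by (intro card_mono) auto
      also have "\<dots> \<le> card S + card T" by (rule card_Un_le)
      also have "\<dots> \<le> DIM(real ^ 'd) + 1" using card_V'[OF ST(1)] card_V'[OF ST(2)] dim by simp
      finally show ?thesis .
    qed
    ultimately have "\<forall>v\<in>moved. u v - w v = 0" by (rule gp)
    then show ?thesis using that by simp
  qed
  let ?Y = "?X - moved"
  have split: "sum g ?X = sum g ?Y + sum g moved" for g :: "real ^ 'v \<Rightarrow> 'z::comm_monoid_add"
    using sum.subset_diff[OF mX fX] .
  have summ: "sum u moved = sum w moved" "(\<Sum>v\<in>moved. u v *\<^sub>R \<beta> v) = (\<Sum>v\<in>moved. w v *\<^sub>R \<beta> v)"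
    by (rule sum.cong; simp add: mv)+
  \<comment> \<open>The weight of the fixed vertices is the same on both sides and serves to normalize them.\<close>
  define \<kappa> where "\<kappa> = sum u ?Y"
  have kw: "\<kappa> = sum w ?Y"
  proof -
    have "sum u ?X = sum w ?X" using uX by (simp add: weights_def)
    then show ?thesis using split[of u] split[of w] summ(1) by (simp add: \<kappa>_def)
  qed
  have beq: "(\<Sum>v\<in>?Y. u v *\<^sub>R \<beta> v) = (\<Sum>v\<in>?Y. w v *\<^sub>R \<beta> v)"
    using eq split[of "\<lambda>v. u v *\<^sub>R \<beta> v"] split[of "\<lambda>v. w v *\<^sub>R \<beta> v"] summ(2) by (simp add: wsum_def)
  have "u v = w v" if v: "v \<in> ?Y" for v
  proof (cases "\<kappa> = 0")
    case True
    have "u v = 0"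
      using True v fX ge sum_nonneg_eq_0_iff[of ?Y u] by (simp add: \<kappa>_def)
    moreover have "w v = 0"
      using True v fX ge sum_nonneg_eq_0_iff[of ?Y w] kw by simp
    ultimately show ?thesis by simp
  next
    case False
    have "\<kappa> \<ge> 0" unfolding \<kappa>_def using ge by (simp add: sum_nonneg)
    then have \<kappa>: "\<kappa> > 0" using False by simp
    have norm: "weights (R - moved) (\<lambda>v. if v \<in> R - moved then z v / \<kappa> else 0) \<and>
        wsum (R - moved) (\<lambda>v. if v \<in> R - moved then z v / \<kappa> else 0) f = (1 / \<kappa>) *\<^sub>R (\<Sum>v\<in>?Y. z v *\<^sub>R \<beta> v)"
      if R: "R \<in> V'" and z: "\<And>v. 0 \<le> z v" "\<And>v. v \<notin> R \<Longrightarrow> z v = 0" "sum z ?Y = \<kappa>" for R z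
    proof -
      have RY: "R - moved \<subseteq> ?Y" using R by blast
      have fR: "finite (R - moved)" using geometricD(3)[OF geometric_V' R] by simp
      have s1: "sum z (R - moved) = sum z ?Y" by (rule sum.mono_neutral_left) (use fX RY z(2) in auto)
      have "(\<Sum>v\<in>R - moved. if v \<in> R - moved then z v / \<kappa> else 0) = (\<Sum>v\<in>R - moved. z v / \<kappa>)"
        by (rule sum.cong) auto
      also have "\<dots> = 1" using s1 z(3) \<kappa> by (simp add: sum_divide_distrib[symmetric])
      finally have "weights (R - moved) (\<lambda>v. if v \<in> R - moved then z v / \<kappa> else 0)"
        using z(1) \<kappa> by (auto simp: weights_def)
      moreover have "wsum (R - moved) (\<lambda>v. if v \<in> R - moved then z v / \<kappa> else 0) f
          = (1 / \<kappa>) *\<^sub>R (\<Sum>v\<in>R - moved. z v *\<^sub>R \<beta> v)"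
        unfolding wsum_def scaleR_sum_right
        by (rule sum.cong) (use unmoved_face(2)[OF R] off in \<open>auto simp: target_def\<close>)
      moreover have "(\<Sum>v\<in>R - moved. z v *\<^sub>R \<beta> v) = (\<Sum>v\<in>?Y. z v *\<^sub>R \<beta> v)"
        by (rule sum.mono_neutral_left) (use fX RY z(2) in auto)
      ultimately show ?thesis by simp
    qed
    note nu = norm[OF ST(1) ge(1) supp \<kappa>_def[symmetric]]
    note nw = norm[OF ST(2) ge(2) supp' kw[symmetric]]
    have "(\<lambda>v. if v \<in> S - moved then u v / \<kappa> else 0) = (\<lambda>v. if v \<in> T - moved then w v / \<kappa> else 0)"
      by (rule embedsD[OF embeds_f unmoved_face(1)[OF ST(1)] unmoved_face(1)[OF ST(2)]])
        (use nu nw beq in auto)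
    then have "(if v \<in> S - moved then u v / \<kappa> else 0) = (if v \<in> T - moved then w v / \<kappa> else 0)"
      by (rule fun_cong)
    moreover have "(if v \<in> S - moved then u v / \<kappa> else 0) = u v / \<kappa>" using v supp by auto
    moreover have "(if v \<in> T - moved then w v / \<kappa> else 0) = w v / \<kappa>" using v supp' by auto
    ultimately show ?thesis using \<kappa> by simp
  qed
  moreover have "u v = w v" if "v \<notin> ?X" for v
  proof -
    have "v \<notin> S" "v \<notin> T" using that sub by blast+
    then show ?thesis using supp[of v] supp'[of v] by simp
  qed
  ultimately show "u = w" using mv by (intro ext) blast
qed

end

text \<open>
  An embedding \<open>f'\<close> of \<open>K\<close> close to the folded map. The condition \<open>avoid\<close> keeps the simplices nondegenerate
  while the vertices are moved back to their targets.
\<close>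

locale perturbed_Y = mapped_Y n K A x V f
  for n :: nat and K :: "'v::finite set set" and A x V and f :: "real ^ 'v \<Rightarrow> real ^ 'd::finite" +
  fixes \<delta> :: real and f' :: "real ^ 'v \<Rightarrow> real ^ 'd"
  assumes gap: "\<And>a p q. a \<in> A \<Longrightarrow> p \<in> f ` realization (part (Some a)) \<Longrightarrow> q \<in> f ` realization (far a) \<Longrightarrow> \<delta> \<le> dist p q"
    and unmoved: "\<And>w. w \<in> \<Union>V' - moved \<Longrightarrow> f' w = target w"
    and near: "\<And>w. w \<in> \<Union>V' \<Longrightarrow> norm (f' w - target w) < \<delta>"
    and avoid: "\<And>w. w \<in> moved \<Longrightarrow> f' w \<notin> target ` \<Union>V'"
    and aff': "\<And>s. s \<in> V' \<Longrightarrow> affine_on_simplex s f'"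
    and embeds': "embeds V' f'"

lemma (in mapped_Y) exists_perturbed: "\<exists>\<delta> f'. perturbed_Y n K A x V f \<delta> f'"
proof -
  obtain \<delta> where \<delta>: "\<delta> > 0"
    "\<And>a p q. a \<in> A \<Longrightarrow> p \<in> f ` realization (part (Some a)) \<Longrightarrow> q \<in> f ` realization (far a) \<Longrightarrow> \<delta> \<le> dist p q"
    using exists_gap by blast
  have "moved \<subseteq> \<Union>V'" by (auto simp: moved_def)
  then have mX: "finite moved" "moved \<subseteq> \<Union>V'"
    using finite_subset finite_vertices(2) by blast+
  obtain \<beta> where \<beta>: "\<And>w. w \<notin> moved \<Longrightarrow> \<beta> w = target w" "\<And>w. norm (\<beta> w - target w) < \<delta>"
    "\<And>w. w \<in> moved \<Longrightarrow> \<beta> w \<notin> target ` \<Union>V'"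
    "\<And>c. sum c (\<Union>V') = 0 \<Longrightarrow> (\<Sum>v\<in>\<Union>V'. c v *\<^sub>R \<beta> v) = 0 \<Longrightarrow>
      card {v\<in>\<Union>V'. c v \<noteq> 0} \<le> DIM(real ^ 'd) + 1 \<Longrightarrow> \<forall>v\<in>moved. c v = 0"
    using exists_general_position[OF finite_vertices(2) mX finite_imageI[OF finite_vertices(2)] \<delta>(1), of target target]
    by blast
  have emb: "embeds V' \<beta>" by (rule general_position_embeds[OF \<beta>(1,4)])
  obtain f' where f': "\<And>s. s \<in> V' \<Longrightarrow> affine_on_simplex s f'" "\<And>v. {v} \<in> V' \<Longrightarrow> f' v = \<beta> v"
    "\<And>s u. s \<in> V' \<Longrightarrow> weights s u \<Longrightarrow> f' (point_at s u) = wsum s u \<beta>"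
    using piecewise_affine_extension[OF geometric_V', of \<beta>] by blast
  have vert: "f' w = \<beta> w" if w: "w \<in> \<Union>V'" for w
  proof -
    obtain S where "S \<in> V'" "w \<in> S" using w by blast
    then have "{w} \<in> V'" using geometricD(4)[OF geometric_V', of S "{w}"] by simp
    then show ?thesis by (rule f'(2))
  qed
  have "perturbed_Y n K A x V f \<delta> f'"
  proof unfold_locales
    show "embeds V' f'"
      unfolding embeds_def
    proof (intro ballI allI impI)
      fix s t u w assume st: "s \<in> V'" "t \<in> V'" and uw: "weights s u \<and> weights t w \<and> wsum s u f' = wsum t w f'"
      have "f' v = \<beta> v" if "v \<in> s \<union> t" for v using vert[of v] st that by blast
      then have "wsum s u f' = wsum s u \<beta>" "wsum t w f' = wsum t w \<beta>"
        unfolding wsum_def by (auto intro!: sum.cong)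
      then show "u = w" using embedsD[OF emb st] uw by simp
    qed
    show "f' w \<notin> target ` \<Union>V'" if "w \<in> moved" for w
      using \<beta>(3)[OF that] vert[OF subsetD[OF mX(2) that]] by simp
  qed (use \<delta>(2) \<beta>(1,2) vert f'(1) in auto)
  then show ?thesis by blast
qed

section \<open>The exchanged sphere\<close>

lemma pl_sphere_homeomorphic:
  fixes X :: "'a::euclidean_space set"
  assumes "pl_sphere n X"
  obtains T :: "'a set" where "(int n + 1) simplex T" "X homeomorphic rel_frontier T"
  using assms unfolding pl_sphere_def pl_homeomorphic_def homeomorphic_def by blast

lemma mod2_cycle_sphere:
  fixes U :: "'a::euclidean_space set set"
  assumes U: "geometric U" and sph: "pl_sphere n (body U)" and n: "n \<ge> 1"
    and dim: "\<And>s. s \<in> U \<Longrightarrow> card s \<le> Suc n"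
  shows "mod2_cycle n {s\<in>U. card s = Suc n}"
proof -
  obtain T :: "'a set" where T: "(int n + 1) simplex T" "body U homeomorphic rel_frontier T"
    using pl_sphere_homeomorphic[OF sph] by blast
  have "even (card {\<sigma>\<in>{s\<in>U. card s = Suc n}. \<rho> \<subseteq> \<sigma>})" if "finite \<rho>" "card \<rho> = n" for \<rho>
    using sphere_even_cofaces[OF U T(1) n T(2) dim that] by (simp add: conj_assoc)
  then show ?thesis
    using geometricD(2,3)[OF U] unfolding mod2_cycle_def by auto
qed

context triangle_Y
begin

definition facets :: "'v set set \<Rightarrow> 'v set" where
  "facets \<gamma> = {a\<in>A. A - {a} \<in> \<gamma>}"

text \<open>
  If \<open>\<gamma>\<close> contains all facets, the subdivided face is empty and so is the result.
\<close>

definition exchanged :: "'v set set \<Rightarrow> 'v set set" where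
  "exchanged \<gamma> = stellar (A - facets \<gamma>) x \<gamma>"

text \<open>
  The facets in \<open>\<gamma>\<close> are exactly the facets that contain the face \<open>A - facets \<gamma>\<close>, and they fill its star.
\<close>

lemma facet_star_in_sphere:
  assumes \<gamma>: "subcomplex \<gamma> K" and sph: "pl_sphere n (realization \<gamma>)" and ne: "facets \<gamma> \<noteq> {}"
    and s: "s \<in> \<gamma>" "A - facets \<gamma> \<subseteq> s"
  shows "s \<subseteq> A"
proof -
  have c\<gamma>: "is_complex \<gamma>" using \<gamma> by (simp add: subcomplex_def)
  let ?vp = "vertex_point :: 'v \<Rightarrow> real ^ 'v"
  note g = realization_geometric[OF c\<gamma>]
  obtain T :: "(real ^ 'v) set" where T: "(int n + 1) simplex T" "realization \<gamma> homeomorphic rel_frontier T"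
    using pl_sphere_homeomorphic[OF sph] by blast
  have vp: "?vp ` (P - Q) = ?vp ` P - ?vp ` Q" for P Q by (rule image_set_diff[OF inj_vertex_point])
  have "?vp ` s \<subseteq> ?vp ` A"
  proof (rule sphere_star_of_facets[OF g(1) T(1) n])
    show "body ((`) ?vp ` insert {} \<gamma>) homeomorphic rel_frontier T" using T(2) g(2) by simp
    show "card (?vp ` A) = n + 2" by (simp add: card_image inj_on_subset[OF inj_vertex_point] cardA)
    show "?vp ` facets \<gamma> \<subseteq> ?vp ` A" by (auto simp: facets_def)
    show "?vp ` facets \<gamma> \<noteq> {}" using ne by simp
    show "?vp ` A - {i} \<in> (`) ?vp ` insert {} \<gamma>" if i: "i \<in> ?vp ` facets \<gamma>" for i
    proof -
      obtain a where a: "a \<in> facets \<gamma>" "i = ?vp a" using i by blast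
      have "?vp ` A - {i} = ?vp ` (A - {a})" using vp[of A "{a}"] a(2) by simp
      then show ?thesis using a(1) by (auto simp: facets_def)
    qed
    show "?vp ` s \<in> (`) ?vp ` insert {} \<gamma>" using s(1) by blast
    show "?vp ` A - ?vp ` facets \<gamma> \<subseteq> ?vp ` s" using s(2) unfolding vp[symmetric] by (rule image_mono)
  qed simp
  then show ?thesis using inj_image_subset_iff[OF inj_vertex_point] by blast
qed

lemma complex_exchanged: "is_complex \<gamma> \<Longrightarrow> is_complex (exchanged \<gamma>)"
  unfolding exchanged_def by (rule is_complex_stellar)

text \<open>
  No facet survives the subdivision, as every facet in \<open>\<gamma>\<close> contains the subdivided face. The new simplices are cones
  over faces of \<open>A\<close> that omit a vertex of this face.
\<close>

lemma exchanged_subset_KY: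
  assumes \<gamma>: "subcomplex \<gamma> K" and sph: "pl_sphere n (realization \<gamma>)" and ne: "facets \<gamma> \<noteq> {}"
  shows "exchanged \<gamma> \<subseteq> KY"
proof
  fix s assume "s \<in> exchanged \<gamma>"
  then consider "s \<in> \<gamma>" "\<not> A - facets \<gamma> \<subseteq> s"
    | r where "s = insert x r" "\<not> A - facets \<gamma> \<subseteq> r" "r \<union> (A - facets \<gamma>) \<in> \<gamma>"
    by (auto simp: exchanged_def stellar_def)
  then show "s \<in> KY"
  proof cases
    case 1
    have "\<not> (s \<subseteq> A \<and> card s = Suc n)"
    proof
      assume "s \<subseteq> A \<and> card s = Suc n"
      then obtain a where a: "a \<in> A" "s = A - {a}" using facet_cases by metis
      then have "a \<in> facets \<gamma>" using 1(1) by (simp add: facets_def)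
      then show False using 1(2) a by blast
    qed
    then show ?thesis using 1(1) \<gamma> by (auto simp: mem_KY common_part_def subcomplex_def)
  next
    case 2
    have rA: "r \<union> (A - facets \<gamma>) \<subseteq> A" by (rule facet_star_in_sphere[OF assms 2(3)]) blast
    have "r \<union> (A - facets \<gamma>) \<in> K" using 2(3) \<gamma> by (auto simp: subcomplex_def)
    then have "card (r \<union> (A - facets \<gamma>)) \<le> Suc n" by (rule dim_K)
    moreover have "card r < card (r \<union> (A - facets \<gamma>))" using 2(2) by (intro psubset_card_mono) auto
    ultimately show ?thesis unfolding mem_KY using 2(1) rA by auto
  qed
qed

lemma exchanged_full:
  assumes "A - facets \<gamma> = {}" shows "exchanged \<gamma> = {}"
  unfolding exchanged_def assms stellar_def by simp

lemma pl_sphere_exchanged: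
  assumes \<gamma>: "subcomplex \<gamma> K" and sph: "pl_sphere n (realization \<gamma>)" and ne: "facets \<gamma> \<noteq> {}"
    and B: "A - facets \<gamma> \<noteq> {}"
  shows "pl_sphere n (realization (exchanged \<gamma>))"
proof -
  have c\<gamma>: "is_complex \<gamma>" and sub: "\<gamma> \<subseteq> K" using \<gamma> by (auto simp: subcomplex_def)
  obtain a where a: "a \<in> facets \<gamma>" using ne by blast
  have "A - facets \<gamma> \<in> \<gamma>"
    by (rule is_complexD(1)[OF c\<gamma>, of "A - {a}"]) (use a B in \<open>auto simp: facets_def\<close>)
  moreover have "x \<notin> \<Union>\<gamma>" using new sub by blast
  ultimately show ?thesis unfolding exchanged_def using pl_sphere_stellar[OF c\<gamma>] sph by blast
qed

lemma exchanged_disjoint: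
  assumes "\<gamma> \<inter> \<gamma>' = {}" "\<gamma>' \<subseteq> K" shows "exchanged \<gamma> \<inter> \<gamma>' = {}"
  using assms new by (auto simp: exchanged_def stellar_def)

lemma disjoint_sphere_in_common_part:
  assumes "subcomplex \<gamma> K" "subcomplex \<gamma>' K" "\<gamma> \<inter> \<gamma>' = {}" "facets \<gamma> \<noteq> {}"
  shows "\<gamma>' \<subseteq> common_part"
proof
  fix s assume s: "s \<in> \<gamma>'"
  obtain a where a: "a \<in> A" "A - {a} \<in> \<gamma>" using assms(4) by (auto simp: facets_def)
  have "\<not> (s \<subseteq> A \<and> card s = Suc n)"
  proof
    assume "s \<subseteq> A \<and> card s = Suc n"
    then obtain b where b: "b \<in> A" "s = A - {b}" using facet_cases by metis
    have "card (A - {a} - {b}) \<ge> 1" using card_facet[OF a(1)] n by (cases "b \<in> A - {a}") auto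
    then have "A - {a} - {b} \<noteq> {}" by (metis card.empty not_one_le_zero)
    then obtain c where c: "c \<in> A - {a}" "c \<in> A - {b}" by blast
    then have "{c} \<in> \<gamma>" "{c} \<in> \<gamma>'"
      using assms(1,2) a b s is_complexD(1)[of \<gamma> "A - {a}" "{c}"] is_complexD(1)[of \<gamma>' s "{c}"]
      by (auto simp: subcomplex_def)
    then show False using assms(3) by blast
  qed
  then show "s \<in> common_part" using s assms(2) by (auto simp: common_part_def subcomplex_def)
qed

end

context triangulated_Y
begin

text \<open>
  The carrier is the support of the barycentre of \<open>s\<close>.
\<close>

lemma top_simplex_carrier:
  assumes s: "s \<in> V" "card s = Suc n"
  obtains t p where "t \<in> KY" "card t = Suc n" "p \<in> convex hull s" "support p = t"
    "\<And>L. is_complex L \<Longrightarrow> convex hull s \<subseteq> realization L \<longleftrightarrow> t \<in> L"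
proof -
  have fin: "finite s" using geometricD(3)[OF V s(1)] .
  have ne: "s \<noteq> {}" using s(2) by auto
  note b = weights_barycenter[OF fin ne] barycenter_pos[OF fin]
  define p where "p = point_at s (barycenter s)"
  have p: "p \<in> convex hull s" using mem_hull_iff[OF fin] b(1) by (auto simp: p_def)
  have std: "weights UNIV (($) y)" if "y \<in> s" for y
    using std_V simplex_subset_body[OF s(1)] that by blast
  have "p \<in> realization KY" using p s(1) body_V by (auto simp: body_def)
  then have t: "support p \<in> KY" using mem_realization_iff[OF complex_KY] by blast
  have "Suc n \<le> card (support p)"
    using card_simplex_support[OF geometricD(5)[OF V s(1)] std b] s(2) by (simp add: p_def)
  then have "card (support p) = Suc n" using dim_KY[OF t] by simp
  moreover have "convex hull s \<subseteq> realization L \<longleftrightarrow> support p \<in> L" if L: "is_complex L" for L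
  proof
    assume "convex hull s \<subseteq> realization L"
    then show "support p \<in> L" using p mem_realization_iff[OF L] by blast
  next
    assume "support p \<in> L"
    then show "convex hull s \<subseteq> realization L"
      using hull_in_realization[OF fin std b L] by (simp add: p_def)
  qed
  ultimately show ?thesis using that t p by blast
qed

definition unfoldings :: "'v set set \<Rightarrow> (real ^ 'v) set \<Rightarrow> 'v option set" where
  "unfoldings \<gamma> s = {i\<in>parts. s \<in> restrict_to V (part i) \<and> unfold_part i ` (convex hull s) \<subseteq> realization \<gamma>}"

text \<open>
  An \<open>n\<close>-simplex away from \<open>x\<close> is unfolded once, as part of \<open>K\<close>. One through \<open>x\<close> lies over an
  \<open>(n-1)\<close>-face of \<open>A\<close>, which omits two vertices \<open>a\<close> and \<open>b\<close>, and is unfolded onto the facets \<open>A - {a}\<close> and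
  \<open>A - {b}\<close>. It belongs to the subdivided sphere if and only if exactly one of these facets is in \<open>\<gamma>\<close>.
\<close>

lemma odd_unfoldings_iff:
  assumes \<gamma>: "subcomplex \<gamma> K" and sph: "pl_sphere n (realization \<gamma>)" and ne: "facets \<gamma> \<noteq> {}"
    and s: "s \<in> V" "card s = Suc n"
  shows "odd (card (unfoldings \<gamma> s)) \<longleftrightarrow> convex hull s \<subseteq> realization (exchanged \<gamma>)"
proof -
  have c\<gamma>: "is_complex \<gamma>" and sub: "\<gamma> \<subseteq> K" using \<gamma> by (auto simp: subcomplex_def)
  obtain t p where t: "t \<in> KY" "card t = Suc n" and p: "p \<in> convex hull s" "support p = t"
    and tL: "\<And>L. is_complex L \<Longrightarrow> convex hull s \<subseteq> realization L \<longleftrightarrow> t \<in> L"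
    using top_simplex_carrier[OF s] by blast
  have part: "s \<in> restrict_to V (part i) \<longleftrightarrow> t \<in> part i" if "i \<in> parts" for i
    using tL[OF complex_part[OF that]] s(1) by (simp add: restrict_to_def)
  have small: "card r \<le> n" if "r \<subset> A - {a}" "a \<in> A" for r a
    using psubset_card_mono[OF _ that(1)] card_facet[OF that(2)] by simp
  show ?thesis
  proof (cases "x \<in> t")
    case False
    then have tc: "t \<in> common_part" using t(1) mem_KY by blast
    have "unfoldings \<gamma> s = (if t \<in> \<gamma> then {None} else {})"
    proof -
      have "i \<in> unfoldings \<gamma> s \<longleftrightarrow> i = None \<and> t \<in> \<gamma>" for i
      proof (cases i)
        case None
        have N: "None \<in> parts" by (simp add: parts_def)
        have "t \<in> part None" using tc by (simp add: part_def)
        moreover have "unfold_part None ` (convex hull s) = convex hull s" by (simp add: unfold_part_def)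
        ultimately show ?thesis unfolding None unfoldings_def using part[OF N] tL[OF c\<gamma>] N by simp
      next
        case (Some a)
        have "t \<notin> part (Some a)" if a: "a \<in> A"
        proof
          assume "t \<in> part (Some a)"
          then have "t \<subset> A - {a}" using False unfolding mem_cone[OF a] by blast
          then have "card t \<le> n" by (rule small[OF _ a])
          then show False using t(2) by simp
        qed
        then show ?thesis unfolding Some unfoldings_def using part[of "Some a"] by (auto simp: parts_def)
      qed
      then show ?thesis by auto
    qed
    moreover have "t \<in> exchanged \<gamma> \<longleftrightarrow> t \<in> \<gamma>"
    proof
      assume "t \<in> exchanged \<gamma>"
      then show "t \<in> \<gamma>" using False by (auto simp: exchanged_def stellar_def)
    next
      assume t\<gamma>: "t \<in> \<gamma>"
      have "\<not> A - facets \<gamma> \<subseteq> t"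
      proof
        assume "A - facets \<gamma> \<subseteq> t"
        then have "t \<subseteq> A" by (rule facet_star_in_sphere[OF \<gamma> sph ne t\<gamma>])
        then show False using tc t(2) by (simp add: common_part_def)
      qed
      then show "t \<in> exchanged \<gamma>" using t\<gamma> by (simp add: exchanged_def stellar_def)
    qed
    ultimately show ?thesis using tL[OF complex_exchanged[OF c\<gamma>]] by simp
  next
    case True
    then have tc: "t \<notin> common_part" using common_part_subset new by blast
    then obtain r where r: "t = insert x r" "r \<subseteq> A" using t(1) mem_KY by blast
    have xr: "x \<notin> r" using r(2) x_notin_A by blast
    have cr: "card r = n" using t(2) r(1) xr by simp
    have "card (A - r) = 2" using r(2) cr cardA by (simp add: card_Diff_subset)
    \<comment> \<open>The facets \<open>A - {a}\<close> and \<open>A - {b}\<close> are those whose cones contain the simplex.\<close>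
    then obtain a b where ab: "A - r = {a, b}" "a \<noteq> b" by (auto simp: card_2_iff)
    have abA: "a \<in> A" "b \<in> A" "a \<notin> r" "b \<notin> r" using ab by auto
    have req: "r = A - {a, b}" using ab r(2) by auto
    have "unfoldings \<gamma> s = Some ` ({a, b} \<inter> facets \<gamma>)"
    proof -
      have "i \<in> unfoldings \<gamma> s \<longleftrightarrow> i \<in> Some ` ({a, b} \<inter> facets \<gamma>)" for i
      proof (cases i)
        case None
        have "None \<in> parts" "t \<notin> part None" using tc by (auto simp: parts_def part_def)
        then show ?thesis unfolding None unfoldings_def using part by auto
      next
        case (Some c)
        show ?thesis
        proof (cases "c \<in> A")
          case cA: True
          have cp: "Some c \<in> parts" using cA by (simp add: parts_def)
          have tp: "t \<in> part (Some c) \<longleftrightarrow> c \<in> {a, b}"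
          proof
            assume "t \<in> part (Some c)"
            then obtain r' where r': "t = insert x r'" "r' \<subset> A - {c}"
              using True x_notin_A unfolding mem_cone[OF cA] by blast
            have "x \<notin> r'" using r'(2) x_notin_A by blast
            then have "r' = r" using r'(1) r(1) insert_ident[OF xr] by metis
            then show "c \<in> {a, b}" using r'(2) cA req by blast
          next
            assume "c \<in> {a, b}"
            then have "r \<subseteq> A - {c}" using r(2) abA by blast
            moreover have "r \<noteq> A - {c}" using card_facet[OF cA] cr by auto
            ultimately have "r \<subset> A - {c}" by blast
            then show "t \<in> part (Some c)" unfolding mem_cone[OF cA] r(1) by blast
          qed
          have img: "unfold_part (Some c) ` (convex hull s) \<subseteq> realization \<gamma> \<longleftrightarrow> A - {c} \<in> \<gamma>"
            if "s \<in> restrict_to V (part (Some c))"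
          proof
            have hs: "convex hull s \<subseteq> realization (part (Some c))" using that by (simp add: restrict_to_def)
            assume im: "unfold_part (Some c) ` (convex hull s) \<subseteq> realization \<gamma>"
            have "p $ x \<noteq> 0" using p(2) True by (auto simp: support_def)
            then have "support (unfold_part (Some c) p) = A - {c}"
              using unfold_part_interior[OF cp subsetD[OF hs p(1)]] by blast
            moreover have "unfold_part (Some c) p \<in> realization \<gamma>" using im p(1) by blast
            ultimately show "A - {c} \<in> \<gamma>" using mem_realization_iff[OF c\<gamma>] by metis
          next
            have hs: "convex hull s \<subseteq> realization (part (Some c))" using that by (simp add: restrict_to_def)
            assume Ac: "A - {c} \<in> \<gamma>"
            show "unfold_part (Some c) ` (convex hull s) \<subseteq> realization \<gamma>"
            proof (rule image_subsetI)
              fix q assume "q \<in> convex hull s"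
              then have "unfold_part (Some c) q \<in> unfold_part (Some c) ` realization (part (Some c))" using hs by blast
              also have "\<dots> = realization (full_simplex (A - {c}))"
                using star_map_bij(2)[OF full_simplex_complex x_notin_full facet_in_full[OF cA]]
                by (simp add: part_def unfold_part_def)
              finally have "weights UNIV (($) (unfold_part (Some c) q))"
                "support (unfold_part (Some c) q) \<in> full_simplex (A - {c})"
                unfolding mem_realization_iff[OF full_simplex_complex] by auto
              then show "unfold_part (Some c) q \<in> realization \<gamma>"
                unfolding mem_realization_iff[OF c\<gamma>] using is_complexD(1)[OF c\<gamma> Ac]
                by (auto simp: full_simplex_def)
            qed
          qed
          have "i \<in> unfoldings \<gamma> s \<longleftrightarrow> c \<in> {a, b} \<and> A - {c} \<in> \<gamma>"
            unfolding Some unfoldings_def using cp part[OF cp] tp img by blast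
          then show ?thesis using cA Some by (auto simp: facets_def)
        next
          case False
          then show ?thesis using Some by (auto simp: unfoldings_def parts_def facets_def)
        qed
      qed
      then show ?thesis by blast
    qed
    then have "card (unfoldings \<gamma> s) = card ({a, b} \<inter> facets \<gamma>)" by (simp add: card_image)
    moreover have "t \<in> exchanged \<gamma> \<longleftrightarrow> \<not> A - facets \<gamma> \<subseteq> r \<and> r \<union> (A - facets \<gamma>) \<in> \<gamma>"
    proof
      assume "t \<in> exchanged \<gamma>"
      moreover have "t \<notin> \<gamma>" using True sub new by blast
      ultimately obtain r' where r': "t = insert x r'" "\<not> A - facets \<gamma> \<subseteq> r'" "r' \<union> (A - facets \<gamma>) \<in> \<gamma>"
        by (auto simp: exchanged_def stellar_def)
      have "x \<notin> r'" using r'(3) sub new by blast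
      then have "r' = r" using r'(1) r(1) insert_ident[OF xr] by metis
      then show "\<not> A - facets \<gamma> \<subseteq> r \<and> r \<union> (A - facets \<gamma>) \<in> \<gamma>" using r' by blast
    next
      assume "\<not> A - facets \<gamma> \<subseteq> r \<and> r \<union> (A - facets \<gamma>) \<in> \<gamma>"
      then show "t \<in> exchanged \<gamma>" unfolding exchanged_def stellar_def r(1) by blast
    qed
    moreover have "odd (card ({a, b} \<inter> facets \<gamma>)) \<longleftrightarrow> \<not> A - facets \<gamma> \<subseteq> r \<and> r \<union> (A - facets \<gamma>) \<in> \<gamma>"
    proof -
      have one: "odd (card ({a, b} \<inter> facets \<gamma>)) \<and> \<not> A - facets \<gamma> \<subseteq> r \<and> r \<union> (A - facets \<gamma>) \<in> \<gamma>"
        if "a \<in> facets \<gamma>" "b \<notin> facets \<gamma>" "{a, b} = A - r" "a \<noteq> b" for a b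
      proof -
        have "{a, b} \<inter> facets \<gamma> = {a}" using that by blast
        moreover have "r \<union> (A - facets \<gamma>) = A - {a}" using that r(2) by blast
        moreover have "b \<in> A - facets \<gamma>" "b \<notin> r" using that by blast+
        ultimately show ?thesis using that(1) by (auto simp: facets_def)
      qed
      consider "a \<in> facets \<gamma>" "b \<in> facets \<gamma>" | "a \<notin> facets \<gamma>" "b \<notin> facets \<gamma>"
        | "a \<in> facets \<gamma>" "b \<notin> facets \<gamma>" | "b \<in> facets \<gamma>" "a \<notin> facets \<gamma>" by blast
      then show ?thesis
      proof cases
        case 1
        then have "{a, b} \<inter> facets \<gamma> = {a, b}" "A - facets \<gamma> \<subseteq> r" using req by blast+
        then show ?thesis using ab(2) by simp
      next
        case 2
        then have "{a, b} \<inter> facets \<gamma> = {}" "r \<union> (A - facets \<gamma>) = A" using req abA by blast+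
        moreover have "A \<notin> \<gamma>" using A_notin_K sub by blast
        ultimately show ?thesis by simp
      next
        case 3
        then show ?thesis using one[OF 3] ab by simp
      next
        case 4
        then show ?thesis using one[OF 4] ab by (simp add: insert_commute)
      qed
    qed
    ultimately show ?thesis using tL[OF complex_exchanged[OF c\<gamma>]] by simp
  qed
qed

end

section \<open>Transfer of the linking number\<close>

context triangulated_Y
begin

text \<open>
  A top-dimensional simplex of the transported triangulation determines the part from which it
  comes, since it cannot consist of fixed vertices if the part is a cone.
\<close>

lemma sum_over_unfolded:
  fixes g :: "(real ^ 'v) set \<Rightarrow> nat"
  shows "(\<Sum>\<sigma>\<in>{\<sigma>\<in>restrict_to V' \<gamma>. card \<sigma> = Suc n}. g (fold_back ` \<sigma>)) =
    (\<Sum>s\<in>{s\<in>V. card s = Suc n}. card (unfoldings \<gamma> s) * g s)"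
proof -
  let ?C = "{\<sigma>\<in>restrict_to V' \<gamma>. card \<sigma> = Suc n}" and ?Vn = "{s\<in>V. card s = Suc n}"
  define D where "D = Sigma ?Vn (\<lambda>s. unfoldings \<gamma> s)"
  \<comment> \<open>A simplex of \<open>V\<close> together with a part that contains it.\<close>
  define \<phi> where "\<phi> = (\<lambda>(s, i). unfold_part i ` s)"
  have finp: "finite parts" by (simp add: parts_def)
  have finVn: "finite ?Vn" using geometricD(2)[OF V] by simp
  have finU: "finite (unfoldings \<gamma> s)" for s by (rule finite_subset[OF _ finp]) (auto simp: unfoldings_def)
  have Dmem: "s \<in> V" "card s = Suc n" "i \<in> parts" "convex hull s \<subseteq> realization (part i)"
    "unfold_part i ` (convex hull s) \<subseteq> realization \<gamma>" if "(s, i) \<in> D" for s i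
    using that by (auto simp: D_def unfoldings_def restrict_to_def)
  have hull: "convex hull (unfold_part i ` s) = unfold_part i ` (convex hull s)" for i s
    by (rule convex_hull_linear_image[OF linear_unfold_part, symmetric])
  have refold: "fold_back ` unfold_part i ` s = s"
    if pi: "i \<in> parts" "convex hull s \<subseteq> realization (part i)" for i s
  proof -
    have "fold_back (unfold_part i v) = v" if "v \<in> s" for v
      using fold_back_unfold[OF pi(1) subsetD[OF pi(2) hull_inc[OF that]]] .
    then show ?thesis by (simp add: image_image)
  qed
  have cardu: "card (unfold_part i ` s) = card s" if "i \<in> parts" "convex hull s \<subseteq> realization (part i)" for i s
  proof -
    have "s \<subseteq> realization (part i)" using hull_subset[of s convex] that(2) by blast
    then show ?thesis using inj_on_subset[OF restrict_part(3)[OF that(1)]] card_image by blast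
  qed
  have "\<phi> ` D = ?C"
  proof
    show "\<phi> ` D \<subseteq> ?C"
    proof clarify
      fix s i assume si: "(s, i) \<in> D"
      note m = Dmem[OF si]
      have "unfold_part i ` s \<in> V'" using m by (auto simp: V'_def restrict_to_def)
      then show "\<phi> (s, i) \<in> restrict_to V' \<gamma> \<and> card (\<phi> (s, i)) = Suc n"
        using m(2,5) cardu[OF m(3,4)] hull by (simp add: \<phi>_def restrict_to_def)
    qed
    show "?C \<subseteq> \<phi> ` D"
    proof clarify
      fix \<sigma> assume \<sigma>: "\<sigma> \<in> restrict_to V' \<gamma>" "card \<sigma> = Suc n"
      then have \<sigma>V: "\<sigma> \<in> V'" "convex hull \<sigma> \<subseteq> realization \<gamma>" by (auto simp: restrict_to_def)
      obtain i s where si: "i \<in> parts" "s \<in> V" "convex hull s \<subseteq> realization (part i)" "\<sigma> = unfold_part i ` s"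
        "finite s" "convex hull \<sigma> = unfold_part i ` (convex hull s)" using mem_V'E[OF \<sigma>V(1)] .
      have "card s = Suc n" using cardu[OF si(1,3)] \<sigma>(2) si(4) by simp
      then have "(s, i) \<in> D" using si \<sigma>V(2) by (simp add: D_def unfoldings_def restrict_to_def)
      then show "\<sigma> \<in> \<phi> ` D" using si(4) by (force simp: \<phi>_def)
    qed
  qed
  moreover have "inj_on \<phi> D"
  proof (rule inj_onI)
    fix d e assume d: "d \<in> D" and e: "e \<in> D" and eq: "\<phi> d = \<phi> e"
    obtain s i t j where de: "d = (s, i)" "e = (t, j)" by (cases d; cases e)
    note m = Dmem[OF d[unfolded de]] and k = Dmem[OF e[unfolded de]]
    have im: "unfold_part i ` s = unfold_part j ` t" using eq de by (simp add: \<phi>_def)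
    have st: "s = t" using refold[OF m(3,4)] refold[OF k(3,4)] im by simp
    have "i = j"
    proof (rule ccontr)
      assume ij: "i \<noteq> j"
      have x0: "v $ x = 0" if v: "v \<in> s" for v
      proof (rule ccontr)
        assume nz: "v $ x \<noteq> 0"
        obtain w where w: "w \<in> t" "unfold_part i v = unfold_part j w" using im v by blast
        have "v \<in> realization (part i)" "w \<in> realization (part j)"
          using subsetD[OF m(4) hull_inc[OF v]] subsetD[OF k(4) hull_inc[OF w(1)]] by auto
        then show False using unfold_part_eq(2)[OF m(3) _ k(3) _ w(2) nz] ij by blast
      qed
      obtain t' p where t': "t' \<in> KY" "card t' = Suc n" "p \<in> convex hull s" "support p = t'"
        and tL: "\<And>L. is_complex L \<Longrightarrow> convex hull s \<subseteq> realization L \<longleftrightarrow> t' \<in> L"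
        using top_simplex_carrier[OF m(1,2)] by blast
      have "x \<notin> t'"
      proof -
        obtain u where "p = point_at s u" using t'(3) mem_hull_iff geometricD(3)[OF V m(1)] by blast
        then have "p $ x = 0" using x0 by (simp add: wsum_def)
        then show ?thesis using t'(4) by (auto simp: support_def)
      qed
      have no: "l = None" if l: "l \<in> parts" "convex hull s \<subseteq> realization (part l)" for l
      proof (cases l)
        case (Some a)
        then have a: "a \<in> A" using l(1) by (auto simp: parts_def)
        have "t' \<in> part (Some a)" using tL[OF complex_part[OF l(1)]] l(2) Some by simp
        then have "t' \<subset> A - {a}" using \<open>x \<notin> t'\<close> unfolding mem_cone[OF a] by blast
        then have "card t' < card (A - {a})" by (intro psubset_card_mono) auto
        then show ?thesis using card_facet[OF a] t'(2) by simp
      qed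
      show False using no[OF m(3,4)] no[OF k(3)] k(4) st ij by simp
    qed
    then show "d = e" using de st by simp
  qed
  ultimately have "(\<Sum>\<sigma>\<in>?C. g (fold_back ` \<sigma>)) = (\<Sum>d\<in>D. g (fold_back ` \<phi> d))"
    using sum.reindex[of \<phi> D "\<lambda>\<sigma>. g (fold_back ` \<sigma>)"] by (simp add: o_def)
  also have "\<dots> = (\<Sum>d\<in>D. case d of (s, i) \<Rightarrow> g s)"
  proof (rule sum.cong[OF refl])
    fix d assume d: "d \<in> D"
    obtain s i where si: "d = (s, i)" by (cases d)
    show "g (fold_back ` \<phi> d) = (case d of (s, i) \<Rightarrow> g s)"
      using refold[OF Dmem(3,4)[OF d[unfolded si]]] si by (simp add: \<phi>_def)
  qed
  also have "\<dots> = (\<Sum>s\<in>?Vn. \<Sum>i\<in>unfoldings \<gamma> s. g s)"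
    unfolding D_def by (rule sum.Sigma[symmetric]) (use finVn finU in auto)
  finally show ?thesis by simp
qed

text \<open>
  Modulo 2, folding the chain of \<open>\<gamma>\<close> back into \<open>K\<^sub>Y\<close> gives the chain of the exchanged sphere.
\<close>

lemma even_unfolded_exchanged:
  fixes g :: "(real ^ 'v) set \<Rightarrow> nat"
  assumes \<gamma>: "subcomplex \<gamma> K" and sph: "pl_sphere n (realization \<gamma>)" and ne: "facets \<gamma> \<noteq> {}"
  shows "even ((\<Sum>\<sigma>\<in>{\<sigma>\<in>restrict_to V' \<gamma>. card \<sigma> = Suc n}. g (fold_back ` \<sigma>)) +
    (\<Sum>s\<in>{s\<in>restrict_to V (exchanged \<gamma>). card s = Suc n}. g s))"
proof -
  let ?Vn = "{s\<in>V. card s = Suc n}"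
  have finVn: "finite ?Vn" using geometricD(2)[OF V] by simp
  have "(\<Sum>s\<in>{s\<in>restrict_to V (exchanged \<gamma>). card s = Suc n}. g s) =
      (\<Sum>s\<in>?Vn. if convex hull s \<subseteq> realization (exchanged \<gamma>) then g s else 0)"
    by (subst sum.inter_filter[OF finVn, symmetric]) (rule sum.cong, auto simp: restrict_to_def)
  moreover have "even (\<Sum>s\<in>?Vn. card (unfoldings \<gamma> s) * g s +
      (if convex hull s \<subseteq> realization (exchanged \<gamma>) then g s else 0))"
  proof (rule dvd_sum)
    fix s assume "s \<in> ?Vn"
    then have "odd (card (unfoldings \<gamma> s)) \<longleftrightarrow> convex hull s \<subseteq> realization (exchanged \<gamma>)"
      using odd_unfoldings_iff[OF assms] by blast
    then show "even (card (unfoldings \<gamma> s) * g s + (if convex hull s \<subseteq> realization (exchanged \<gamma>) then g s else 0))"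
      by auto
  qed
  ultimately show ?thesis unfolding sum_over_unfolded by (simp add: sum.distrib)
qed

end

context perturbed_Y
begin

lemma inj': "inj_on f' (body V')"
  using embeds_imp_inj_on_body[OF geometric_V' aff' embeds'] .

lemma pl_embedding': "pl_embedding (realization K) f'"
  unfolding pl_embedding_def pl_map_on_iff_geometric
  using geometric_V' body_V' aff' inj' by auto

lemma unchanged_on_common_part:
  assumes p: "p \<in> realization common_part" shows "f' p = f p"
proof -
  have N: "None \<in> parts" by (simp add: parts_def)
  have part: "part None = common_part" by (simp add: part_def)
  have "p \<in> body (restrict_to V common_part)" using restrict_part(2)[OF N] p part by simp
  then obtain s u where s: "s \<in> restrict_to V common_part" "weights s u" "p = point_at s u"
    using body_iff[OF geometric_restrict_to[OF V]] by blast
  have sV: "s \<in> V" "convex hull s \<subseteq> realization (part None)" using s(1) part by (auto simp: restrict_to_def)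
  have "unfold_part None ` s \<in> V'" unfolding V'_def by (rule UN_I[OF N imageI]) (simp add: part s(1))
  then have sV': "s \<in> V'" by (simp add: unfold_part_def)
  have "f' v = f v" if v: "v \<in> s" for v
  proof -
    have fb: "fold_back v = v" using fold_back_simplex[OF N sV(2) v] by (simp add: unfold_part_def)
    have "v \<in> realization common_part" using subsetD[OF sV(2) hull_inc[OF v]] part by simp
    then have "support v \<in> common_part" using mem_realization_iff[OF complex_common_part] by blast
    then have "v $ x = 0" using common_part_subset new by (auto simp: support_def)
    then have "v \<in> \<Union>V' - moved" using sV' v fb by (auto simp: moved_def)
    then show ?thesis using unmoved fb by (simp add: target_def)
  qed
  then have "wsum s u f' = wsum s u f" unfolding wsum_def by simp
  then show ?thesis
    using affine_on_simplexD[OF aff'[OF sV'] s(2)] affine_on_simplexD[OF aff[OF sV(1)] s(2)] s(3) by simp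
qed

text \<open>
  The hull lies in the \<open>\<delta>\<close>-neighbourhood of the convex set \<open>f ` (convex hull s)\<close>, where \<open>s\<close> is a simplex
  of a cone over the boundary of a facet of \<open>\<gamma>\<close>, and \<open>\<gamma>'\<close> is disjoint from this facet.
\<close>

lemma moved_simplex_far_from_sphere:
  assumes \<gamma>: "subcomplex \<gamma> K" "subcomplex \<gamma>' K" "\<gamma> \<inter> \<gamma>' = {}"
    and \<sigma>: "\<sigma> \<in> restrict_to V' \<gamma>" "\<sigma> \<inter> moved \<noteq> {}" and common: "\<gamma>' \<subseteq> common_part"
  shows "convex hull (target ` \<sigma> \<union> f' ` \<sigma>) \<inter> f ` realization \<gamma>' = {}"
proof -
  have c\<gamma>: "is_complex \<gamma>" "is_complex \<gamma>'" using \<gamma> by (auto simp: subcomplex_def)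
  have \<sigma>V: "\<sigma> \<in> V'" "convex hull \<sigma> \<subseteq> realization \<gamma>" using \<sigma> by (auto simp: restrict_to_def)
  obtain i s where si: "i \<in> parts" "s \<in> V" "convex hull s \<subseteq> realization (part i)" "\<sigma> = unfold_part i ` s"
    "finite s" "convex hull \<sigma> = unfold_part i ` (convex hull s)" using mem_V'E[OF \<sigma>V(1)] .
  obtain w where w: "w \<in> \<sigma>" "fold_back w $ x \<noteq> 0" using \<sigma>(2) by (auto simp: moved_def)
  obtain v where v: "v \<in> s" "w = unfold_part i v" using w(1) si(4) by blast
  have vi: "v \<in> realization (part i)" using subsetD[OF si(3) hull_inc[OF v(1)]] .
  have "v $ x \<noteq> 0" using w(2) v fold_back_simplex[OF si(1,3) v(1)] by simp
  then obtain a where a: "i = Some a" "a \<in> A" "support w = A - {a}"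
    using unfold_part_interior[OF si(1) vi] v(2) by metis
  have "w \<in> realization \<gamma>" using subsetD[OF \<sigma>V(2) hull_inc[OF w(1)]] .
  then have Aa: "A - {a} \<in> \<gamma>" using a(3) mem_realization_iff[OF c\<gamma>(1)] by metis
  have "\<gamma>' \<subseteq> far a"
  proof
    fix r assume r: "r \<in> \<gamma>'"
    have "r \<inter> (A - {a}) = {}"
    proof (rule ccontr)
      assume "r \<inter> (A - {a}) \<noteq> {}"
      then have "r \<inter> (A - {a}) \<in> \<gamma>" "r \<inter> (A - {a}) \<in> \<gamma>'"
        using is_complexD(1)[OF c\<gamma>(1) Aa Int_lower2] is_complexD(1)[OF c\<gamma>(2) r Int_lower1] by auto
      then show False using \<gamma>(3) by blast
    qed
    then show "r \<in> far a" using r common by (auto simp: far_def)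
  qed
  then have sub: "realization \<gamma>' \<subseteq> realization (far a)" by (auto simp: realization_def)
  have refold: "fold_back ` \<sigma> = s"
    unfolding si(4) using fold_back_simplex[OF si(1,3)] by (simp add: image_image)
  have tg: "target ` \<sigma> = f ` s" unfolding refold[symmetric] by (auto simp: target_def)
  \<comment> \<open>The \<open>\<delta>\<close>-neighbourhood of a convex set is convex.\<close>
  let ?N = "\<Union>y\<in>convex hull (f ` s). \<Union>z\<in>ball 0 \<delta>. {y + z}"
  have "target ` \<sigma> \<union> f' ` \<sigma> \<subseteq> ?N"
  proof
    fix y assume "y \<in> target ` \<sigma> \<union> f' ` \<sigma>"
    then obtain u where u: "u \<in> \<sigma>" "y = target u \<or> y = f' u" by blast
    have uV: "u \<in> \<Union>V'" using u(1) \<sigma>V(1) by blast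
    have "norm (y - target u) < \<delta>"
      using u(2) near[OF uV] by (auto intro: le_less_trans[OF norm_ge_zero])
    moreover have "target u \<in> convex hull (f ` s)" using u(1) tg hull_subset[of "f ` s" convex] by blast
    ultimately show "y \<in> ?N" by (intro UN_I[of "target u"] UN_I[of "y - target u"]) auto
  qed
  moreover have "convex ?N" by (rule convex_sums[OF convex_convex_hull convex_ball])
  ultimately have hull: "convex hull (target ` \<sigma> \<union> f' ` \<sigma>) \<subseteq> ?N" by (rule hull_minimal)
  show ?thesis
  proof (rule ccontr)
    assume "convex hull (target ` \<sigma> \<union> f' ` \<sigma>) \<inter> f ` realization \<gamma>' \<noteq> {}"
    then obtain q where q: "q \<in> convex hull (target ` \<sigma> \<union> f' ` \<sigma>)" "q \<in> f ` realization \<gamma>'" by blast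
    then obtain y z where yz: "q = y + z" "y \<in> convex hull (f ` s)" "norm z < \<delta>" using hull by auto
    have "y \<in> f ` (convex hull s)" using affine_on_simplex_image[OF aff[OF si(2)] si(5)] yz(2) by simp
    then have "y \<in> f ` realization (part (Some a))" using si(3) a(1) by blast
    moreover have "q \<in> f ` realization (far a)" using q(2) sub by blast
    ultimately have "\<delta> \<le> dist y q" using gap[OF a(2)] by blast
    then show False using yz by (simp add: dist_norm)
  qed
qed

text \<open>
  For generic \<open>v\<close>, the preimages for \<open>f' \<gamma>\<close> are counted by the simplices of \<open>\<gamma>\<close>; the parity is unchanged when the
  moved vertices return to their targets, and by folding the count becomes that for the exchanged sphere. If the latter
  were empty, the count would be 0 and not odd.
\<close>

lemma exchange_preserves_link:
  assumes \<gamma>: "subcomplex \<gamma> K" "subcomplex \<gamma>' K" and disj: "realization \<gamma> \<inter> realization \<gamma>' = {}"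
    and sph: "pl_sphere n (realization \<gamma>)" "pl_sphere n (realization \<gamma>')" and ne: "facets \<gamma> \<noteq> {}"
    and lk: "lk2 (f' ` realization \<gamma>) (f' ` realization \<gamma>') = 1"
  shows "{exchanged \<gamma>, \<gamma>'} \<in> sphere_pairs n KY"
    "lk2 (f ` realization (exchanged \<gamma>)) (f ` realization \<gamma>') = 1"
proof -
  have c\<gamma>: "is_complex \<gamma>" "is_complex \<gamma>'" and sub: "\<gamma> \<subseteq> K" "\<gamma>' \<subseteq> K" using \<gamma> by (auto simp: subcomplex_def)
  have disj': "\<gamma> \<inter> \<gamma>' = {}" using disj realization_Int_empty[OF c\<gamma>] by blast
  have common: "\<gamma>' \<subseteq> common_part" by (rule disjoint_sphere_in_common_part[OF \<gamma> disj' ne])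
  have \<gamma>'KY: "\<gamma>' \<subseteq> KY" using common mem_KY by blast
  note cE = complex_exchanged[OF c\<gamma>(1)] and EKY = exchanged_subset_KY[OF \<gamma>(1) sph(1) ne]
  have dimd: "DIM(real ^ 'd) = 2 * n + 1" using dim by simp
  let ?U = "restrict_to V' \<gamma>" and ?W = "restrict_to V \<gamma>'" and ?Q = "restrict_to V (exchanged \<gamma>)"
  let ?C = "{\<sigma>\<in>?U. card \<sigma> = Suc n}" and ?Z = "{\<tau>\<in>?W. card \<tau> = Suc n}"
  note gU = geometric_restrict_to[OF geometric_V', of \<gamma>]
    and gW = geometric_restrict_to[OF V, of \<gamma>'] and gQ = geometric_restrict_to[OF V, of "exchanged \<gamma>"]
  have bU: "body ?U = realization \<gamma>" by (rule body_restrict'[OF c\<gamma>(1) sub(1)])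
  have bW: "body ?W = realization \<gamma>'" by (rule body_restrict[OF c\<gamma>(2) \<gamma>'KY])
  have bQ: "body ?Q = realization (exchanged \<gamma>)" by (rule body_restrict[OF cE EKY])
  have UV: "?U \<subseteq> V'" and WV: "?W \<subseteq> V" and QV: "?Q \<subseteq> V" by (auto simp: restrict_to_def)
  have bsub: "body X \<subseteq> body Y" if "X \<subseteq> Y" for X Y :: "(real ^ 'v) set set" using that by (auto simp: body_def)
  have affU: "affine_on_simplex s f'" "card s \<le> Suc n" if "s \<in> ?U" for s using aff' card_V' UV that by auto
  have affW: "affine_on_simplex s f" "card s \<le> Suc n" if "s \<in> ?W" for s using aff card_V WV that by auto
  have affQ: "affine_on_simplex s f" "card s \<le> Suc n" if "s \<in> ?Q" for s using aff card_V QV that by auto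
  have injU: "inj_on f' (body ?U)" using inj_on_subset[OF inj' bsub[OF UV]] .
  have injW: "inj_on f (body ?W)" using inj_on_subset[OF inj bsub[OF WV]] .
  have injQ: "inj_on f (body ?Q)" using inj_on_subset[OF inj bsub[OF QV]] .
  define E where "E = f' ` \<Union>V' \<union> target ` \<Union>V' \<union> f ` \<Union>V"
  have finE: "finite E" using finite_vertices by (simp add: E_def)
  have EU: "f' ` \<Union>?U \<subseteq> E" and EW: "f ` \<Union>?W \<subseteq> E" and EQ: "f ` \<Union>?Q \<subseteq> E"
    using image_mono[OF Union_mono[OF UV], of f'] image_mono[OF Union_mono[OF WV], of f]
      image_mono[OF Union_mono[OF QV], of f] unfolding E_def by blast+
  have fU: "f' ` realization \<gamma>' = f ` realization \<gamma>'"
  proof (rule image_cong[OF refl])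
    fix p assume "p \<in> realization \<gamma>'"
    then have "p \<in> realization common_part" using common by (auto simp: realization_def)
    then show "f' p = f p" by (rule unchanged_on_common_part)
  qed
  have cycle: "mod2_cycle n ?Z"
    by (rule mod2_cycle_sphere[OF gW _ n affW(2)]) (use sph(2) bW in simp_all)
  have cycleC: "mod2_cycle n ?C"
    by (rule mod2_cycle_sphere[OF gU _ n affU(2)]) (use sph(1) bU in simp_all)
  have injV: "inj_on f (\<Union>V)" using embeds_inj_vertices[OF geometricD(1)[OF V] embeds_f] .
  have injV': "inj_on f' (\<Union>V')" using embeds_inj_vertices[OF geometricD(1)[OF geometric_V'] embeds'] .
  \<comment> \<open>Agrees with the target positions at all vertices, and with \<open>f'\<close> off the moved ones.\<close>
  define \<alpha> where "\<alpha> w = (if w \<in> moved then target w else f' w)" for w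
  have \<alpha>: "\<alpha> w = target w" if "w \<in> \<Union>V'" for w using unmoved[of w] that by (auto simp: \<alpha>_def)
  have \<alpha>im: "\<alpha> ` \<sigma> = target ` \<sigma>" if "\<sigma> \<in> V'" for \<sigma>
    by (rule image_cong[OF refl]) (use \<alpha> that in blast)
  have move: "even ((\<Sum>\<sigma>\<in>?C. chain_count (f' ` \<sigma>) ?Z f v) + (\<Sum>\<sigma>\<in>?C. chain_count (\<alpha> ` \<sigma>) ?Z f v))"
    if gen: "generic_direction E v" for v
  proof (rule chain_count_move_vertices[OF dimd _ _ _ _ _ _ _ cycle _ _ gen])
    show "finite moved" using finite_subset[of moved "\<Union>V'"] finite_vertices(2) by (auto simp: moved_def)
    show "finite ?C" by (rule mod2_cycleD(1)[OF cycleC])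
    show "finite \<sigma> \<and> card \<sigma> = Suc n" if "\<sigma> \<in> ?C" for \<sigma> by (rule mod2_cycleD(2)[OF cycleC that])
    show "even (card {\<sigma>\<in>?C. \<rho> \<subseteq> \<sigma>})" if "finite \<rho>" "card \<rho> = n" for \<rho>
      by (rule mod2_cycleD(3)[OF cycleC that])
    show "\<alpha> w = f' w" if "w \<notin> moved" for w using that by (simp add: \<alpha>_def)
    show "inj_on \<alpha> \<sigma> \<and> inj_on f' \<sigma> \<and> \<alpha> ` \<sigma> \<subseteq> E \<and> f' ` \<sigma> \<subseteq> E" if "\<sigma> \<in> ?C" for \<sigma>
    proof -
      have \<sigma>: "\<sigma> \<in> V'" using that UV by blast
      obtain i s where si: "i \<in> parts" "s \<in> V" "convex hull s \<subseteq> realization (part i)" "\<sigma> = unfold_part i ` s"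
        using mem_V'E[OF \<sigma>] by metis
      have "inj_on \<alpha> \<sigma>"
      proof (rule inj_onI)
        fix y z assume yz: "y \<in> \<sigma>" "z \<in> \<sigma>" "\<alpha> y = \<alpha> z"
        obtain y0 z0 where 0: "y0 \<in> s" "y = unfold_part i y0" "z0 \<in> s" "z = unfold_part i z0" using yz si(4) by blast
        have "\<alpha> y = f y0" "\<alpha> z = f z0"
          using \<alpha>[of y] \<alpha>[of z] yz \<sigma> fold_back_simplex[OF si(1,3) 0(1)] fold_back_simplex[OF si(1,3) 0(3)] 0
          by (auto simp: target_def)
        then have "f y0 = f z0" using yz(3) by simp
        then have "y0 = z0" using inj_onD[OF injV] 0(1,3) si(2) by blast
        then show "y = z" using 0 by simp
      qed
      moreover have "inj_on f' \<sigma>" using inj_on_subset[OF injV'] \<sigma> by blast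
      moreover have "\<alpha> ` \<sigma> \<subseteq> E" unfolding \<alpha>im[OF \<sigma>] E_def using \<sigma> by blast
      moreover have "f' ` \<sigma> \<subseteq> E" unfolding E_def using \<sigma> by blast
      ultimately show ?thesis by blast
    qed
    show "f' y \<noteq> \<alpha> z" if "\<sigma> \<in> ?C" "y \<in> \<sigma> \<inter> moved" "z \<in> \<sigma>" for \<sigma> y z
    proof -
      have z: "z \<in> \<Union>V'" using that UV by blast
      have "f' y \<notin> target ` \<Union>V'" using avoid that(2) by blast
      then show ?thesis using \<alpha>[OF z] z by force
    qed
    show "inj_on f \<tau> \<and> f ` \<tau> \<subseteq> E" if "\<tau> \<in> ?Z" for \<tau>
      using inj_on_subset[OF injV, of \<tau>] that WV unfolding E_def by blast
    show "convex hull (\<alpha> ` \<sigma> \<union> f' ` \<sigma>) \<inter> convex hull (f ` \<tau>) = {}"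
      if "\<sigma> \<in> ?C" "\<sigma> \<inter> moved \<noteq> {}" "\<tau> \<in> ?Z" for \<sigma> \<tau>
    proof -
      have \<sigma>: "\<sigma> \<in> ?U" "\<sigma> \<in> V'" using that(1) UV by auto
      have \<tau>: "\<tau> \<in> V" "convex hull \<tau> \<subseteq> realization \<gamma>'" using that(3) by (auto simp: restrict_to_def)
      have "convex hull (f ` \<tau>) = f ` (convex hull \<tau>)"
        using affine_on_simplex_image[OF aff[OF \<tau>(1)] geometricD(3)[OF V \<tau>(1)]] by simp
      then have "convex hull (f ` \<tau>) \<subseteq> f ` realization \<gamma>'" using \<tau>(2) by blast
      then show ?thesis
        using moved_simplex_far_from_sphere[OF \<gamma> disj' \<sigma>(1) that(2) common] unfolding \<alpha>im[OF \<sigma>(2)] by blast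
    qed
  qed
  have parity: "odd (card (gauss_preimage (f ` realization (exchanged \<gamma>)) (f ` realization \<gamma>') v))"
    if gen: "generic_direction E v" and odd: "odd (card (gauss_preimage (f' ` realization \<gamma>) (f' ` realization \<gamma>') v))" for v
  proof -
    have 1: "card (gauss_preimage (f' ` realization \<gamma>) (f ` realization \<gamma>') v) = (\<Sum>\<sigma>\<in>?C. chain_count (f' ` \<sigma>) ?Z f v)"
      using card_gauss_preimage_image[OF dimd gU affU(1) injU affU(2) gW affW(1) injW affW(2) EU EW gen]
      unfolding bU bW .
    have 2: "card (gauss_preimage (f ` realization (exchanged \<gamma>)) (f ` realization \<gamma>') v) =
        (\<Sum>s\<in>{s\<in>?Q. card s = Suc n}. chain_count (f ` s) ?Z f v)"
      using card_gauss_preimage_image[OF dimd gQ affQ(1) injQ affQ(2) gW affW(1) injW affW(2) EQ EW gen]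
      unfolding bQ bW .
    have 3: "(\<Sum>\<sigma>\<in>?C. chain_count (\<alpha> ` \<sigma>) ?Z f v) = (\<Sum>\<sigma>\<in>?C. chain_count (f ` fold_back ` \<sigma>) ?Z f v)"
    proof (rule sum.cong[OF refl])
      fix \<sigma> assume "\<sigma> \<in> ?C"
      then have "\<alpha> ` \<sigma> = target ` \<sigma>" using \<alpha>im UV by blast
      also have "\<dots> = f ` fold_back ` \<sigma>" by (auto simp: target_def image_image)
      finally show "chain_count (\<alpha> ` \<sigma>) ?Z f v = chain_count (f ` fold_back ` \<sigma>) ?Z f v" by simp
    qed
    have 4: "even ((\<Sum>\<sigma>\<in>?C. chain_count (f ` fold_back ` \<sigma>) ?Z f v) +
        (\<Sum>s\<in>{s\<in>?Q. card s = Suc n}. chain_count (f ` s) ?Z f v))"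
      using even_unfolded_exchanged[OF \<gamma>(1) sph(1) ne, of "\<lambda>s. chain_count (f ` s) ?Z f v"] .
    show ?thesis using odd move[OF gen] 4 unfolding fU 1 2 3[symmetric] by simp
  qed
  have AE: "AE v in lborel. odd (card (gauss_preimage (f ` realization (exchanged \<gamma>)) (f ` realization \<gamma>') v))"
    using AE_generic_direction[OF finE] lk[unfolded lk2_eq_1_iff] by eventually_elim (rule parity)
  then show "lk2 (f ` realization (exchanged \<gamma>)) (f ` realization \<gamma>') = 1" by (simp add: lk2_eq_1_iff)
  have B: "A - facets \<gamma> \<noteq> {}"
  proof
    assume "A - facets \<gamma> = {}"
    then have "realization (exchanged \<gamma>) = {}" using exchanged_full by (simp add: realization_def)
    then have "AE v in (lborel :: (real ^ 'd) measure). False" using AE by (simp add: gauss_preimage_def)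
    then show False using not_AE_lborel_False by blast
  qed
  have "exchanged \<gamma> \<inter> \<gamma>' = {}" by (rule exchanged_disjoint[OF disj' sub(2)])
  then have "realization (exchanged \<gamma>) \<inter> realization \<gamma>' = {}" using realization_Int_empty[OF cE c\<gamma>(2)] by blast
  then show "{exchanged \<gamma>, \<gamma>'} \<in> sphere_pairs n KY"
    using cE c\<gamma>(2) EKY \<gamma>'KY sph(2) pl_sphere_exchanged[OF \<gamma>(1) sph(1) ne B]
    unfolding sphere_pairs_def subcomplex_def by blast
qed

lemma exists_linked_pair:
  assumes pair: "{\<gamma>\<^sub>1, \<gamma>\<^sub>2} \<in> sphere_pairs n K" and lk: "lk2 (f' ` realization \<gamma>\<^sub>1) (f' ` realization \<gamma>\<^sub>2) = 1"
  shows "\<exists>\<gamma> \<gamma>'. {\<gamma>, \<gamma>'} \<in> sphere_pairs n KY \<and> lk2 (f ` realization \<gamma>) (f ` realization \<gamma>') = 1"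
proof -
  have s: "subcomplex \<gamma>\<^sub>1 K" "subcomplex \<gamma>\<^sub>2 K" "realization \<gamma>\<^sub>1 \<inter> realization \<gamma>\<^sub>2 = {}"
    "pl_sphere n (realization \<gamma>\<^sub>1)" "pl_sphere n (realization \<gamma>\<^sub>2)"
    using pair unfolding sphere_pairs_def by (auto simp: doubleton_eq_iff)
  consider "facets \<gamma>\<^sub>1 \<noteq> {}" | "facets \<gamma>\<^sub>2 \<noteq> {}" | "facets \<gamma>\<^sub>1 = {}" "facets \<gamma>\<^sub>2 = {}" by blast
  then show ?thesis
  proof cases
    case 1
    then show ?thesis using exchange_preserves_link[OF s 1 lk] by blast
  next
    case 2
    have "realization \<gamma>\<^sub>2 \<inter> realization \<gamma>\<^sub>1 = {}" using s(3) by blast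
    moreover have "lk2 (f' ` realization \<gamma>\<^sub>2) (f' ` realization \<gamma>\<^sub>1) = 1" using lk lk2_commute by metis
    ultimately show ?thesis using exchange_preserves_link[OF s(2,1) _ s(5,4) 2] by blast
  next
    case 3
    have common: "\<gamma> \<subseteq> common_part" if \<gamma>: "subcomplex \<gamma> K" "facets \<gamma> = {}" for \<gamma>
    proof
      fix r assume r: "r \<in> \<gamma>"
      have "\<not> (r \<subseteq> A \<and> card r = Suc n)"
      proof
        assume "r \<subseteq> A \<and> card r = Suc n"
        then obtain a where "a \<in> A" "r = A - {a}" using facet_cases by metis
        then show False using \<gamma>(2) r by (auto simp: facets_def)
      qed
      then show "r \<in> common_part" using r \<gamma>(1) by (auto simp: common_part_def subcomplex_def)
    qed
    have same: "f' ` realization \<gamma> = f ` realization \<gamma>" if "\<gamma> \<subseteq> common_part" for \<gamma>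
      by (rule image_cong[OF refl], rule unchanged_on_common_part) (use that in \<open>auto simp: realization_def\<close>)
    have c: "\<gamma>\<^sub>1 \<subseteq> common_part" "\<gamma>\<^sub>2 \<subseteq> common_part" using common s 3 by auto
    then have "\<gamma>\<^sub>1 \<subseteq> KY" "\<gamma>\<^sub>2 \<subseteq> KY" using mem_KY by auto
    then have "{\<gamma>\<^sub>1, \<gamma>\<^sub>2} \<in> sphere_pairs n KY"
      using s unfolding sphere_pairs_def subcomplex_def by blast
    then show ?thesis using lk same[OF c(1)] same[OF c(2)] by metis
  qed
qed

end

theorem theorem1p5:
  fixes n :: nat and K :: "'v::finite set set" and A :: "'v set" and x :: 'v
  assumes "n \<ge> 1"
    and "is_n_complex n K"
    and "card A = n + 2"
    and "subcomplex (simplex_boundary A) K"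
    and "x \<notin> \<Union>K"
    and "CARD('d::finite) = 2 * n + 1"
    and "\<forall>f' :: real ^ 'v \<Rightarrow> real ^ 'd. pl_embedding (realization K) f' \<longrightarrow>
           (\<exists>\<gamma>\<^sub>1 \<gamma>\<^sub>2. {\<gamma>\<^sub>1, \<gamma>\<^sub>2} \<in> sphere_pairs n K \<and>
              lk2 (f' ` realization \<gamma>\<^sub>1) (f' ` realization \<gamma>\<^sub>2) = 1)"
  shows "\<forall>f :: real ^ 'v \<Rightarrow> real ^ 'd. pl_embedding (realization (Delta_Y_exchange n A x K)) f \<longrightarrow>
           (\<exists>\<gamma>\<^sub>1 \<gamma>\<^sub>2. {\<gamma>\<^sub>1, \<gamma>\<^sub>2} \<in> sphere_pairs n (Delta_Y_exchange n A x K) \<and>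
              lk2 (f ` realization \<gamma>\<^sub>1) (f ` realization \<gamma>\<^sub>2) = 1)"
proof (intro allI impI)
  fix f :: "real ^ 'v \<Rightarrow> real ^ 'd"
  assume f: "pl_embedding (realization (Delta_Y_exchange n A x K)) f"
  then obtain V where V: "geometric V" "body V = realization (Delta_Y_exchange n A x K)"
    "\<And>s. s \<in> V \<Longrightarrow> affine_on_simplex s f" "inj_on f (body V)"
    unfolding pl_embedding_def pl_map_on_iff_geometric by auto
  interpret mapped_Y n K A x V f
    by unfold_locales (use assms(1-6) V in auto)
  obtain \<delta> f' where "perturbed_Y n K A x V f \<delta> f'" using exists_perturbed by blast
  then interpret perturbed_Y n K A x V f \<delta> f' .
  obtain \<gamma>\<^sub>1 \<gamma>\<^sub>2 where "{\<gamma>\<^sub>1, \<gamma>\<^sub>2} \<in> sphere_pairs n K"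
    "lk2 (f' ` realization \<gamma>\<^sub>1) (f' ` realization \<gamma>\<^sub>2) = 1"
    using assms(7) pl_embedding' by blast
  then show "\<exists>\<gamma>\<^sub>1 \<gamma>\<^sub>2. {\<gamma>\<^sub>1, \<gamma>\<^sub>2} \<in> sphere_pairs n (Delta_Y_exchange n A x K) \<and>
      lk2 (f ` realization \<gamma>\<^sub>1) (f ` realization \<gamma>\<^sub>2) = 1"
    by (rule exists_linked_pair)
qed

end
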